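(* Let $M$ be a closed $R$-oriented Riemannian manifold. For the type $(\chi,k,\ell)=(0,1,1)$ and a cocycle $W\in C^0(S,S-s)$ representing the diffuse intersection class $\Omega$, the string topology operation $$\mathcal{ST}_W(p^{-1}\eta\otimes -):C_*(LM)\to C_{*+1}(LM)$$ coincides with the chain-level Batalin--Vilkovisky operator $\Delta$.
   Context: $R$ is a commutative ring with identity (coefficients); $d=\dim M$. **BV operator.** $S^1$ is the standard circle $[0,1]/(0\sim1)$, $LM$ is the space of continuous maps $S^1\to M$, $\mathfrak r:S^1\times LM\to LM$ is $\mathfrak r(u,\gamma)(t)=\gamma(u+t \bmod 1)$, and $\eta$ is the singular $1$-chain of $S^1$ given by the defining map $[0,1]\to S^1$. The chain-level Batalin--Vilkovisky operator $\Delta$ is the composite $C_i(LM)\xrightarrow{\eta\otimes}C_1(S^1)\otimes C_i(LM)\xrightarrow{EZ}C_{i+1}(S^1\times LM)\xrightarrow{\mathfrak r_*}C_{i+1}(LM)$, with $EZ$ the Eilenberg--Zilber shuffle map. **The map $p$.** String diagrams (defined below) in $\mathcal{SD}(0,1,1)$ have one $Q_1$, one $L_1$ and no trees (and an orientation is no data). With $in$, $out$ the input and output boundary cycles, $p:\mathcal{SD}(0,1,1)\to S^1$ is the homeomorphism $p(\Gamma)=\partial_{in}^{-1}\bar\partial_{out}(0)$ (the position on $Q_1$ of the vertex of $L_1$ relative to the vertex of $Q_1$), and $p^{-1}\eta$ is the singular $1$-cycle in $\mathcal{SD}(0,1,1)$ corresponding to $\eta$ under $p$. The general definitions of $\mathcal{SD}$,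 $S$, $s$, $\mathcal{ST}_W$, $\Omega$, for a fixed type $(\chi,k,\ell)$, are as follows. **Graphs.** A graph is $(V,H,s,\iota)$ with $V$ (vertices) and $H$ (half-edges) finite, $s:H\to V$ surjective (source) and $\iota$ a fixed-point-free involution of $H$; an edge is an orbit of $\iota$. The valence of $v$ is $|s^{-1}(v)|$; a leaf is a univalent vertex, other vertices are internal; a leaf half-edge is a half-edge whose source is a leaf; an external edge is an edge containing a leaf half-edge, other edges are internal. A tree is a nonempty connected graph with no cycle subgraph (a cycle is a nonempty connected graph with all vertices bivalent); a segment is a tree with one edge. The Euler characteristic is the number of vertices minus the number of edges. A fatgraph is a graph with a cyclic order on each $s^{-1}(v)$. A pseudometric (fat)graph has a nonnegative length function on edges; its length $\|\cdot\|$ is the sum of its edge lengths. Contracting an edge $e$ (not a segment component) deletes its half-edges and identifies their sources, giving $G/e$ with induced structures. The vertex explosion of $G$ at $v$ replaces $v$ by the univalent vertices $\{v\}\times s^{-1}(v)$, one for each half-edge at $v$. The pseudometric realization $|G|$ is the metric space glued from an interval of length $\ell(e)$ for each edge $e$ by identifying endpoints with vertices (so zero-length edges collapse to points). A boundary cycle of a fatgraph is a cycle of half-edges $h_1,\dots,h_n$ such that $h_{i+1}$ follows $\iota(h_i)$ in the cyclic order at $s(h_{i+1})$. A marking of a boundary cycle is a leaf whose leaf half-edge appears in it (its external edge must have length zero in the pseudometric case). A marked fatgraph is one where each boundary cycle contains exactly one marking. The standard circle of length $L$ is $[0,L]/(0\sim L)$; standard circles of different lengths are identified by linear scaling. For a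 boundary cycle $C=(h_1,\dots,h_n)$ with exactly one marking $v$ and $h_1$ the leaf half-edge of $v$, $\partial_C$ is the map from the standard circle of length $L$ (the sum of the lengths of the edges of $h_1,\dots,h_n$) to $|G|$ traversing at unit speed the oriented edges $(h_i,\iota(h_i))$ in order, starting at $v$ (constant if $L=0$); $\bar\partial_C(t)=\partial_C(L-t)$. A fat lollipop is a connected fatgraph with one external edge, joining a leaf to a trivalent vertex, and all other vertices bivalent; its marked boundary cycle is the one containing the leaf half-edge. **Trees.** The leaf length of a tree $T$ is one less than its number of leaves; $L(T)$ is its set of leaves. For a half-edge $h$ of $T$ whose source is at least trivalent, the branch $T_h$ is the maximal subtree containing $h$ in which $s(h)$ is a leaf, and the pollard $T^h$ is the maximal subtree containing no edge of $T_h$. A branch of a pseudometric tree is prunable if its length equals its leaf length. A pseudometric tree $T$ is short branched if its length equals its leaf length and every branch $T_h$ has length at most its leaf length. **String diagrams.** A combinatorial string diagram is a connected marked fatgraph $\Gamma$ without bivalent vertices with subgraphs $Q_1,\dots,Q_k$, $L_1,\dots,L_\ell$ and $\{\widetilde T_j\}$ ($j$ in a finite set), each edge in precisely one of them, and a subset of the internal vertices of each $\widetilde T_j$ called fundamental, such that: each $Q_i$ is a fat lollipop whose inclusion preserves its marked boundary cycle; each $L_i$ is a segment precisely one of whose leaves is a leaf of $\Gamma$; no $\widetilde T_j$ contains a leaf of $\Gamma$; each internal vertex of $\Gamma$ is either contained in precisely one $Q_i$, or is disjoint from all $Q_i$ and fundamental in precisely one $\widetilde T_j$; the vertex explosion $T_j$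 of $\widetilde T_j$ at its non-fundamental vertices is a fatgraph tree; and there is no cyclic sequence $\widetilde T_{j_1},\dots,\widetilde T_{j_m}=\widetilde T_{j_1}$ in which each $\widetilde T_{j_i}$ has a fundamental vertex which is a non-fundamental vertex of $\widetilde T_{j_{i+1}}$. (The map $T_j\to\Gamma$ determines $\widetilde T_j$ and its fundamental vertices, which are the internal vertices of $T_j$.) The $k$ boundary cycles induced by the marked boundary cycles of the $Q_i$ are input boundary cycles $C_1,\dots,C_k$; the other $\ell$ are output boundary cycles. A string diagram is a combinatorial string diagram with a pseudometric structure in which each $Q_i$ has total length one and each $T_j$ is short branched. The intersection graph $\widehat\Gamma$ is the union of the $\widetilde T_j$, exploded at all vertices lying in the $Q_i$. $\mathcal T=\{T_j\}$; $\mathcal L$ is the disjoint union of the leaf sets $L(T_j)$. An ordering is an ordering of $\mathcal T$ together with one of $\mathcal L$; an orientation is an ordering modulo pairs of permutations with product of signs $+1$ (no data if there are no trees). The type is $(\chi,k,\ell)$ with $\chi$ the Euler characteristic of $\Gamma$, which equals $|\mathcal T|-|\mathcal L|\le 0$. **Contraction and pruning of string diagrams.** Let $e$ be an internal edge of length zero. $\Gamma/e$ has underlying fatgraph $\Gamma/e$; if $e$ lies in $Q_i$, or is an internal edge of $T_j$ or an external edge of $T_j$ whose internal vertex is bivalent in $T_j$, contract $e$ in $Q_i$ or $T_j$. If $e$ is an external edge of $T_j$ whose internal vertex $v$ is at least trivalent in $T_j$, contract $e$ in $T_j$, explode at the identified vertex, and replace $T_j$ by the resulting components $T_a$. If $T_h$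 is a prunable branch of $T_j$, the pruning $\Gamma\setminus h$ has the same pseudometric fatgraph with $T_j$ replaced by $T^h$ and $T_h$. Induced orientations: evident in the first cases; in the exploding case, put $T_j$ first in $\mathcal T$, replace it by $T_a^1,\dots,T_a^{|v|-1}$ in any order, put their new leaves $\ell_a^2,\dots,\ell_a^{|v|-1}$ in order at the beginning of $\mathcal L$ and replace the leaf of $e$ by $\ell_a^1$; for pruning, put $T_j$ first, replace it by $(T^h,T_h)$ and add the leaf $s(h)$ of $T_h$ at the beginning of $\mathcal L$. **The space $\mathcal{SD}$.** For an oriented combinatorial string diagram, the set $K$ of string diagrams on it is a bounded convex polytope via internal edge lengths. $\mathcal{SD}$ is the cell complex whose cells are these polytopes $K$ (one per isomorphism class of oriented combinatorial string diagram), the attaching maps identifying $\Gamma$ in a codimension one face of $K$ with $\Gamma/e$ (if an internal edge $e$ has length zero) or $\Gamma\setminus h$ (if a branch $T_h$ is prunable), with induced orientation. $\mathcal{SD}(\chi,k,\ell)$ is the subcomplex of type $(\chi,k,\ell)$, abbreviated $\mathcal{SD}$ below. For a face $\widehat{K'}$ of $K$, identified by $\alpha:\widehat{K'}\cong K'$ with a cell $K'$, $K'$ is called a degeneration of $K$; in codimension one it is a contraction or a pruning degeneration. **Straightening.** Let $T$ be a short-branched tree and $v\in|T|$. The $v$-zero cells of $|T|$ are the images of vertices of $T$ and $v$. For distinct $v$-zero cells, $T(v_i,v_j)$ is the closure of the component of $|T|-v_i$ containing $v_j$, and $D(v_i,v_j)$ is the number of leaves of $T$ with image in $T(v_i,v_j)-v_i$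 minus the length of $T(v_i,v_j)$. For a leaf $w$, with $v=v_1,\dots,v_n=|w|$ the sequence of distinct $v$-zero cells from $v$ to the image $|w|$ of $w$, $a(v,w)=\prod_{i=1}^{n-1}\frac{D(v_i,v_{i+1})}{1-D(v_{i+1},v_i)}$. The straightening $\mathrm{str}:|T|\to\Delta_{L(T)}$ has barycentric coordinates $a(v,w)$, where $\Delta_F$ is the simplex spanned by the finite set $F$. For a component $C$ of $\widehat\Gamma$ with leaf set $L(C)$, $\mathrm{str}:|C|\to\Delta_{L(C)}$ is defined inductively on the trees $T_j$ of $C$ (a tree is treated once each of its leaves maps to a leaf of $C$ or into the image of earlier trees): $|T_j|\to\Delta_{L(T_j)}\to\Delta_{L(C)}$, the second map being the linear extension of the already determined images of the leaves of $T_j$. **Interpolation.** The pre-convexity radius is $r=\frac12\min\{\mathrm{inj}(M),\pi/\sqrt{\Delta}\}$, where $\mathrm{inj}(M)$ is the injectivity radius, $\Delta$ (here) the supremum of sectional curvatures, and $\pi/\sqrt\Delta=\infty$ if $\Delta\le0$. For a finite set $F$ and an $r$-ball $B\subset M$, $\Upsilon_F:B^F\times\Delta_F\to B$ is the smooth simplicial geodesic interpolation: $\Upsilon_F(f,t)$ is the Riemannian center of mass of the points $f(w)$ with weights $t_w$ (the minimizer in $B$ of $x\mapsto\sum_w t_w d(x,f(w))^2$); it is independent of the choice of $B$ containing $f(F)$. **$S$, $s$ and $\Theta$.** $\gamma\in LM^k$ is regarded as a map $\sqcup|Q_i|\to M$ via the maps $\partial_{C_i}$. Let $\iota$ be the natural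 map from leaves of $\widehat\Gamma$ to $\sqcup|Q_i|$. $\gamma$ is $\varepsilon$-Lipschitz with respect to $\Gamma$ if $d(\gamma(\iota(a)),\gamma(\iota(b)))<\varepsilon\, d_{|\widehat\Gamma|}(a,b)$ for all pairs of leaves $a\neq b$ in the same component of $\widehat\Gamma$. $S\subset\mathcal{SD}\times LM^k$ is the set of $(\Gamma,\gamma)$ with $\gamma$ $\frac{r}{|\chi|}$-Lipschitz with respect to $\Gamma$; $s\subset S$ the set where it is $\frac{r}{2|\chi|}$-Lipschitz (no condition if $\chi=0$, as there are then no trees). For $(\Gamma,\gamma)\in S$, $\Theta(\Gamma,\gamma):|\Gamma|\to M$ extends $\gamma$ by $x\mapsto\Upsilon_{L(C)}(\gamma\circ\iota,\mathrm{str}(x))$ on each component $|C|$ of $|\widehat\Gamma|$ (and is constant along each $L_i$, which has length zero). Let $\heartsuit(\Gamma,\gamma)=(\Gamma,\Theta(\Gamma,\gamma))$, and $\rho_{out}(\Gamma,\Theta)\in LM^\ell$ the pullback of $\Theta$ along the maps $\bar\partial_C$, $C$ ranging over output boundary cycles; $\rho_{out}\circ\heartsuit:S\to LM^\ell$ is continuous. **Push-pull map.** Singular chains with coefficients in $R$. For a cochain $W\in C^{|W|}(S,S-s)$, $\mathcal{ST}_W:C_*(\mathcal{SD})\otimes C_*(LM)^{\otimes k}\to C_*(LM)^{\otimes\ell}$ is the composite: the Eilenberg--Zilber shuffle map to $C_*(\mathcal{SD}\times LM^k)$; the quotient to $C_*(\mathcal{SD}\times LM^k,\mathcal{SD}\times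 LM^k-s)$; a fixed chain homotopy inverse (the standard one by iterated barycentric subdivision; the identity when $S=\mathcal{SD}\times LM^k$) of the excision inclusion of $C_*(S,S-s)$; cap product with $W$, to $C_{*-|W|}(S)$; the map induced by $\rho_{out}\circ\heartsuit$ to $C_{*-|W|}(LM^\ell)$; and the Alexander--Whitney map to $C_*(LM)^{\otimes\ell}$. **The stratified pair.** For a cell $K$, $N_K\subset M^{\mathcal L}$ is the set of $f:\mathcal L\to M$ sending each $L(T_j)$ into an $r$-ball, and $n_K\subset N_K$ the set of $f$ sending each $L(T_j)$ into a ball of radius $\frac{\|T_j\|}{|\chi|^2}\frac r4$ (both are a point if there are no trees). For $J\subset K$, $\mathcal N(J;K)=(J\times N_K,J\times(N_K-n_K))$. For a codimension one degeneration $K'$ there is a natural injection $\xi:\mathcal L_K\to\mathcal L_{K'}$ of leaf sets, bijective for a contraction degeneration and missing only the leaf $w=s(h)$ of $T_h$ for a pruning degeneration. $\nabla:\mathcal N(\widehat{K'};K)\to\mathcal N(K';K')$ is $(\Gamma,f)\mapsto(\alpha(\Gamma),\Psi(\Gamma,f))$, where $\Psi(\Gamma,f)=f\xi^{-1}$ on the image of $\xi$ and, for pruning of $T_j$, $\Psi(\Gamma,f)(w)=\Upsilon_{L(T_j)}(f|_{L(T_j)},\mathrm{str}(|w|))$ with $w=s(h)$ viewed as a vertex of $T_j$. Compositions define $\nabla$ for higher codimension. $\mathcal N(\mathcal{SD})$ is the coequalizer of $\coprod_{K',K}\mathcal N(\widehat{K'};K)\rightrightarrows\coprod_K\mathcal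 N(K;K)$ (pairs with $K'$ a codimension one degeneration of $K$), the two maps being inclusion into $\mathcal N(K;K)$ and $\nabla$ into $\mathcal N(K';K')$. **Diffuse intersection class.** For a $0$-cell $p$ (all $T_j$ are segments, $|\mathcal T|=|\chi|$, $|\mathcal L|=2|\chi|$) with an order representing its orientation, $[M^{\mathcal T}]$ and $[M^{\mathcal L}]$ are the ordered products of fundamental classes, $[N_p]$ is the image of $[M^{\mathcal L}]$ in $H_{2|\chi|d}(M^{\mathcal L},M^{\mathcal L}-n_p)\cong H_{2|\chi|d}(N_p,N_p-n_p)$, and $\omega_p\in H^{|\chi|d}(N_p,N_p-n_p)=H^{|\chi|d}(\mathcal N(p;p))$ is Poincaré--Lefschetz dual (via cap product with $[N_p]$) to the image of $[M^{\mathcal T}]$ under the diagonal $M^{\mathcal T}\to N_p$. For a cell $K$ with vertex $\widehat p$, $\omega_K$ is the pullback of $\omega_p$ along $\mathcal N(K;K)\to\mathcal N(\widehat p;K)\xrightarrow{\nabla}\mathcal N(p;p)$ (independent of $\widehat p$). The global Thom class $\omega\in H^{|\chi|d}(\mathcal N(\mathcal{SD}))$ is the unique class pulling back to every $\omega_K$. The evaluation map $ev:(S,S-s)\to\mathcal N(\mathcal{SD})$ sends $(\Gamma,\gamma)$, with $\Gamma$ in the cell $K$, to $(\Gamma,\Theta(\Gamma,\gamma)|_{\mathcal L})$, restriction along $\mathcal L\to|\Gamma|$. $\Omega=ev^*(\omega)\in H^{|\chi|d}(S,S-s)$. *)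

theory Defs
  imports "HOL-Analysis.Analysis" "HOL-Homology.Homology" "HOL-Combinatorics.Permutations"
begin

section \<open>Quotient spaces, the circle and loop spaces\<close>

definition quotient_space :: "'a topology \<Rightarrow> ('a \<Rightarrow> 'b) \<Rightarrow> 'b topology" where
  "quotient_space X q = topology (\<lambda>U. U \<subseteq> q ` topspace X \<and> openin X {x \<in> topspace X. q x \<in> U})"

lemma openin_quotient_space:
  "openin (quotient_space X q) U \<longleftrightarrow> U \<subseteq> q ` topspace X \<and> openin X {x \<in> topspace X. q x \<in> U}"
proof -
  let ?L = "\<lambda>U. U \<subseteq> q ` topspace X \<and> openin X {x \<in> topspace X. q x \<in> U}"
  have "istopology ?L"
    unfolding istopology_def
  proof (intro conjI allI impI)
    fix S T assume "?L S" "?L T"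
    moreover have "{x \<in> topspace X. q x \<in> S \<inter> T}
        = {x \<in> topspace X. q x \<in> S} \<inter> {x \<in> topspace X. q x \<in> T}" by auto
    ultimately show "S \<inter> T \<subseteq> q ` topspace X" "openin X {x \<in> topspace X. q x \<in> S \<inter> T}"
      by auto
  next
    fix \<K> assume \<K>: "\<forall>K\<in>\<K>. ?L K"
    then show "\<Union>\<K> \<subseteq> q ` topspace X" by blast
    have "{x \<in> topspace X. q x \<in> \<Union>\<K>} = (\<Union>K\<in>\<K>. {x \<in> topspace X. q x \<in> K})" by auto
    with \<K> show "openin X {x \<in> topspace X. q x \<in> \<Union>\<K>}" by auto
  qed
  then show ?thesis by (simp add: quotient_space_def)
qed

lemma topspace_quotient_space: "topspace (quotient_space X q) = q ` topspace X"
proof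
  show "topspace (quotient_space X q) \<subseteq> q ` topspace X"
    using openin_quotient_space openin_topspace by metis
  have "{x \<in> topspace X. q x \<in> q ` topspace X} = topspace X" by auto
  then have "openin (quotient_space X q) (q ` topspace X)"
    by (simp add: openin_quotient_space)
  then show "q ` topspace X \<subseteq> topspace (quotient_space X q)" by (rule openin_subset)
qed

lemma quotient_map_quotient_space: "quotient_map X (quotient_space X q) q"
  by (simp add: quotient_map_def topspace_quotient_space openin_quotient_space)

text \<open>The circle \<open>[0,1]/(0 \<sim> 1)\<close>: the points are represented by \<open>[0,1)\<close>, and \<open>frac\<close> is the
  quotient map. Standard circles of any length are identified with it by linear scaling.\<close>

definition circle :: "real topology" where
  "circle = quotient_space (top_of_set {0..1}) frac"

definition loop_set :: "'a topology \<Rightarrow> (real \<Rightarrow> 'a) set" where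
  "loop_set X = {\<gamma>. continuous_map circle X \<gamma> \<and> \<gamma> \<in> extensional {0..<1}}"

definition LM :: "'a topology \<Rightarrow> (real \<Rightarrow> 'a) topology" where
  "LM X = topology_generated_by
     {{\<gamma> \<in> loop_set X. \<gamma> ` K \<subseteq> U} | K U. compactin circle K \<and> openin X U}"

definition LMpow :: "nat \<Rightarrow> 'a topology \<Rightarrow> (nat \<Rightarrow> real \<Rightarrow> 'a) topology" where
  "LMpow k X = product_topology (\<lambda>_. LM X) {..<k}"


section \<open>Singular chains and cochains with coefficients\<close>

text \<open>A basis element of the total singular complex is a singular simplex tagged by its dimension.
  Integral formulas on basis elements are extended linearly over the coefficient ring by \<open>rlin\<close>.\<close>

type_synonym 'a gsimp = "nat \<times> ((nat \<Rightarrow> real) \<Rightarrow> 'a)"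
type_synonym ('a, 'r) gchain = "'a gsimp \<Rightarrow>\<^sub>0 'r"

definition scl :: "'r::comm_ring_1 \<Rightarrow> ('a \<Rightarrow>\<^sub>0 'r) \<Rightarrow> ('a \<Rightarrow>\<^sub>0 'r)" where
  "scl a c = Poly_Mapping.map (\<lambda>z. a * z) c"

definition rlin :: "('a \<Rightarrow> ('b \<Rightarrow>\<^sub>0 int)) \<Rightarrow> ('a \<Rightarrow>\<^sub>0 'r::comm_ring_1) \<Rightarrow> ('b \<Rightarrow>\<^sub>0 'r)" where
  "rlin f c = (\<Sum>a\<in>Poly_Mapping.keys c.
      Poly_Mapping.map (\<lambda>z. of_int z * Poly_Mapping.lookup c a) (f a))"

definition gsing :: "'a topology \<Rightarrow> 'a gsimp set" where
  "gsing X = {(n, \<sigma>). singular_simplex n X \<sigma>}"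

definition gchains :: "'a topology \<Rightarrow> ('a, 'r::comm_ring_1) gchain set" where
  "gchains X = {c. Poly_Mapping.keys c \<subseteq> gsing X}"

definition gchains_deg :: "nat \<Rightarrow> 'a topology \<Rightarrow> ('a, 'r::comm_ring_1) gchain set" where
  "gchains_deg n X = {c. Poly_Mapping.keys c \<subseteq> {n} \<times> singular_simplex_set n X}"

definition tag :: "nat \<Rightarrow> 'a chain \<Rightarrow> ('a gsimp \<Rightarrow>\<^sub>0 int)" where
  "tag n = frag_extend (\<lambda>\<sigma>. frag_of (n, \<sigma>))"

definition gbd :: "'a gsimp \<Rightarrow> ('a gsimp \<Rightarrow>\<^sub>0 int)" where
  "gbd = (\<lambda>(n, \<sigma>). tag (n - 1) (chain_boundary n (frag_of \<sigma>)))"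

definition gmap :: "('a \<Rightarrow> 'b) \<Rightarrow> 'a gsimp \<Rightarrow> 'b gsimp" where
  "gmap f = (\<lambda>(n, \<sigma>). (n, simplex_map n f \<sigma>))"

definition push :: "('a \<Rightarrow> 'b) \<Rightarrow> ('a, 'r::comm_ring_1) gchain \<Rightarrow> ('b, 'r) gchain" where
  "push f = rlin (\<lambda>s. frag_of (gmap f s))"

definition rel_cycle :: "nat \<Rightarrow> 'a topology \<Rightarrow> 'a set \<Rightarrow> ('a, 'r::comm_ring_1) gchain \<Rightarrow> bool" where
  "rel_cycle n X A c \<longleftrightarrow> c \<in> gchains_deg n X \<and> rlin gbd c \<in> gchains_deg (n - 1) (subtopology X A)"

definition homol :: "nat \<Rightarrow> 'a topology \<Rightarrow> 'a set \<Rightarrow> ('a, 'r::comm_ring_1) gchain \<Rightarrow>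
    ('a, 'r) gchain \<Rightarrow> bool" where
  "homol n X A c c' \<longleftrightarrow>
     (\<exists>b\<in>gchains_deg (Suc n) X. c - c' - rlin gbd b \<in> gchains_deg n (subtopology X A))"

type_synonym ('a, 'r) cochain = "'a gsimp \<Rightarrow> 'r"

definition cpair :: "('a, 'r::comm_ring_1) cochain \<Rightarrow> ('a, 'r) gchain \<Rightarrow> 'r" where
  "cpair u c = (\<Sum>s\<in>Poly_Mapping.keys c. Poly_Mapping.lookup c s * u s)"

definition cobd :: "('a, 'r::comm_ring_1) cochain \<Rightarrow> ('a, 'r) cochain" where
  "cobd u s = cpair u (rlin gbd (Poly_Mapping.single s 1))"

definition rel_cochain :: "nat \<Rightarrow> 'a topology \<Rightarrow> 'a set \<Rightarrow> ('a, 'r::comm_ring_1) cochain \<Rightarrow> bool" where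
  "rel_cochain n X A u \<longleftrightarrow> (\<forall>\<sigma>. singular_simplex n (subtopology X A) \<sigma> \<longrightarrow> u (n, \<sigma>) = 0)"

definition rel_cocycle :: "nat \<Rightarrow> 'a topology \<Rightarrow> 'a set \<Rightarrow> ('a, 'r::comm_ring_1) cochain \<Rightarrow> bool" where
  "rel_cocycle n X A u \<longleftrightarrow> rel_cochain n X A u \<and>
     (\<forall>\<sigma>. singular_simplex (Suc n) X \<sigma> \<longrightarrow> cobd u (Suc n, \<sigma>) = 0)"

definition cohomologous :: "nat \<Rightarrow> 'a topology \<Rightarrow> 'a set \<Rightarrow> ('a, 'r::comm_ring_1) cochain \<Rightarrow>
    ('a, 'r) cochain \<Rightarrow> bool" where
  "cohomologous n X A u u' \<longleftrightarrow>
     (if n = 0 then (\<forall>\<sigma>. singular_simplex 0 X \<sigma> \<longrightarrow> u (0, \<sigma>) = u' (0, \<sigma>))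
      else (\<exists>v. rel_cochain (n - 1) X A v \<and>
              (\<forall>\<sigma>. singular_simplex n X \<sigma> \<longrightarrow> u (n, \<sigma>) - u' (n, \<sigma>) = cobd v (n, \<sigma>))))"

definition pullb :: "('a \<Rightarrow> 'b) \<Rightarrow> ('b, 'r) cochain \<Rightarrow> ('a, 'r) cochain" where
  "pullb f u s = u (gmap f s)"

text \<open>The face of a simplex spanned by the vertices \<open>a, \<dots>, b\<close>.\<close>

definition seg :: "nat \<Rightarrow> nat \<Rightarrow> ((nat \<Rightarrow> real) \<Rightarrow> 'a) \<Rightarrow> (nat \<Rightarrow> real) \<Rightarrow> 'a" where
  "seg a b \<sigma> = restrict (\<lambda>x. \<sigma> (\<lambda>i. if a \<le> i then x (i - a) else 0)) (standard_simplex (b - a))"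

text \<open>Cap product with a cochain of degree \<open>q\<close>, evaluated on front faces.\<close>

definition capp :: "nat \<Rightarrow> ('a, 'r::comm_ring_1) cochain \<Rightarrow> ('a, 'r) gchain \<Rightarrow> ('a, 'r) gchain" where
  "capp q u c = (\<Sum>s\<in>Poly_Mapping.keys c. case s of (n, \<sigma>) \<Rightarrow>
     if q \<le> n then Poly_Mapping.single (n - q, seg q n \<sigma>)
                   (Poly_Mapping.lookup c s * u (q, seg 0 q \<sigma>)) else 0)"


subsection \<open>Tensor products, Eilenberg--Zilber and Alexander--Whitney\<close>

text \<open>The free module on lists (pairs) of basis elements is the tensor product.\<close>

primrec tens :: "('a \<Rightarrow>\<^sub>0 'r::comm_ring_1) list \<Rightarrow> ('a list \<Rightarrow>\<^sub>0 'r)" where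
  "tens [] = Poly_Mapping.single [] 1"
| "tens (c # cs) = (\<Sum>a\<in>Poly_Mapping.keys c. \<Sum>as\<in>Poly_Mapping.keys (tens cs).
     Poly_Mapping.single (a # as) (Poly_Mapping.lookup c a * Poly_Mapping.lookup (tens cs) as))"

definition tens2 :: "('a \<Rightarrow>\<^sub>0 'r::comm_ring_1) \<Rightarrow> ('b \<Rightarrow>\<^sub>0 'r) \<Rightarrow> ('a \<times> 'b \<Rightarrow>\<^sub>0 'r)" where
  "tens2 c e = (\<Sum>a\<in>Poly_Mapping.keys c. \<Sum>b\<in>Poly_Mapping.keys e.
     Poly_Mapping.single (a, b) (Poly_Mapping.lookup c a * Poly_Mapping.lookup e b))"

text \<open>A shuffle of factors of dimensions \<open>ns\<close> is a lattice path, given by the word listing which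
  factor advances at each step. The \<open>i\<close>-th projection of the corresponding simplex of the prism is
  the degeneracy \<open>degen c i\<close>, sending the vertex \<open>j\<close> to the number of advances of factor \<open>i\<close> among
  the first \<open>j\<close> steps. The sign of the shuffle permutation counts inversions of the word.\<close>

definition shuffle_words :: "nat list \<Rightarrow> nat list set" where
  "shuffle_words ns = {c. set c \<subseteq> {..<length ns} \<and> (\<forall>i<length ns. count_list c i = ns ! i)}"

definition shuffle_sgn :: "nat list \<Rightarrow> int" where
  "shuffle_sgn c = (-1) ^ card {(a, b). a < b \<and> b < length c \<and> c ! a > c ! b}"

definition degen :: "nat list \<Rightarrow> nat \<Rightarrow> (nat \<Rightarrow> real) \<Rightarrow> (nat \<Rightarrow> real)" where
  "degen c i x = (\<lambda>m. \<Sum>j\<in>{j. j \<le> length c \<and> count_list (take j c) i = m}. x j)"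

definition ez2 :: "'a gsimp \<times> 'b gsimp \<Rightarrow> (('a \<times> 'b) gsimp \<Rightarrow>\<^sub>0 int)" where
  "ez2 = (\<lambda>(a, b). \<Sum>c\<in>shuffle_words [fst a, fst b]. frag_cmul (shuffle_sgn c)
     (frag_of (length c, restrict (\<lambda>x. (snd a (degen c 0 x), snd b (degen c 1 x)))
                          (standard_simplex (length c)))))"

definition ez_sd :: "nat \<Rightarrow> 'a gsimp \<times> 'b gsimp list \<Rightarrow> (('a \<times> (nat \<Rightarrow> 'b)) gsimp \<Rightarrow>\<^sub>0 int)" where
  "ez_sd k = (\<lambda>(a, bs). \<Sum>c\<in>shuffle_words (fst a # map fst bs). frag_cmul (shuffle_sgn c)
     (frag_of (length c,
        restrict (\<lambda>x. (snd a (degen c 0 x), \<lambda>i\<in>{..<k}. snd (bs ! i) (degen c (Suc i) x)))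
          (standard_simplex (length c)))))"

text \<open>The cross product into a product indexed by the entries of a distinct list \<open>js\<close>, ordered as in
  the list.\<close>

definition ez_idx :: "nat list \<Rightarrow> 'a gsimp list \<Rightarrow> ((nat \<Rightarrow> 'a) gsimp \<Rightarrow>\<^sub>0 int)" where
  "ez_idx js bs = (\<Sum>c\<in>shuffle_words (map fst bs). frag_cmul (shuffle_sgn c)
     (frag_of (length c,
        restrict (\<lambda>x. \<lambda>j\<in>set js. let i = (THE i. i < length js \<and> js ! i = j)
                                  in snd (bs ! i) (degen c i x))
          (standard_simplex (length c)))))"

definition aw :: "nat \<Rightarrow> (nat \<Rightarrow> 'a) gsimp \<Rightarrow> ('a gsimp list \<Rightarrow>\<^sub>0 int)" where
  "aw l = (\<lambda>(n, \<tau>). \<Sum>cs\<in>{cs. length cs = Suc l \<and> sorted cs \<and> cs ! 0 = 0 \<and> cs ! l = n}.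
     frag_of (map (\<lambda>i. (cs ! Suc i - cs ! i, seg (cs ! i) (cs ! Suc i) (\<lambda>x. \<tau> x i))) [0..<l]))"


subsection \<open>The standard excision homotopy inverse\<close>

text \<open>For \<open>S, B \<subseteq> X\<close> with interiors covering \<open>X\<close>: the operator
  \<open>\<rho> = 1 - \<partial>D - D\<partial>\<close>, \<open>D \<sigma> = \<Sum>i<m(\<sigma>). T (sd\<^sup>i \<sigma>)\<close>, where \<open>m(\<sigma>)\<close> is the least number of barycentric
  subdivisions making \<open>\<sigma>\<close> small, and \<open>T\<close> is the standard homotopy with \<open>\<partial>T + T\<partial> = 1 - sd\<close>. The
  library constant \<open>subd\<close> has the opposite sign. If \<open>S = X\<close> then every \<open>m(\<sigma>)\<close> is zero and
  \<open>\<rho>\<close> is the identity. Finally simplices not lying in \<open>S\<close> (hence lying in \<open>B\<close>) are discarded.\<close>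

definition gsd :: "'a gsimp \<Rightarrow> ('a gsimp \<Rightarrow>\<^sub>0 int)" where
  "gsd = (\<lambda>(n, \<sigma>). tag n (singular_subdivision n (frag_of \<sigma>)))"

definition gprism :: "'a gsimp \<Rightarrow> ('a gsimp \<Rightarrow>\<^sub>0 int)" where
  "gprism = (\<lambda>(n, \<sigma>). - tag (Suc n)
      (chain_map (Suc n) \<sigma> (subd n (frag_of (restrict id (standard_simplex n))))))"

definition in_set :: "'a set \<Rightarrow> 'a gsimp \<Rightarrow> bool" where
  "in_set A = (\<lambda>(n, \<sigma>). \<sigma> ` standard_simplex n \<subseteq> A)"

definition subdiv_num :: "'a set \<Rightarrow> 'a set \<Rightarrow> 'a gsimp \<Rightarrow> nat" where
  "subdiv_num S B s =
     (LEAST m. \<forall>t\<in>Poly_Mapping.keys ((frag_extend gsd ^^ m) (frag_of s)). in_set S t \<or> in_set B t)"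

definition exc_D :: "'a set \<Rightarrow> 'a set \<Rightarrow> 'a gsimp \<Rightarrow> ('a gsimp \<Rightarrow>\<^sub>0 int)" where
  "exc_D S B s =
     (\<Sum>i<subdiv_num S B s. frag_extend gprism ((frag_extend gsd ^^ i) (frag_of s)))"

definition exc_rho :: "'a set \<Rightarrow> 'a set \<Rightarrow> 'a gsimp \<Rightarrow> ('a gsimp \<Rightarrow>\<^sub>0 int)" where
  "exc_rho S B s = frag_of s - frag_extend gbd (exc_D S B s) - frag_extend (exc_D S B) (gbd s)"

definition exc_inverse :: "'a set \<Rightarrow> 'a set \<Rightarrow> 'a gsimp \<Rightarrow> ('a gsimp \<Rightarrow>\<^sub>0 int)" where
  "exc_inverse S B s = frag_extend (\<lambda>t. if in_set S t then frag_of t else 0) (exc_rho S B s)"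


section \<open>The Batalin--Vilkovisky operator\<close>

definition rot :: "real \<times> (real \<Rightarrow> 'a) \<Rightarrow> (real \<Rightarrow> 'a)" where
  "rot = (\<lambda>(u, \<gamma>). \<lambda>t\<in>{0..<1}. \<gamma> (frac (u + t)))"

text \<open>The interval is identified with the standard 1-simplex by \<open>t \<mapsto> (1 - t, t)\<close>.\<close>

definition eta :: "(real, 'r::comm_ring_1) gchain" where
  "eta = Poly_Mapping.single (1, \<lambda>x\<in>standard_simplex 1. frac (x 1)) 1"

definition BV :: "(real \<Rightarrow> 'a, 'r::comm_ring_1) gchain \<Rightarrow> (real \<Rightarrow> 'a, 'r) gchain" where
  "BV c = push rot (rlin ez2 (tens2 eta c))"


section \<open>Riemannian manifolds\<close>

text \<open>Charts take values in the open subsets of the \<open>d\<close>-dimensional Euclidean space of sequences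
  vanishing from index \<open>d\<close> on. The metric is given by its coefficient functions in each chart.\<close>

type_synonym vec = "nat \<Rightarrow> real"
type_synonym 'm chart = "'m set \<times> ('m \<Rightarrow> vec)"

record 'm riem =
  mtop :: "'m topology"
  mdim :: nat
  atlas :: "'m chart set"
  gram :: "'m chart \<Rightarrow> vec \<Rightarrow> nat \<Rightarrow> nat \<Rightarrow> real"

definition pdiff :: "nat \<Rightarrow> (vec \<Rightarrow> real) \<Rightarrow> vec \<Rightarrow> real" where
  "pdiff i f x = deriv (\<lambda>t. f (x(i := t))) (x i)"

definition smooth :: "nat \<Rightarrow> vec set \<Rightarrow> (vec \<Rightarrow> real) \<Rightarrow> bool" where
  "smooth d V f \<longleftrightarrow> (\<forall>is. set is \<subseteq> {..<d} \<longrightarrow>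
      continuous_map (subtopology (Euclidean_space d) V) euclideanreal (fold pdiff is f) \<and>
      (\<forall>i<d. \<forall>x\<in>V. (\<lambda>t. fold pdiff is f (x(i := t))) field_differentiable at (x i)))"

definition chart_inv :: "'m chart \<Rightarrow> vec \<Rightarrow> 'm" where
  "chart_inv c = inv_into (fst c) (snd c)"

definition riemannian :: "'m riem \<Rightarrow> bool" where
  "riemannian M \<longleftrightarrow> (let X = mtop M; d = mdim M; A = atlas M in
     Hausdorff_space X \<and> second_countable X \<and>
     (\<forall>c\<in>A. openin X (fst c) \<and> openin (Euclidean_space d) (snd c ` fst c) \<and>
        homeomorphic_map (subtopology X (fst c))
          (subtopology (Euclidean_space d) (snd c ` fst c)) (snd c)) \<and>
     (\<Union>c\<in>A. fst c) = topspace X \<and>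
     (\<forall>c\<in>A. \<forall>e\<in>A. \<forall>k<d.
        smooth d (snd c ` (fst c \<inter> fst e)) (\<lambda>x. snd e (chart_inv c x) k)) \<and>
     (\<forall>c\<in>A. (\<forall>i<d. \<forall>j<d. smooth d (snd c ` fst c) (\<lambda>x. gram M c x i j)) \<and>
        (\<forall>x\<in>snd c ` fst c. (\<forall>i<d. \<forall>j<d. gram M c x i j = gram M c x j i) \<and>
           (\<forall>v. (\<exists>i<d. v i \<noteq> 0) \<longrightarrow> (\<Sum>i<d. \<Sum>j<d. gram M c x i j * v i * v j) > 0))) \<and>
     (\<forall>c\<in>A. \<forall>e\<in>A. \<forall>x\<in>snd c ` (fst c \<inter> fst e). \<forall>i<d. \<forall>j<d.
        (let \<tau> = (\<lambda>a y. snd e (chart_inv c y) a) in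
         gram M c x i j = (\<Sum>a<d. \<Sum>b<d.
           gram M e (snd e (chart_inv c x)) a b * pdiff i (\<tau> a) x * pdiff j (\<tau> b) x))))"

definition closed_riemannian :: "'m riem \<Rightarrow> bool" where
  "closed_riemannian M \<longleftrightarrow> riemannian M \<and> compact_space (mtop M)"

definition inner_at :: "'m riem \<Rightarrow> 'm chart \<Rightarrow> vec \<Rightarrow> vec \<Rightarrow> vec \<Rightarrow> real" where
  "inner_at M c x u v = (\<Sum>i<mdim M. \<Sum>j<mdim M. gram M c x i j * u i * v j)"

text \<open>Piecewise \<open>C\<^sup>1\<close> curves from \<open>x\<close> to \<open>y\<close> of length \<open>L\<close>, as concatenations of \<open>C\<^sup>1\<close> curves each
  contained in a chart domain.\<close>

inductive curve_length :: "'m riem \<Rightarrow> 'm \<Rightarrow> 'm \<Rightarrow> real \<Rightarrow> bool" for M where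
  curve_const: "x \<in> topspace (mtop M) \<Longrightarrow> curve_length M x x 0"
| curve_append: "\<lbrakk>curve_length M x y L; e \<in> atlas M; y \<in> fst e;
     \<And>t. t \<in> {0..1} \<Longrightarrow> p t \<in> snd e ` fst e; p 0 = snd e y;
     \<And>i t. \<lbrakk>i < mdim M; t \<in> {0..1}\<rbrakk> \<Longrightarrow>
        ((\<lambda>t. p t i) has_real_derivative p' t i) (at t within {0..1});
     \<And>i. i < mdim M \<Longrightarrow> continuous_on {0..1} (\<lambda>t. p' t i)\<rbrakk> \<Longrightarrow>
   curve_length M x (chart_inv e (p 1))
     (L + integral {0..1} (\<lambda>t. sqrt (inner_at M e (p t) (p' t) (p' t))))"

definition rdist :: "'m riem \<Rightarrow> 'm \<Rightarrow> 'm \<Rightarrow> ereal" where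
  "rdist M x y = (INF L\<in>{L. curve_length M x y L}. ereal L)"

definition rball :: "'m riem \<Rightarrow> 'm \<Rightarrow> ereal \<Rightarrow> 'm set" where
  "rball M x \<rho> = {y \<in> topspace (mtop M). rdist M x y < \<rho>}"

definition gram_inv :: "'m riem \<Rightarrow> 'm chart \<Rightarrow> vec \<Rightarrow> nat \<Rightarrow> nat \<Rightarrow> real" where
  "gram_inv M c x = (SOME h. \<forall>i<mdim M. \<forall>k<mdim M.
      (\<Sum>j<mdim M. gram M c x i j * h j k) = (if i = k then 1 else 0))"

definition christoffel :: "'m riem \<Rightarrow> 'm chart \<Rightarrow> nat \<Rightarrow> nat \<Rightarrow> nat \<Rightarrow> vec \<Rightarrow> real" where
  "christoffel M c k i j x = (\<Sum>l<mdim M. gram_inv M c x k l *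
     (pdiff i (\<lambda>y. gram M c y j l) x + pdiff j (\<lambda>y. gram M c y i l) x
        - pdiff l (\<lambda>y. gram M c y i j) x)) / 2"

text \<open>\<open>R(\<partial>\<^sub>i, \<partial>\<^sub>j) \<partial>\<^sub>k = \<Sum>l. curv l i j k \<partial>\<^sub>l\<close>\<close>

definition curv :: "'m riem \<Rightarrow> 'm chart \<Rightarrow> nat \<Rightarrow> nat \<Rightarrow> nat \<Rightarrow> nat \<Rightarrow> vec \<Rightarrow> real" where
  "curv M c l i j k x =
     pdiff i (christoffel M c l j k) x - pdiff j (christoffel M c l i k) x
     + (\<Sum>m<mdim M. christoffel M c l i m x * christoffel M c m j k x
                  - christoffel M c l j m x * christoffel M c m i k x)"

definition area_sq :: "'m riem \<Rightarrow> 'm chart \<Rightarrow> vec \<Rightarrow> vec \<Rightarrow> vec \<Rightarrow> real" where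
  "area_sq M c x u v =
     inner_at M c x u u * inner_at M c x v v - (inner_at M c x u v)\<^sup>2"

definition sec_curv :: "'m riem \<Rightarrow> 'm chart \<Rightarrow> vec \<Rightarrow> vec \<Rightarrow> vec \<Rightarrow> real" where
  "sec_curv M c x u v =
     (\<Sum>i<mdim M. \<Sum>j<mdim M. \<Sum>k<mdim M. \<Sum>l<mdim M. \<Sum>p<mdim M.
        gram M c x l p * curv M c l i j k x * u i * v j * v k * u p) / area_sq M c x u v"

definition max_curv :: "'m riem \<Rightarrow> ereal" where
  "max_curv M = Sup {ereal (sec_curv M c x u v) | c x u v.
      c \<in> atlas M \<and> x \<in> snd c ` fst c \<and> area_sq M c x u v \<noteq> 0}"

definition geodesic :: "'m riem \<Rightarrow> (real \<Rightarrow> 'm) \<Rightarrow> bool" where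
  "geodesic M \<gamma> \<longleftrightarrow> continuous_map euclideanreal (mtop M) \<gamma> \<and>
     (\<forall>c\<in>atlas M. \<forall>t. \<gamma> t \<in> fst c \<longrightarrow> (\<forall>k<mdim M.
        let u = (\<lambda>i s. snd c (\<gamma> s) i) in
        u k field_differentiable at t \<and>
        (deriv (u k) has_real_derivative
          - (\<Sum>i<mdim M. \<Sum>j<mdim M.
               christoffel M c k i j (snd c (\<gamma> t)) * deriv (u i) t * deriv (u j) t)) (at t)))"

text \<open>The exponential map at \<open>x\<close>, in the coordinates of tangent vectors given by a chart at \<open>x\<close>.\<close>

definition rexp :: "'m riem \<Rightarrow> 'm chart \<Rightarrow> 'm \<Rightarrow> vec \<Rightarrow> 'm" where
  "rexp M c x v = (THE y. \<exists>\<gamma>. geodesic M \<gamma> \<and> \<gamma> 0 = x \<and> \<gamma> 1 = y \<and>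
      (\<forall>k<mdim M. deriv (\<lambda>t. snd c (\<gamma> t) k) 0 = v k))"

definition diffeo_onto_image :: "'m riem \<Rightarrow> vec set \<Rightarrow> (vec \<Rightarrow> 'm) \<Rightarrow> bool" where
  "diffeo_onto_image M V E \<longleftrightarrow> inj_on E V \<and> openin (mtop M) (E ` V) \<and>
     homeomorphic_map (subtopology (Euclidean_space (mdim M)) V) (subtopology (mtop M) (E ` V)) E \<and>
     (\<forall>c\<in>atlas M. \<forall>k<mdim M.
        smooth (mdim M) {v\<in>V. E v \<in> fst c} (\<lambda>v. snd c (E v) k) \<and>
        smooth (mdim M) (snd c ` (fst c \<inter> E ` V)) (\<lambda>y. inv_into V E (chart_inv c y) k))"

definition inj_radius_at :: "'m riem \<Rightarrow> 'm \<Rightarrow> ereal" where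
  "inj_radius_at M x = Sup {ereal \<rho> | \<rho>. \<rho> > 0 \<and> (\<forall>c\<in>atlas M. x \<in> fst c \<longrightarrow>
      diffeo_onto_image M
        {v \<in> topspace (Euclidean_space (mdim M)). inner_at M c (snd c x) v v < \<rho>\<^sup>2} (rexp M c x))}"

definition inj_radius :: "'m riem \<Rightarrow> ereal" where
  "inj_radius M = (INF x\<in>topspace (mtop M). inj_radius_at M x)"

definition preconvexity_radius :: "'m riem \<Rightarrow> ereal" where
  "preconvexity_radius M = ereal (1/2) *
     min (inj_radius M)
         (if max_curv M \<le> 0 then \<infinity> else ereal (pi / sqrt (real_of_ereal (max_curv M))))"

text \<open>Riemannian center of mass of the points \<open>f w\<close>, \<open>w \<in> F\<close>, with weights \<open>t w\<close>.\<close>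

definition interpolation :: "'m riem \<Rightarrow> nat set \<Rightarrow> (nat \<Rightarrow> 'm) \<Rightarrow> (nat \<Rightarrow> real) \<Rightarrow> 'm" where
  "interpolation M F f t = (THE x. \<exists>z\<in>topspace (mtop M).
     let B = rball M z (preconvexity_radius M);
         E = (\<lambda>y. \<Sum>w\<in>F. ereal (t w) * (rdist M y (f w))\<^sup>2)
     in f ` F \<subseteq> B \<and> x \<in> B \<and> (\<forall>y\<in>B. E x \<le> E y))"


subsection \<open>Orientations\<close>

text \<open>An \<open>R\<close>-orientation assigns to each point a generator of the local homology in a locally
  consistent way; classes are represented by relative cycles.\<close>

definition R_orientation :: "'m riem \<Rightarrow> ('m \<Rightarrow> ('m, 'r::comm_ring_1) gchain) \<Rightarrow> bool" where
  "R_orientation M \<mu> \<longleftrightarrow> (let X = mtop M; d = mdim M in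
     (\<forall>x\<in>topspace X. rel_cycle d X (topspace X - {x}) (\<mu> x) \<and>
        (\<forall>z. rel_cycle d X (topspace X - {x}) z \<longrightarrow>
           (\<exists>a. homol d X (topspace X - {x}) z (scl a (\<mu> x))))) \<and>
     (\<forall>x\<in>topspace X. \<exists>U c. openin X U \<and> x \<in> U \<and> rel_cycle d X (topspace X - U) c \<and>
        (\<forall>y\<in>U. homol d X (topspace X - {y}) c (\<mu> y))))"

definition fundamental_cycle ::
  "'m riem \<Rightarrow> ('m \<Rightarrow> ('m, 'r::comm_ring_1) gchain) \<Rightarrow> ('m, 'r) gchain \<Rightarrow> bool" where
  "fundamental_cycle M \<mu> z \<longleftrightarrow> rel_cycle (mdim M) (mtop M) {} z \<and>
     (\<forall>x\<in>topspace (mtop M). homol (mdim M) (mtop M) (topspace (mtop M) - {x}) z (\<mu> x))"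


section \<open>Fatgraphs\<close>

record 'v fgraph =
  verts :: "'v set"
  hedges :: "nat set"
  src :: "nat \<Rightarrow> 'v"
  opp :: "nat \<Rightarrow> nat"
  nxt :: "nat \<Rightarrow> nat"

definition fatgraph :: "'v fgraph \<Rightarrow> bool" where
  "fatgraph G \<longleftrightarrow> finite (verts G) \<and> finite (hedges G) \<and> src G ` hedges G = verts G \<and>
     (\<forall>h\<in>hedges G. opp G h \<in> hedges G \<and> opp G h \<noteq> h \<and> opp G (opp G h) = h) \<and>
     bij_betw (nxt G) (hedges G) (hedges G) \<and>
     (\<forall>h\<in>hedges G. \<forall>h'\<in>hedges G. src G h = src G h' \<longleftrightarrow> (\<exists>n. (nxt G ^^ n) h = h'))"

definition valence :: "'v fgraph \<Rightarrow> 'v \<Rightarrow> nat" where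
  "valence G v = card {h \<in> hedges G. src G h = v}"

text \<open>Leaves are encoded by their leaf half-edges, to which they correspond bijectively.\<close>

definition leaf_hedges :: "'v fgraph \<Rightarrow> nat set" where
  "leaf_hedges G = {h \<in> hedges G. valence G (src G h) = 1}"

definition adj :: "'v fgraph \<Rightarrow> ('v \<times> 'v) set" where
  "adj G = {(src G h, src G (opp G h)) | h. h \<in> hedges G}"

definition conn :: "'v fgraph \<Rightarrow> bool" where
  "conn G \<longleftrightarrow> verts G \<noteq> {} \<and> (\<forall>v\<in>verts G. \<forall>w\<in>verts G. (v, w) \<in> (adj G)\<^sup>*)"

text \<open>Since sources are surjective, subgraphs correspond to sets of half-edges closed under \<open>opp\<close>.\<close>

definition hclosed :: "'v fgraph \<Rightarrow> nat set \<Rightarrow> bool" where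
  "hclosed G A \<longleftrightarrow> A \<subseteq> hedges G \<and> opp G ` A \<subseteq> A"

definition subgraph :: "'v fgraph \<Rightarrow> nat set \<Rightarrow> 'v fgraph" where
  "subgraph G A = \<lparr>verts = src G ` A, hedges = A, src = src G, opp = opp G,
     nxt = (\<lambda>h. (nxt G ^^ (LEAST n. n > 0 \<and> (nxt G ^^ n) h \<in> A)) h)\<rparr>"

definition cycle_graph :: "'v fgraph \<Rightarrow> bool" where
  "cycle_graph G \<longleftrightarrow> conn G \<and> (\<forall>v\<in>verts G. valence G v = 2)"

definition is_tree :: "'v fgraph \<Rightarrow> bool" where
  "is_tree G \<longleftrightarrow> conn G \<and> \<not> (\<exists>A. hclosed G A \<and> cycle_graph (subgraph G A))"

definition is_segment :: "'v fgraph \<Rightarrow> bool" where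
  "is_segment G \<longleftrightarrow> is_tree G \<and> card (hedges G) = 2"

definition explode :: "'v fgraph \<Rightarrow> 'v set \<Rightarrow> ('v + 'v \<times> nat) fgraph" where
  "explode G W = \<lparr>
     verts = Inl ` (verts G - W) \<union> Inr ` {(src G h, h) | h. h \<in> hedges G \<and> src G h \<in> W},
     hedges = hedges G,
     src = (\<lambda>h. if src G h \<in> W then Inr (src G h, h) else Inl (src G h)),
     opp = opp G,
     nxt = (\<lambda>h. if src G h \<in> W then h else nxt G h)\<rparr>"

text \<open>Contraction of the edge of \<open>h\<close>; the identified vertex keeps the name of the source of \<open>h\<close>.\<close>

definition contract :: "'v fgraph \<Rightarrow> nat \<Rightarrow> 'v fgraph" where
  "contract G h = (let h' = opp G h in \<lparr>
     verts = verts G - {src G h'},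
     hedges = hedges G - {h, h'},
     src = (\<lambda>y. if src G y = src G h' then src G h else src G y),
     opp = opp G,
     nxt = (\<lambda>y. let z = nxt G y in
        if z = h then (if nxt G h' = h' then nxt G h else nxt G h')
        else if z = h' then (if nxt G h = h then nxt G h' else nxt G h)
        else z)\<rparr>)"

definition bstep :: "'v fgraph \<Rightarrow> nat \<Rightarrow> nat" where
  "bstep G h = nxt G (opp G h)"

definition marked :: "'v fgraph \<Rightarrow> bool" where
  "marked G \<longleftrightarrow> (\<forall>h\<in>hedges G. \<exists>!a. a \<in> leaf_hedges G \<and> (\<exists>n. a = (bstep G ^^ n) h))"

definition fat_lollipop :: "'v fgraph \<Rightarrow> bool" where
  "fat_lollipop G \<longleftrightarrow> fatgraph G \<and> conn G \<and>
     (\<exists>h\<in>hedges G. valence G (src G h) = 1 \<and> valence G (src G (opp G h)) = 3 \<and>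
        (\<forall>v\<in>verts G. v \<noteq> src G h \<longrightarrow> v \<noteq> src G (opp G h) \<longrightarrow> valence G v = 2))"

definition euler_char :: "'v fgraph \<Rightarrow> int" where
  "euler_char G = int (card (verts G)) - int (card (hedges G) div 2)"


subsection \<open>Pseudometric graphs and their realization\<close>

type_synonym lens = "nat \<Rightarrow> real"

definition pseudometric :: "'v fgraph \<Rightarrow> lens \<Rightarrow> bool" where
  "pseudometric G L \<longleftrightarrow> (\<forall>h\<in>hedges G. L h \<ge> 0 \<and> L (opp G h) = L h) \<and> (\<forall>h. h \<notin> hedges G \<longrightarrow> L h = 0)"

text \<open>Total length of the edges of an \<open>opp\<close>-closed set of half-edges.\<close>

definition tot_len :: "lens \<Rightarrow> nat set \<Rightarrow> real" where
  "tot_len L A = (\<Sum>h\<in>A. L h) / 2"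

type_synonym gpt = "(nat \<times> real) set"

text \<open>The pair \<open>(h, t)\<close> is the point at distance \<open>t\<close> from the source of \<open>h\<close> on the edge of \<open>h\<close>.\<close>

definition prepts :: "'v fgraph \<Rightarrow> lens \<Rightarrow> (nat \<times> real) set" where
  "prepts G L = {(h, t). h \<in> hedges G \<and> 0 \<le> t \<and> t \<le> L h}"

inductive pglue :: "'v fgraph \<Rightarrow> lens \<Rightarrow> nat \<times> real \<Rightarrow> nat \<times> real \<Rightarrow> bool" for G L where
  flip: "(h, t) \<in> prepts G L \<Longrightarrow> pglue G L (h, t) (opp G h, L h - t)"
| ends: "\<lbrakk>h \<in> hedges G; h' \<in> hedges G; src G h = src G h'\<rbrakk> \<Longrightarrow> pglue G L (h, 0) (h', 0)"

definition rpt :: "'v fgraph \<Rightarrow> lens \<Rightarrow> nat \<times> real \<Rightarrow> gpt" where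
  "rpt G L p = {q \<in> prepts G L. equivclp (pglue G L) p q}"

definition realization :: "'v fgraph \<Rightarrow> lens \<Rightarrow> gpt topology" where
  "realization G L =
     quotient_space (sum_topology (\<lambda>h. top_of_set {0..L h}) (hedges G)) (rpt G L)"

inductive gwalk :: "'v fgraph \<Rightarrow> lens \<Rightarrow> gpt \<Rightarrow> gpt \<Rightarrow> real \<Rightarrow> bool" for G L where
  stay: "p \<in> prepts G L \<Longrightarrow> gwalk G L (rpt G L p) (rpt G L p) 0"
| move: "\<lbrakk>gwalk G L P (rpt G L (h, t)) a; (h, t) \<in> prepts G L; (h, t') \<in> prepts G L\<rbrakk> \<Longrightarrow>
     gwalk G L P (rpt G L (h, t')) (a + \<bar>t' - t\<bar>)"

definition gdist :: "'v fgraph \<Rightarrow> lens \<Rightarrow> gpt \<Rightarrow> gpt \<Rightarrow> real" where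
  "gdist G L P Q = Inf {a. gwalk G L P Q a}"

text \<open>The parametrized boundary cycle with marking \<open>h\<close>; the parameter circle is scaled to length 1.\<close>

definition bcycle :: "'v fgraph \<Rightarrow> nat \<Rightarrow> nat list" where
  "bcycle G h = map (\<lambda>i. (bstep G ^^ i) h) [0..<(LEAST n. n > 0 \<and> (bstep G ^^ n) h = h)]"

definition bdry :: "'v fgraph \<Rightarrow> lens \<Rightarrow> nat \<Rightarrow> real \<Rightarrow> gpt" where
  "bdry G L h t = (let hs = bcycle G h; s = sum_list (map L hs) * t;
      i = (LEAST i. s \<le> sum_list (map L (take (Suc i) hs)))
    in rpt G L (hs ! i, s - sum_list (map L (take i hs))))"

definition bdry_bar :: "'v fgraph \<Rightarrow> lens \<Rightarrow> nat \<Rightarrow> real \<Rightarrow> gpt" where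
  "bdry_bar G L h t = bdry G L h (frac (1 - t))"


subsection \<open>Trees\<close>

definition leaf_length :: "'v fgraph \<Rightarrow> real" where
  "leaf_length T = real (card (leaf_hedges T)) - 1"

definition branch :: "'v fgraph \<Rightarrow> nat \<Rightarrow> nat set" where
  "branch T h = \<Union>{A. hclosed T A \<and> is_tree (subgraph T A) \<and> h \<in> A \<and> valence (subgraph T A) (src T h) = 1}"

definition prunable :: "'v fgraph \<Rightarrow> lens \<Rightarrow> nat \<Rightarrow> bool" where
  "prunable T L h \<longleftrightarrow> h \<in> hedges T \<and> valence T (src T h) \<ge> 3 \<and>
     tot_len L (branch T h) = leaf_length (subgraph T (branch T h))"

definition short_branched :: "'v fgraph \<Rightarrow> lens \<Rightarrow> bool" where
  "short_branched T L \<longleftrightarrow> tot_len L (hedges T) = leaf_length T \<and>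
     (\<forall>h\<in>hedges T. valence T (src T h) \<ge> 3 \<longrightarrow>
        tot_len L (branch T h) \<le> leaf_length (subgraph T (branch T h)))"


subsection \<open>Straightening of a short-branched tree\<close>

definition zero_cells :: "'v fgraph \<Rightarrow> lens \<Rightarrow> gpt \<Rightarrow> gpt set" where
  "zero_cells T L v = insert v {rpt T L (h, 0) | h. h \<in> hedges T}"

definition cell_list :: "'v fgraph \<Rightarrow> lens \<Rightarrow> gpt \<Rightarrow> gpt \<Rightarrow> gpt list" where
  "cell_list T L v w = (THE zs.
     set zs = {u \<in> zero_cells T L v. gdist T L v u + gdist T L u w = gdist T L v w} \<and>
     sorted_wrt (\<lambda>a b. gdist T L v a < gdist T L v b) zs)"

definition subtree_at :: "'v fgraph \<Rightarrow> lens \<Rightarrow> gpt \<Rightarrow> gpt \<Rightarrow> gpt set" where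
  "subtree_at T L p q = realization T L closure_of
     (connected_component_of_set (subtopology (realization T L) (topspace (realization T L) - {p})) q)"

definition set_len :: "'v fgraph \<Rightarrow> lens \<Rightarrow> gpt set \<Rightarrow> real" where
  "set_len T L A = (\<Sum>h\<in>hedges T. measure lebesgue {t \<in> {0..L h}. rpt T L (h, t) \<in> A}) / 2"

definition Dnum :: "'v fgraph \<Rightarrow> lens \<Rightarrow> gpt \<Rightarrow> gpt \<Rightarrow> real" where
  "Dnum T L p q =
     real (card {h \<in> leaf_hedges T. rpt T L (h, 0) \<in> subtree_at T L p q - {p}})
     - set_len T L (subtree_at T L p q)"

definition str_tree :: "'v fgraph \<Rightarrow> lens \<Rightarrow> gpt \<Rightarrow> nat \<Rightarrow> real" where
  "str_tree T L v w = (let zs = cell_list T L v (rpt T L (w, 0)) in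
     \<Prod>i<length zs - 1.
       Dnum T L (zs ! i) (zs ! Suc i) / (1 - Dnum T L (zs ! Suc i) (zs ! i)))"


section \<open>String diagrams\<close>

text \<open>An oriented combinatorial string diagram, with an ordering representing its orientation.
  The subgraphs are given by their sets of half-edges; \<open>trees\<close> lists the subgraphs
  \<open>T\<^sub>j\<close> (before explosion) with their sets of fundamental vertices, in the order of the trees, and
  \<open>lvs\<close> lists all leaves of the exploded trees.\<close>

record diagram =
  gam :: "nat fgraph"
  lolls :: "nat set list"
  segs :: "nat set list"
  trees :: "(nat set \<times> nat set) list"
  lvs :: "nat list"

definition tree_of :: "diagram \<Rightarrow> nat \<Rightarrow> (nat + nat \<times> nat) fgraph" where
  "tree_of D j = (case trees D ! j of (A, F) \<Rightarrow>
     explode (subgraph (gam D) A) (src (gam D) ` A - F))"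

definition loll_verts :: "diagram \<Rightarrow> nat set" where
  "loll_verts D = (\<Union>Q\<in>set (lolls D). src (gam D) ` Q)"

definition comb_diagram :: "int \<Rightarrow> nat \<Rightarrow> nat \<Rightarrow> diagram \<Rightarrow> bool" where
  "comb_diagram chi k l D \<longleftrightarrow> (let G = gam D; parts = lolls D @ segs D @ map fst (trees D) in
     fatgraph G \<and> conn G \<and> marked G \<and> (\<forall>v\<in>verts G. valence G v \<noteq> 2) \<and>
     euler_char G = chi \<and> length (lolls D) = k \<and> length (segs D) = l \<and>
     (\<forall>A\<in>set parts. hclosed G A) \<and> \<Union>(set parts) = hedges G \<and>
     (\<forall>i<length parts. \<forall>j<i. parts ! i \<inter> parts ! j = {}) \<and>
     (\<forall>Q\<in>set (lolls D). fat_lollipop (subgraph G Q) \<and>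
        (\<forall>a\<in>leaf_hedges (subgraph G Q). \<forall>h\<in>set (bcycle (subgraph G Q) a).
           bstep G h = bstep (subgraph G Q) h)) \<and>
     (\<forall>A\<in>set (segs D). is_segment (subgraph G A) \<and> card (A \<inter> leaf_hedges G) = 1) \<and>
     (\<forall>j<length (trees D). let (A, F) = trees D ! j in
        A \<inter> leaf_hedges G = {} \<and>
        F \<subseteq> {v \<in> src G ` A. valence (subgraph G A) v \<noteq> 1} \<and>
        is_tree (tree_of D j)) \<and>
     (\<forall>v\<in>verts G. valence G v \<noteq> 1 \<longrightarrow>
        (\<exists>!i. i < k \<and> v \<in> src G ` (lolls D ! i)) \<and> (\<forall>(A, F)\<in>set (trees D). v \<notin> F)
        \<or> v \<notin> loll_verts D \<and> (\<exists>!j. j < length (trees D) \<and> v \<in> snd (trees D ! j))) \<and>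
     acyclic {(i, j). i < length (trees D) \<and> j < length (trees D) \<and>
        (\<exists>v. v \<in> snd (trees D ! i) \<and>
             v \<in> src G ` fst (trees D ! j) - snd (trees D ! j))} \<and>
     distinct (lvs D) \<and> set (lvs D) = (\<Union>j<length (trees D). leaf_hedges (tree_of D j)))"

definition is_string_diagram :: "diagram \<Rightarrow> lens \<Rightarrow> bool" where
  "is_string_diagram D L \<longleftrightarrow> pseudometric (gam D) L \<and>
     (\<forall>h\<in>leaf_hedges (gam D). L h = 0) \<and>
     (\<forall>Q\<in>set (lolls D). tot_len L Q = 1) \<and>
     (\<forall>j<length (trees D). short_branched (tree_of D j) L)"

text \<open>The polytope \<open>K\<close> of string diagrams on a combinatorial string diagram.\<close>

definition cell :: "diagram \<Rightarrow> lens set" where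
  "cell D = {L. is_string_diagram D L}"

text \<open>Orientation preserving isomorphisms: \<open>\<pi>\<close> and \<open>\<tau>\<close> compare the orderings of trees and leaves.\<close>

definition diagram_iso :: "(nat \<Rightarrow> nat) \<Rightarrow> diagram \<Rightarrow> diagram \<Rightarrow> bool" where
  "diagram_iso \<phi> D D' \<longleftrightarrow> (\<exists>\<psi> \<pi> \<tau>. let G = gam D; G' = gam D' in
     bij_betw \<phi> (hedges G) (hedges G') \<and> bij_betw \<psi> (verts G) (verts G') \<and>
     (\<forall>h\<in>hedges G. src G' (\<phi> h) = \<psi> (src G h) \<and> opp G' (\<phi> h) = \<phi> (opp G h) \<and>
        nxt G' (\<phi> h) = \<phi> (nxt G h)) \<and>
     lolls D' = map ((`) \<phi>) (lolls D) \<and> segs D' = map ((`) \<phi>) (segs D) \<and>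
     length (trees D') = length (trees D) \<and> length (lvs D') = length (lvs D) \<and>
     \<pi> permutes {..<length (trees D)} \<and> \<tau> permutes {..<length (lvs D)} \<and>
     (\<forall>j<length (trees D). trees D' ! \<pi> j = (\<phi> ` fst (trees D ! j), \<psi> ` snd (trees D ! j))) \<and>
     (\<forall>i<length (lvs D). lvs D' ! \<tau> i = \<phi> (lvs D ! i)) \<and>
     sign \<pi> * sign \<tau> = 1)"

definition contract_diagram ::
  "diagram \<Rightarrow> nat \<Rightarrow> (nat set \<times> nat set) list \<Rightarrow> nat list \<Rightarrow> diagram" where
  "contract_diagram D h ts ls = \<lparr>gam = contract (gam D) h,
     lolls = map (\<lambda>A. A - {h, opp (gam D) h}) (lolls D), segs = segs D, trees = ts, lvs = ls\<rparr>"

definition internal_edge :: "'v fgraph \<Rightarrow> nat \<Rightarrow> bool" where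
  "internal_edge G h \<longleftrightarrow> h \<in> hedges G \<and> h \<notin> leaf_hedges G \<and> opp G h \<notin> leaf_hedges G"

definition tree_contract :: "diagram \<Rightarrow> nat \<Rightarrow> nat \<Rightarrow> (nat set \<times> nat set) list" where
  "tree_contract D j h = (trees D)[j := (fst (trees D ! j) - {h, opp (gam D) h},
                                         snd (trees D ! j) - {src (gam D) (opp (gam D) h)})]"

text \<open>Contractions of an internal edge of length zero onto a codimension one face. In
  \<open>contract_external\<close> the half-edge \<open>h\<close> is the leaf half-edge of an external edge of the tree, and
  \<open>x\<close> is the other half-edge at its bivalent internal vertex. The last argument is the
  correspondence of leaves.\<close>

inductive contraction :: "diagram \<Rightarrow> lens \<Rightarrow> diagram \<Rightarrow> (nat \<Rightarrow> nat) \<Rightarrow> bool" for D L where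
  contract_loll: "\<lbrakk>internal_edge (gam D) h; L h = 0; Q \<in> set (lolls D); h \<in> Q\<rbrakk> \<Longrightarrow>
     contraction D L (contract_diagram D h (trees D) (lvs D)) id"
| contract_internal: "\<lbrakk>internal_edge (gam D) h; L h = 0; j < length (trees D);
     h \<in> fst (trees D ! j); src (gam D) h \<in> snd (trees D ! j);
     src (gam D) (opp (gam D) h) \<in> snd (trees D ! j)\<rbrakk> \<Longrightarrow>
     contraction D L (contract_diagram D h (tree_contract D j h) (lvs D)) id"
| contract_external: "\<lbrakk>internal_edge (gam D) h; L h = 0; j < length (trees D);
     h \<in> fst (trees D ! j); src (gam D) h \<notin> snd (trees D ! j);
     src (gam D) (opp (gam D) h) \<in> snd (trees D ! j);
     {x \<in> fst (trees D ! j). src (gam D) x = src (gam D) (opp (gam D) h)} = {opp (gam D) h, x};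
     x \<noteq> opp (gam D) h; \<xi> = id(h := x)\<rbrakk> \<Longrightarrow>
     contraction D L (contract_diagram D h (tree_contract D j h) (map \<xi> (lvs D))) \<xi>"

text \<open>Contraction of an external edge with an at least trivalent internal vertex explodes the tree
  into the branches at that vertex. The tree is assumed to come first, which can be achieved by an
  isomorphism. The face where such an edge has length zero has codimension at least two, and the
  resulting identification is a composition of prunings and contractions.\<close>

inductive explosion :: "diagram \<Rightarrow> lens \<Rightarrow> diagram \<Rightarrow> bool" for D L where
  "\<lbrakk>internal_edge (gam D) h; L h = 0; trees D = (A, F) # ts; h \<in> A;
    src (gam D) h \<notin> F; v = src (gam D) (opp (gam D) h); v \<in> F;
    distinct xs; set xs = {x \<in> A. src (gam D) x = v \<and> x \<noteq> opp (gam D) h}; length xs \<ge> 2\<rbrakk> \<Longrightarrow>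
    explosion D L (contract_diagram D h
      (map (\<lambda>x. (branch (tree_of D 0) x, F \<inter> src (gam D) ` branch (tree_of D 0) x - {v})) xs @ ts)
      (tl xs @ map (id(h := hd xs)) (lvs D)))"

text \<open>Pruning at \<open>h\<close> of the first tree; the pollard consists of the edges not in the branch, and
  \<open>h\<close> encodes the new leaf of the branch.\<close>

inductive pruning :: "diagram \<Rightarrow> lens \<Rightarrow> nat \<Rightarrow> diagram \<Rightarrow> bool" for D L where
  "\<lbrakk>trees D = (A, F) # ts; prunable (tree_of D 0) L h; B = branch (tree_of D 0) h\<rbrakk> \<Longrightarrow>
    pruning D L h (D\<lparr>trees := (A - B, F \<inter> src (gam D) ` (A - B))
                            # (B, F \<inter> src (gam D) ` B - {src (gam D) h}) # ts,
                     lvs := h # lvs D\<rparr>)"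

text \<open>The gluing of the polytopes, including the identification of isomorphic ones. Contractions and
  prunings do not change the lengths of the remaining edges.\<close>

inductive sd_glue :: "diagram \<times> lens \<Rightarrow> diagram \<times> lens \<Rightarrow> bool" where
  "\<lbrakk>diagram_iso \<phi> D D'; \<And>h. h \<in> hedges (gam D) \<Longrightarrow> L' (\<phi> h) = L h\<rbrakk> \<Longrightarrow> sd_glue (D, L) (D', L')"
| "contraction D L D' \<xi> \<Longrightarrow> sd_glue (D, L) (D', L)"
| "explosion D L D' \<Longrightarrow> sd_glue (D, L) (D', L)"
| "pruning D L h D' \<Longrightarrow> sd_glue (D, L) (D', L)"

definition sd_points :: "int \<Rightarrow> nat \<Rightarrow> nat \<Rightarrow> (diagram \<times> lens) set" where
  "sd_points chi k l = {(D, L). comb_diagram chi k l D \<and> L \<in> cell D}"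

definition sd_class :: "int \<Rightarrow> nat \<Rightarrow> nat \<Rightarrow> diagram \<times> lens \<Rightarrow> (diagram \<times> lens) set" where
  "sd_class chi k l x = {y \<in> sd_points chi k l.
     equivclp (\<lambda>a b. a \<in> sd_points chi k l \<and> b \<in> sd_points chi k l \<and> sd_glue a b) x y}"

definition SD :: "int \<Rightarrow> nat \<Rightarrow> nat \<Rightarrow> (diagram \<times> lens) set topology" where
  "SD chi k l = quotient_space
     (sum_topology (\<lambda>D. top_of_set (cell D)) {D. comb_diagram chi k l D}) (sd_class chi k l)"

text \<open>The constructions below are invariant under the gluing, so that they can be evaluated on
  any representative.\<close>

definition sd_rep :: "(diagram \<times> lens) set \<Rightarrow> diagram \<times> lens" where
  "sd_rep c = (SOME x. x \<in> c)"

definition in_mark :: "diagram \<Rightarrow> nat \<Rightarrow> nat" where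
  "in_mark D i = (THE h. h \<in> lolls D ! i \<and> h \<in> leaf_hedges (gam D))"

definition out_mark :: "diagram \<Rightarrow> nat \<Rightarrow> nat" where
  "out_mark D i = (THE h. h \<in> segs D ! i \<and> h \<in> leaf_hedges (gam D))"

definition inter_graph :: "diagram \<Rightarrow> (nat + nat \<times> nat) fgraph" where
  "inter_graph D = explode (subgraph (gam D) (\<Union>(fst ` set (trees D)))) (loll_verts D)"

definition same_comp :: "'v fgraph \<Rightarrow> nat \<Rightarrow> nat \<Rightarrow> bool" where
  "same_comp G a b \<longleftrightarrow> (src G a, src G b) \<in> (adj G)\<^sup>*"

text \<open>\<open>on_lolls D L \<gamma>\<close> is \<open>\<gamma>\<close>, regarded as a map on the realized lollipops inside the realization
  of the string diagram.\<close>

definition on_loll_pts :: "diagram \<Rightarrow> lens \<Rightarrow> gpt \<Rightarrow> (nat \<times> real) set" where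
  "on_loll_pts D L P = {(i, u). i < length (lolls D) \<and> u \<in> {0..<1} \<and> bdry (gam D) L (in_mark D i) u = P}"

definition on_lolls :: "diagram \<Rightarrow> lens \<Rightarrow> (nat \<Rightarrow> real \<Rightarrow> 'm) \<Rightarrow> gpt \<Rightarrow> 'm" where
  "on_lolls D L \<gamma> P = (case (SOME x. x \<in> on_loll_pts D L P) of (i, u) \<Rightarrow> \<gamma> i u)"

definition leaf_value :: "diagram \<Rightarrow> lens \<Rightarrow> (nat \<Rightarrow> real \<Rightarrow> 'm) \<Rightarrow> nat \<Rightarrow> 'm" where
  "leaf_value D L \<gamma> a = on_lolls D L \<gamma> (rpt (gam D) L (a, 0))"

definition lipschitz_wrt :: "'m riem \<Rightarrow> ereal \<Rightarrow> diagram \<Rightarrow> lens \<Rightarrow> (nat \<Rightarrow> real \<Rightarrow> 'm) \<Rightarrow> bool" where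
  "lipschitz_wrt M \<epsilon> D L \<gamma> \<longleftrightarrow> (let I = inter_graph D in
     \<forall>a\<in>leaf_hedges I. \<forall>b\<in>leaf_hedges I. a \<noteq> b \<longrightarrow> same_comp I a b \<longrightarrow>
       rdist M (leaf_value D L \<gamma> a) (leaf_value D L \<gamma> b)
         < \<epsilon> * ereal (gdist I L (rpt I L (a, 0)) (rpt I L (b, 0))))"

text \<open>Straightening on components of the intersection graph: \<open>str_at D L j P c\<close> holds if the point
  \<open>P\<close> of the \<open>j\<close>-th tree has barycentric coordinates \<open>c\<close>; \<open>b u\<close> are those of the image of its leaf
  \<open>u\<close>.\<close>

inductive str_at :: "diagram \<Rightarrow> lens \<Rightarrow> nat \<Rightarrow> gpt \<Rightarrow> (nat \<Rightarrow> real) \<Rightarrow> bool" for D L where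
  "\<lbrakk>j < length (trees D);
    \<And>u. \<lbrakk>u \<in> leaf_hedges (tree_of D j); src (gam D) u \<in> loll_verts D\<rbrakk> \<Longrightarrow>
        b u = (\<lambda>w. if w = u then 1 else 0);
    \<And>u. \<lbrakk>u \<in> leaf_hedges (tree_of D j); src (gam D) u \<notin> loll_verts D\<rbrakk> \<Longrightarrow>
        \<exists>i h. i < length (trees D) \<and> h \<in> fst (trees D ! i) \<and> src (gam D) h = src (gam D) u \<and>
              src (gam D) h \<in> snd (trees D ! i) \<and>
              str_at D L i (rpt (tree_of D i) L (h, 0)) (b u)\<rbrakk> \<Longrightarrow>
   str_at D L j P (\<lambda>w. \<Sum>u\<in>leaf_hedges (tree_of D j). str_tree (tree_of D j) L P u * b u w)"

definition Theta :: "'m riem \<Rightarrow> diagram \<Rightarrow> lens \<Rightarrow> (nat \<Rightarrow> real \<Rightarrow> 'm) \<Rightarrow> gpt \<Rightarrow> 'm" where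
  "Theta M D L \<gamma> P =
     (if on_loll_pts D L P \<noteq> {} then on_lolls D L \<gamma> P
      else (case (SOME (j, h, t). j < length (trees D) \<and> h \<in> fst (trees D ! j) \<and> (h, t) \<in> P) of
        (j, h, t) \<Rightarrow>
          interpolation M {a \<in> leaf_hedges (inter_graph D). same_comp (inter_graph D) h a}
            (leaf_value D L \<gamma>) (THE c. str_at D L j (rpt (tree_of D j) L (h, t)) c)))"

definition rho_out :: "diagram \<Rightarrow> lens \<Rightarrow> (gpt \<Rightarrow> 'm) \<Rightarrow> nat \<Rightarrow> real \<Rightarrow> 'm" where
  "rho_out D L \<theta> = (\<lambda>i\<in>{..<length (segs D)}. \<lambda>t\<in>{0..<1}. \<theta> (bdry_bar (gam D) L (out_mark D i) t))"


section \<open>The push-pull map\<close>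

type_synonym 'm sdlm = "(diagram \<times> lens) set \<times> (nat \<Rightarrow> real \<Rightarrow> 'm)"

definition SDLM :: "'m riem \<Rightarrow> int \<Rightarrow> nat \<Rightarrow> nat \<Rightarrow> 'm sdlm topology" where
  "SDLM M chi k l = prod_topology (SD chi k l) (LMpow k (mtop M))"

text \<open>For \<open>chi = 0\<close> there are no trees and the Lipschitz conditions are void.\<close>

definition bigS :: "'m riem \<Rightarrow> int \<Rightarrow> nat \<Rightarrow> nat \<Rightarrow> 'm sdlm set" where
  "bigS M chi k l = {(c, \<gamma>) \<in> topspace (SDLM M chi k l). case sd_rep c of (D, L) \<Rightarrow>
     lipschitz_wrt M (preconvexity_radius M / ereal \<bar>real_of_int chi\<bar>) D L \<gamma>}"

definition smallS :: "'m riem \<Rightarrow> int \<Rightarrow> nat \<Rightarrow> nat \<Rightarrow> 'm sdlm set" where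
  "smallS M chi k l = {(c, \<gamma>) \<in> topspace (SDLM M chi k l). case sd_rep c of (D, L) \<Rightarrow>
     lipschitz_wrt M (preconvexity_radius M / ereal (2 * \<bar>real_of_int chi\<bar>)) D L \<gamma>}"

definition out_heart :: "'m riem \<Rightarrow> 'm sdlm \<Rightarrow> nat \<Rightarrow> real \<Rightarrow> 'm" where
  "out_heart M = (\<lambda>(c, \<gamma>). case sd_rep c of (D, L) \<Rightarrow> rho_out D L (Theta M D L \<gamma>))"

definition ST :: "'m riem \<Rightarrow> int \<Rightarrow> nat \<Rightarrow> nat \<Rightarrow> nat \<Rightarrow> ('m sdlm, 'r::comm_ring_1) cochain \<Rightarrow>
    ((diagram \<times> lens) set gsimp \<times> (real \<Rightarrow> 'm) gsimp list \<Rightarrow>\<^sub>0 'r) \<Rightarrow>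
    ((real \<Rightarrow> 'm) gsimp list \<Rightarrow>\<^sub>0 'r)" where
  "ST M chi k l q W c =
     rlin (aw l) (push (out_heart M) (capp q W
       (rlin (exc_inverse (bigS M chi k l) (topspace (SDLM M chi k l) - smallS M chi k l))
         (rlin (ez_sd k) c))))"


section \<open>The stratified pair and the diffuse intersection class\<close>

definition bigN :: "'m riem \<Rightarrow> diagram \<Rightarrow> (nat \<Rightarrow> 'm) set" where
  "bigN M D = {f \<in> set (lvs D) \<rightarrow>\<^sub>E topspace (mtop M). \<forall>j<length (trees D).
     \<exists>z\<in>topspace (mtop M). f ` leaf_hedges (tree_of D j) \<subseteq> rball M z (preconvexity_radius M)}"

text \<open>The length of a short-branched tree is its leaf length.\<close>

definition smallN :: "'m riem \<Rightarrow> int \<Rightarrow> diagram \<Rightarrow> (nat \<Rightarrow> 'm) set" where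
  "smallN M chi D = {f \<in> bigN M D. \<forall>j<length (trees D). \<exists>z\<in>topspace (mtop M).
     f ` leaf_hedges (tree_of D j) \<subseteq>
       rball M z (ereal (leaf_length (tree_of D j) / (real_of_int chi)\<^sup>2) * (preconvexity_radius M / 4))}"

definition Mpow :: "'m riem \<Rightarrow> nat set \<Rightarrow> (nat \<Rightarrow> 'm) topology" where
  "Mpow M I = product_topology (\<lambda>_. mtop M) I"

definition Ntop :: "'m riem \<Rightarrow> diagram \<Rightarrow> (nat \<Rightarrow> 'm) topology" where
  "Ntop M D = subtopology (Mpow M (set (lvs D))) (bigN M D)"

definition KN :: "'m riem \<Rightarrow> diagram \<Rightarrow> (lens \<times> (nat \<Rightarrow> 'm)) topology" where
  "KN M D = prod_topology (top_of_set (cell D)) (Ntop M D)"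

text \<open>\<open>nabla1 M D L D' L' F\<close>: the string diagram \<open>L\<close> in a codimension one face of the cell of \<open>D\<close> is
  identified with \<open>L'\<close> in the cell of \<open>D'\<close> (or the cells are isomorphic), and \<open>\<nabla>\<close> acts on the
  second component by \<open>F\<close>.\<close>

inductive nabla1 :: "'m riem \<Rightarrow> diagram \<Rightarrow> lens \<Rightarrow> diagram \<Rightarrow> lens \<Rightarrow>
    ((nat \<Rightarrow> 'm) \<Rightarrow> (nat \<Rightarrow> 'm)) \<Rightarrow> bool" for M where
  "\<lbrakk>diagram_iso \<phi> D D'; \<And>h. h \<in> hedges (gam D) \<Longrightarrow> L' (\<phi> h) = L h\<rbrakk> \<Longrightarrow>
    nabla1 M D L D' L' (\<lambda>f. \<lambda>a\<in>set (lvs D'). f (inv_into (hedges (gam D)) \<phi> a))"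
| "contraction D L D' \<xi> \<Longrightarrow>
    nabla1 M D L D' L (\<lambda>f. \<lambda>a\<in>set (lvs D'). f (inv_into (set (lvs D)) \<xi> a))"
| "pruning D L h D' \<Longrightarrow>
    nabla1 M D L D' L (\<lambda>f. f(h := interpolation M (leaf_hedges (tree_of D 0)) f
      (str_tree (tree_of D 0) L (rpt (tree_of D 0) L (h, 0)))))"

inductive nablas :: "'m riem \<Rightarrow> int \<Rightarrow> nat \<Rightarrow> nat \<Rightarrow> diagram \<Rightarrow> lens \<Rightarrow> diagram \<Rightarrow> lens \<Rightarrow>
    ((nat \<Rightarrow> 'm) \<Rightarrow> (nat \<Rightarrow> 'm)) \<Rightarrow> bool" for M chi k l where
  "(D, L) \<in> sd_points chi k l \<Longrightarrow> nablas M chi k l D L D L id"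
| "\<lbrakk>nablas M chi k l D L D' L' F; nabla1 M D' L' D'' L'' F'; (D'', L'') \<in> sd_points chi k l\<rbrakk> \<Longrightarrow>
    nablas M chi k l D L D'' L'' (F' \<circ> F)"

type_synonym 'm npt = "diagram \<times> lens \<times> (nat \<Rightarrow> 'm)"

definition nsd_points :: "'m riem \<Rightarrow> int \<Rightarrow> nat \<Rightarrow> nat \<Rightarrow> 'm npt set" where
  "nsd_points M chi k l = {(D, L, f). (D, L) \<in> sd_points chi k l \<and> f \<in> bigN M D}"

definition nsd_glue :: "'m riem \<Rightarrow> int \<Rightarrow> nat \<Rightarrow> nat \<Rightarrow> 'm npt \<Rightarrow> 'm npt \<Rightarrow> bool" where
  "nsd_glue M chi k l x y \<longleftrightarrow> x \<in> nsd_points M chi k l \<and> y \<in> nsd_points M chi k l \<and>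
     (case x of (D, L, f) \<Rightarrow> case y of (D', L', f') \<Rightarrow> \<exists>F. nabla1 M D L D' L' F \<and> f' = F f)"

definition nsd_class :: "'m riem \<Rightarrow> int \<Rightarrow> nat \<Rightarrow> nat \<Rightarrow> 'm npt \<Rightarrow> 'm npt set" where
  "nsd_class M chi k l x = {y \<in> nsd_points M chi k l. equivclp (nsd_glue M chi k l) x y}"

definition NSD :: "'m riem \<Rightarrow> int \<Rightarrow> nat \<Rightarrow> nat \<Rightarrow> 'm npt set topology" where
  "NSD M chi k l = quotient_space
     (sum_topology (KN M) {D. comb_diagram chi k l D}) (nsd_class M chi k l)"

definition NSD_sub :: "'m riem \<Rightarrow> int \<Rightarrow> nat \<Rightarrow> nat \<Rightarrow> 'm npt set set" where
  "NSD_sub M chi k l = nsd_class M chi k l `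
     {(D, L, f) \<in> nsd_points M chi k l. f \<notin> smallN M chi D}"

definition zero_cell :: "int \<Rightarrow> nat \<Rightarrow> nat \<Rightarrow> diagram \<Rightarrow> bool" where
  "zero_cell chi k l P \<longleftrightarrow> comb_diagram chi k l P \<and> (\<exists>L. cell P = {L})"

definition omega_deg :: "'m riem \<Rightarrow> int \<Rightarrow> nat" where
  "omega_deg M chi = nat \<bar>chi\<bar> * mdim M"

definition tree_diagonal :: "diagram \<Rightarrow> (nat \<Rightarrow> 'm) \<Rightarrow> (nat \<Rightarrow> 'm)" where
  "tree_diagonal P f = (\<lambda>a\<in>set (lvs P). f (THE j. j < length (trees P) \<and> a \<in> fst (trees P ! j)))"

text \<open>\<open>u\<close> represents \<open>\<omega>\<^sub>p\<close>: here \<open>z\<close> represents the fundamental class of the manifold and \<open>y\<close>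
  represents \<open>[N\<^sub>p]\<close>. Trees are indexed by their position in the order.\<close>

definition is_omega_p :: "'m riem \<Rightarrow> ('m \<Rightarrow> ('m, 'r::comm_ring_1) gchain) \<Rightarrow> int \<Rightarrow> diagram \<Rightarrow>
    (nat \<Rightarrow> 'm, 'r) cochain \<Rightarrow> bool" where
  "is_omega_p M \<mu> chi P u \<longleftrightarrow> (let q = omega_deg M chi; N = bigN M P; n = smallN M chi P;
       X = Mpow M (set (lvs P)); m = length (trees P) in
     rel_cocycle q (Ntop M P) (N - n) u \<and>
     (\<exists>z y. fundamental_cycle M \<mu> z \<and>
        rel_cycle (2 * q) (Ntop M P) (N - n) y \<and>
        homol (2 * q) X (topspace X - n) y
          (rlin (ez_idx (lvs P)) (tens (replicate (length (lvs P)) z))) \<and>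
        homol q (Ntop M P) {} (capp q u y)
          (push (tree_diagonal P) (rlin (ez_idx [0..<m]) (tens (replicate m z))))))"

definition is_omega_K :: "'m riem \<Rightarrow> ('m \<Rightarrow> ('m, 'r::comm_ring_1) gchain) \<Rightarrow> int \<Rightarrow> nat \<Rightarrow> nat \<Rightarrow>
    diagram \<Rightarrow> (lens \<times> (nat \<Rightarrow> 'm), 'r) cochain \<Rightarrow> bool" where
  "is_omega_K M \<mu> chi k l D u \<longleftrightarrow>
     (\<exists>L P L' F v. zero_cell chi k l P \<and> nablas M chi k l D L P L' F \<and> is_omega_p M \<mu> chi P v \<and>
        cohomologous (omega_deg M chi) (KN M D) (cell D \<times> (bigN M D - smallN M chi D))
          u (pullb (F \<circ> snd) v))"

definition is_global_thom :: "'m riem \<Rightarrow> ('m \<Rightarrow> ('m, 'r::comm_ring_1) gchain) \<Rightarrow> int \<Rightarrow> nat \<Rightarrow> nat \<Rightarrow>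
    ('m npt set, 'r) cochain \<Rightarrow> bool" where
  "is_global_thom M \<mu> chi k l w \<longleftrightarrow>
     rel_cocycle (omega_deg M chi) (NSD M chi k l) (NSD_sub M chi k l) w \<and>
     (\<forall>D. comb_diagram chi k l D \<longrightarrow>
        is_omega_K M \<mu> chi k l D (pullb (\<lambda>(L, f). nsd_class M chi k l (D, L, f)) w))"

definition ev :: "'m riem \<Rightarrow> int \<Rightarrow> nat \<Rightarrow> nat \<Rightarrow> 'm sdlm \<Rightarrow> 'm npt set" where
  "ev M chi k l = (\<lambda>(c, \<gamma>). case sd_rep c of (D, L) \<Rightarrow>
     nsd_class M chi k l (D, L, \<lambda>a\<in>set (lvs D). Theta M D L \<gamma> (rpt (gam D) L (a, 0))))"

text \<open>\<open>W\<close> is a relative cocycle representing \<open>\<Omega> = ev\<^sup>* \<omega>\<close>.\<close>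

definition represents_diffuse_class :: "'m riem \<Rightarrow> ('m \<Rightarrow> ('m, 'r::comm_ring_1) gchain) \<Rightarrow>
    int \<Rightarrow> nat \<Rightarrow> nat \<Rightarrow> ('m sdlm, 'r) cochain \<Rightarrow> bool" where
  "represents_diffuse_class M \<mu> chi k l W \<longleftrightarrow>
     (let q = omega_deg M chi; X = subtopology (SDLM M chi k l) (bigS M chi k l);
          A = bigS M chi k l - smallS M chi k l in
      rel_cocycle q X A W \<and>
      (\<exists>w. is_global_thom M \<mu> chi k l w \<and> cohomologous q X A W (pullb (ev M chi k l) w)))"


section \<open>The type (0,1,1)\<close>

definition p_map :: "(diagram \<times> lens) set \<Rightarrow> real" where
  "p_map c = (case sd_rep c of (D, L) \<Rightarrow> THE u. u \<in> {0..<1} \<and>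
     bdry (gam D) L (in_mark D 0) u = bdry_bar (gam D) L (out_mark D 0) 0)"

definition p_inv_eta :: "((diagram \<times> lens) set, 'r::comm_ring_1) gchain" where
  "p_inv_eta = push (inv_into (topspace (SD 0 1 1)) p_map) eta"

end

theory Submission
  imports Defs
begin

text \<open>Counting vertices and edges shows that a string diagram of type \<open>(0,1,1)\<close> has no trees, so it is
  a lollipop with the output segment attached either at its base point or at one further vertex;
  hence \<open>p\<close> reads off the position of that vertex. The output circle is the input circle rotated by
  \<open>p\<close>, so \<open>out_heart\<close> is the rotation map precomposed with \<open>p\<close>. As all Lipschitz conditions are
  void, \<open>S\<close> and \<open>s\<close> are the whole space, excision is the identity, and the degree zero class \<open>\<Omega>\<close> takes the value one on every point, so
  that capping with it is the identity as well. What remains of the push-pull map on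
  \<open>p\<^sup>-\<^sup>1\<eta>\<close> is the shuffle product followed by rotation.\<close>

section \<open>Linear extension\<close>

text \<open>The identity holds on the nose, not just up to homotopy: a cohomology class of degree
  zero is a function on points, an Alexander--Whitney map with one factor makes no cuts, and both
  shuffle products run over the same signed words. The obstacles are two quotients. Points of the
  realization of a graph are classes of a generated equivalence relation, so distinctness is
  certified by an explicit coordinate that is constant on glued pairs; it is the inverse of the
  input parametrization. Points of the moduli space are classes too, evaluated on a representative
  picked by choice, so the position of the output vertex must be invariant under every gluing. The
  output boundary cycle runs against the input circle; the reversal in \<open>bdry_bar\<close> makes
  this a rotation instead of a reflection. Since \<open>out_heart\<close> sees a diagram only
  through its value under \<open>p_map\<close>, the right inverse supplied by surjectivity fixes the
  composite, and a single diagram with arcs of variable length realizes all positions.\<close>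

lemma lookup_map0:
  assumes "f 0 = 0"
  shows "Poly_Mapping.lookup (Poly_Mapping.map f p) k = f (Poly_Mapping.lookup p k)"
  using assms by (simp add: Poly_Mapping.map.rep_eq when_def)

text \<open>The index set is any finite set containing the keys: keys can cancel under linear
  extension, so sums over different key sets must be brought to a common one before they can be
  interchanged.\<close>

lemma lookup_rlin:
  assumes "finite A" "Poly_Mapping.keys c \<subseteq> A"
  shows "Poly_Mapping.lookup (rlin f c) b =
    (\<Sum>a\<in>A. of_int (Poly_Mapping.lookup (f a) b) * Poly_Mapping.lookup c a)"
proof -
  have "Poly_Mapping.lookup (rlin f c) b =
      (\<Sum>a\<in>Poly_Mapping.keys c. of_int (Poly_Mapping.lookup (f a) b) * Poly_Mapping.lookup c a)"
    by (simp add: rlin_def lookup_sum lookup_map0)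
  also have "\<dots> = (\<Sum>a\<in>A. of_int (Poly_Mapping.lookup (f a) b) * Poly_Mapping.lookup c a)"
    using assms by (intro sum.mono_neutral_left) (auto simp: in_keys_iff)
  finally show ?thesis .
qed

lemma keys_rlin: "Poly_Mapping.keys (rlin f c) \<subseteq> (\<Union>a\<in>Poly_Mapping.keys c. Poly_Mapping.keys (f a))"
proof
  fix b assume "b \<in> Poly_Mapping.keys (rlin f c)"
  then have "(\<Sum>a\<in>Poly_Mapping.keys c. of_int (Poly_Mapping.lookup (f a) b) * Poly_Mapping.lookup c a) \<noteq> 0"
    by (simp add: in_keys_iff lookup_rlin[OF finite_keys order_refl])
  then obtain a where "a \<in> Poly_Mapping.keys c" "Poly_Mapping.lookup (f a) b \<noteq> 0"
    by (force elim: sum.not_neutral_contains_not_neutral)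
  then show "b \<in> (\<Union>a\<in>Poly_Mapping.keys c. Poly_Mapping.keys (f a))"
    by (auto simp: in_keys_iff)
qed

lemma rlin_cong: "(\<And>a. a \<in> Poly_Mapping.keys c \<Longrightarrow> f a = g a) \<Longrightarrow> rlin f c = rlin g c"
  by (simp add: rlin_def)

lemma lookup_frag_extend:
  assumes "finite A" "Poly_Mapping.keys x \<subseteq> A"
  shows "Poly_Mapping.lookup (frag_extend g x) b =
    (\<Sum>a\<in>A. Poly_Mapping.lookup x a * Poly_Mapping.lookup (g a) b)"
proof -
  have "Poly_Mapping.lookup (frag_extend g x) b =
      (\<Sum>a\<in>Poly_Mapping.keys x. Poly_Mapping.lookup x a * Poly_Mapping.lookup (g a) b)"
    by (simp add: frag_extend_def lookup_sum)
  also have "\<dots> = (\<Sum>a\<in>A. Poly_Mapping.lookup x a * Poly_Mapping.lookup (g a) b)"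
    using assms by (intro sum.mono_neutral_left) (auto simp: in_keys_iff)
  finally show ?thesis .
qed

text \<open>This composition law collapses the push-pull map and the BV operator to one linear
  extension each, so that they can be compared on basis elements with integral formulas.\<close>

lemma rlin_rlin: "rlin g (rlin f c) = rlin (\<lambda>a. frag_extend g (f a)) c"
proof (rule poly_mapping_eqI)
  fix b
  let ?X = "\<Union>a\<in>Poly_Mapping.keys c. Poly_Mapping.keys (f a)"
  have fin: "finite ?X" by simp
  have "Poly_Mapping.lookup (rlin g (rlin f c)) b =
     (\<Sum>x\<in>?X. of_int (Poly_Mapping.lookup (g x) b) *
       (\<Sum>a\<in>Poly_Mapping.keys c. of_int (Poly_Mapping.lookup (f a) x) * Poly_Mapping.lookup c a))"
    by (subst lookup_rlin[OF fin keys_rlin]) (simp add: lookup_rlin[OF finite_keys order_refl])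
  also have "\<dots> = (\<Sum>a\<in>Poly_Mapping.keys c. \<Sum>x\<in>?X. of_int (Poly_Mapping.lookup (g x) b) *
        (of_int (Poly_Mapping.lookup (f a) x) * Poly_Mapping.lookup c a))"
    by (subst sum.swap) (simp add: sum_distrib_left)
  also have "\<dots> = (\<Sum>a\<in>Poly_Mapping.keys c.
       of_int (Poly_Mapping.lookup (frag_extend g (f a)) b) * Poly_Mapping.lookup c a)"
  proof (rule sum.cong[OF refl])
    fix a assume "a \<in> Poly_Mapping.keys c"
    then have "Poly_Mapping.keys (f a) \<subseteq> ?X" by blast
    then show "(\<Sum>x\<in>?X. of_int (Poly_Mapping.lookup (g x) b) *
        (of_int (Poly_Mapping.lookup (f a) x) * Poly_Mapping.lookup c a)) =
        of_int (Poly_Mapping.lookup (frag_extend g (f a)) b) * Poly_Mapping.lookup c a"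
      by (simp add: lookup_frag_extend[OF fin] sum_distrib_right sum_distrib_left mult_ac)
  qed
  also have "\<dots> = Poly_Mapping.lookup (rlin (\<lambda>a. frag_extend g (f a)) c) b"
    by (simp add: lookup_rlin[OF finite_keys order_refl])
  finally show "Poly_Mapping.lookup (rlin g (rlin f c)) b =
    Poly_Mapping.lookup (rlin (\<lambda>a. frag_extend g (f a)) c) b" .
qed

lemma rlin_frag_of: "rlin (\<lambda>a. frag_of (f a)) c =
    (\<Sum>a\<in>Poly_Mapping.keys c. Poly_Mapping.single (f a) (Poly_Mapping.lookup c a))"
  by (simp add: rlin_def)

lemma rlin_id: "rlin frag_of c = c"
  unfolding rlin_frag_of
  by (rule poly_mapping_eqI)
    (auto simp: lookup_sum lookup_single when_def sum.delta in_keys_iff)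

lemma tens_single_list: "tens [c] = rlin (\<lambda>a. frag_of [a]) c"
  \<comment> \<open>In the zero ring the tensor unit \<open>single [] 1\<close> has no keys, so its
    sum is treated apart.\<close>
  by (cases "(1::'b) = 0") (auto simp: rlin_frag_of)

lemma tens2_single_left:
  "tens2 (Poly_Mapping.single e 1) c = rlin (\<lambda>a. frag_of (e, a)) c"
  by (auto simp: tens2_def rlin_frag_of)

lemma rlin_single_one: "rlin (\<lambda>a. frag_of (f a)) (Poly_Mapping.single e 1) = Poly_Mapping.single (f e) 1"
  by (simp add: rlin_frag_of)

section \<open>Diagrams of type (0,1,1)\<close>

text \<open>The fibres of \<open>src\<close> are the orbits of the permutation \<open>nxt\<close>.
  On a finite set every orbit is a cycle, and its least period is the size of the fibre, which is
  the valence.\<close>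

lemma fatgraph_orbit:
  assumes "fatgraph G" "h \<in> hedges G"
  defines "n \<equiv> valence G (src G h)"
  shows fatgraph_orbit_bij: "bij_betw (\<lambda>i. (nxt G ^^ i) h) {..<n} {h' \<in> hedges G. src G h' = src G h}"
    and fatgraph_orbit_period: "(nxt G ^^ n) h = h"
    and fatgraph_valence_pos: "n > 0"
proof -
  let ?f = "nxt G" and ?H = "hedges G"
  let ?F = "{h' \<in> ?H. src G h' = src G h}"
  have fin: "finite ?H" and bij: "bij_betw ?f ?H ?H"
    and orb: "\<And>h'. h' \<in> ?H \<Longrightarrow> src G h = src G h' \<longleftrightarrow> (\<exists>n. (?f ^^ n) h = h')"
    using assms(1,2) by (simp_all add: fatgraph_def)
  have inH: "(?f ^^ i) h \<in> ?H" for i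
    using assms(2) bij by (induction i) (auto simp: bij_betw_def)
  have srcf: "src G ((?f ^^ i) h) = src G h" for i
    using orb[OF inH[of i]] by metis
  have F: "?F = range (\<lambda>i. (?f ^^ i) h)"
  proof (intro equalityI subsetI)
    fix h' assume "h' \<in> ?F"
    then obtain i where "(?f ^^ i) h = h'" using orb[of h'] by auto
    then show "h' \<in> range (\<lambda>i. (?f ^^ i) h)" by blast
  next
    fix h' assume "h' \<in> range (\<lambda>i. (?f ^^ i) h)"
    then show "h' \<in> ?F" using inH srcf by auto
  qed
  have inj: "inj_on ?f ?H" using bij by (simp add: bij_betw_def)
  have canc: "\<exists>k>0. (?f ^^ k) h = h"
  proof -
    have "\<not> inj (\<lambda>i. (?f ^^ i) h)"
    proof
      assume "inj (\<lambda>i. (?f ^^ i) h)"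
      moreover have "range (\<lambda>i. (?f ^^ i) h) \<subseteq> ?H" using inH by auto
      ultimately have "finite (UNIV :: nat set)" using fin inj_on_finite by blast
      then show False by simp
    qed
    then obtain i j where ij: "i < j" "(?f ^^ i) h = (?f ^^ j) h"
      unfolding inj_on_def by (metis linorder_neqE_nat)
    \<comment> \<open>Cancelling \<open>nxt\<close> by injectivity i times turns a coincidence of
      two iterates into a return to h itself.\<close>
    have "(?f ^^ (j - k)) h = (?f ^^ (i - k)) h" if "k \<le> i" for k
      using that
    proof (induction k)
      case (Suc k)
      then have "j - k = Suc (j - Suc k)" "i - k = Suc (i - Suc k)"
        using ij by auto
      then have "?f ((?f ^^ (j - Suc k)) h) = ?f ((?f ^^ (i - Suc k)) h)"
        using Suc by (simp del: funpow.simps add: funpow.simps(2)[symmetric] flip: comp_apply[of ?f])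
      then show ?case using inj_onD[OF inj _ inH inH] by blast
    qed (use ij in simp)
    from this[of i] ij show ?thesis by (intro exI[of _ "j - i"]) auto
  qed
  define m where "m = (LEAST k. k > 0 \<and> (?f ^^ k) h = h)"
  have m: "m > 0" "(?f ^^ m) h = h"
    using LeastI_ex[OF canc[simplified]] unfolding m_def by auto
  have mmin: "k < m \<Longrightarrow> k > 0 \<Longrightarrow> (?f ^^ k) h \<noteq> h" for k
    using not_less_Least unfolding m_def by blast
  have modm: "(?f ^^ i) h = (?f ^^ (i mod m)) h" for i
  proof (induction i rule: less_induct)
    case (less i)
    show ?case
    proof (cases "i < m")
      case False
      then have "(?f ^^ i) h = (?f ^^ (i - m)) ((?f ^^ m) h)"
        by (metis funpow_add comp_apply le_add_diff_inverse2 not_less)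
      also have "\<dots> = (?f ^^ ((i - m) mod m)) h"
        using less[of "i - m"] m False by simp
      finally show ?thesis using False by (simp add: le_mod_geq)
    qed simp
  qed
  have "inj_on (\<lambda>i. (?f ^^ i) h) {..<m}"
  proof (rule linorder_inj_onI)
    fix i j assume ij: "i < j" "i \<in> {..<m}" "j \<in> {..<m}"
    show "(?f ^^ i) h \<noteq> (?f ^^ j) h"
    proof
      assume "(?f ^^ i) h = (?f ^^ j) h"
      then have "(?f ^^ (m - j)) ((?f ^^ i) h) = (?f ^^ (m - j)) ((?f ^^ j) h)" by simp
      then have "(?f ^^ (m - j + i)) h = (?f ^^ (m - j + j)) h"
        by (simp only: funpow_add comp_apply)
      then have "(?f ^^ (m - j + i)) h = h" using ij m by simp
      moreover have "m - j + i < m" "m - j + i > 0" using ij by auto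
      ultimately show False using mmin[of "m - j + i"] by simp
    qed
  qed auto
  moreover have "(\<lambda>i. (?f ^^ i) h) ` {..<m} = ?F"
    unfolding F
  proof (intro equalityI subsetI)
    fix h' assume "h' \<in> range (\<lambda>i. (?f ^^ i) h)"
    then obtain i where "h' = (?f ^^ (i mod m)) h" using modm by auto
    then show "h' \<in> (\<lambda>i. (?f ^^ i) h) ` {..<m}" using m(1) by auto
  qed auto
  ultimately have bb: "bij_betw (\<lambda>i. (?f ^^ i) h) {..<m} ?F" by (simp add: bij_betw_def)
  then have "m = n" unfolding n_def valence_def using bij_betw_same_card by fastforce
  with bb m show "bij_betw (\<lambda>i. (?f ^^ i) h) {..<n} ?F" "(?f ^^ n) h = h" "n > 0" by auto
qed

lemma fatgraph_fiber1:
  assumes "fatgraph G" "h \<in> hedges G" "valence G (src G h) = 1"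
  shows "nxt G h = h" "{h' \<in> hedges G. src G h' = src G h} = {h}"
  using fatgraph_orbit[OF assms(1,2)] assms(3) by (auto simp: bij_betw_def lessThan_Suc)

lemma fatgraph_fiber2:
  assumes "fatgraph G" "h \<in> hedges G" "valence G (src G h) = 2"
  shows "{h' \<in> hedges G. src G h' = src G h} = {h, nxt G h}" "nxt G (nxt G h) = h" "nxt G h \<noteq> h"
  using fatgraph_orbit[OF assms(1,2)] assms(3)
  by (auto simp: bij_betw_def lessThan_Suc numeral_2_eq_2)

lemma fatgraph_fiber3:
  assumes "fatgraph G" "h \<in> hedges G" "valence G (src G h) = 3"
  shows "{h' \<in> hedges G. src G h' = src G h} = {h, nxt G h, nxt G (nxt G h)}"
    "nxt G (nxt G (nxt G h)) = h" "distinct [h, nxt G h, nxt G (nxt G h)]"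
  using fatgraph_orbit[OF assms(1,2)] assms(3)
  by (auto simp: bij_betw_def lessThan_Suc numeral_3_eq_3)

lemma fatgraph_fiber4:
  assumes "fatgraph G" "h \<in> hedges G" "valence G (src G h) = 4"
  shows "{h' \<in> hedges G. src G h' = src G h} = {h, nxt G h, nxt G (nxt G h), nxt G (nxt G (nxt G h))}"
    "nxt G (nxt G (nxt G (nxt G h))) = h"
    "distinct [h, nxt G h, nxt G (nxt G h), nxt G (nxt G (nxt G h))]"
  using fatgraph_orbit[OF assms(1,2)] assms(3)
  by (auto simp: bij_betw_def lessThan_Suc eval_nat_numeral)

text \<open>The iterates of \<open>bstep\<close> are the entries of the list with index taken modulo
  its length, and distinctness makes that length the least period. Boundary cycles can thus be
  checked one step at a time.\<close>

lemma bcycle_eqI: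
  assumes "hs \<noteq> []" "distinct hs" "\<And>i. i < length hs \<Longrightarrow> bstep G (hs ! i) = hs ! (Suc i mod length hs)"
  shows "bcycle G (hd hs) = hs"
proof -
  let ?n = "length hs"
  have it: "(bstep G ^^ i) (hd hs) = hs ! (i mod ?n)" for i
  proof (induction i)
    case (Suc i)
    then show ?case using assms(3)[of "i mod ?n"] assms(1) by (simp add: mod_Suc_eq)
  qed (use assms(1) in \<open>simp add: hd_conv_nth\<close>)
  have "(LEAST n. n > 0 \<and> (bstep G ^^ n) (hd hs) = hd hs) = ?n"
  proof (rule Least_equality)
    show "?n > 0 \<and> (bstep G ^^ ?n) (hd hs) = hd hs"
      using assms(1) it[of ?n] it[of 0] by simp
    fix m assume m: "m > 0 \<and> (bstep G ^^ m) (hd hs) = hd hs"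
    then have "hs ! (m mod ?n) = hs ! 0" using it assms(1) by (metis hd_conv_nth)
    then have "m mod ?n = 0" using assms(1,2) by (simp add: nth_eq_iff_index_eq)
    then show "?n \<le> m" using m by (meson dvd_imp_le mod_eq_0_iff_dvd)
  qed
  then show ?thesis unfolding bcycle_def
    by (intro nth_equalityI) (auto simp: it)
qed

section \<open>Counting vertices and edges of a string diagram\<close>

lemma even_card_hclosed:
  assumes "fatgraph G" "hclosed G A"
  shows "even (card A)"
proof -
  have fin: "finite A" and opp: "\<And>h. h \<in> A \<Longrightarrow> opp G h \<in> A \<and> opp G h \<noteq> h \<and> opp G (opp G h) = h"
    using assms unfolding fatgraph_def hclosed_def by (auto intro: finite_subset)
  let ?C = "(\<lambda>h. {h, opp G h}) ` A"
  have "\<Union>?C = A" using opp by auto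
  moreover have "2 * card ?C = card (\<Union>?C)"
  proof (rule card_partition)
    show "finite ?C" "finite (\<Union>?C)" using fin opp by auto
    show "\<And>c. c \<in> ?C \<Longrightarrow> card c = 2" using opp by force
    show "c \<inter> c' = {}" if c: "c \<in> ?C" "c' \<in> ?C" "c \<noteq> c'" for c c'
    proof -
      obtain h h' where hh: "h \<in> A" "h' \<in> A" "c = {h, opp G h}" "c' = {h', opp G h'}"
        using c by auto
      show ?thesis using opp[OF hh(1)] opp[OF hh(2)] c(3) hh by auto
    qed
  qed
  ultimately show ?thesis by (metis dvd_triv_left)
qed

lemma sum_valence_subset:
  assumes "finite A" "finite F"
  shows "(\<Sum>v\<in>F. card {h \<in> A. s h = v}) = card {h \<in> A. s h \<in> F}"
proof -
  have "{h \<in> A. s h \<in> F} = (\<Union>v\<in>F. {h \<in> A. s h = v})" by auto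
  moreover have "card (\<Union>v\<in>F. {h \<in> A. s h = v}) = (\<Sum>v\<in>F. card {h \<in> A. s h = v})"
    by (rule card_UN_disjoint) (use assms in auto)
  ultimately show ?thesis by simp
qed

text \<open>If there were as many internal vertices as edges, every vertex would be bivalent and
  the whole tree would be a cycle.\<close>

lemma card_fundamental_lt:
  assumes A: "finite A" and opp: "opp G ` A \<subseteq> A"
    and F: "F \<subseteq> {v \<in> src G ` A. valence (subgraph G A) v \<noteq> 1}"
    and tree: "is_tree (explode (subgraph G A) (src G ` A - F))" (is "is_tree ?T")
  shows "2 * card F < card A"
proof -
  have finF: "finite F" using F A by (auto intro: finite_subset)
  have val2: "card {h \<in> A. src G h = v} \<ge> 2" if "v \<in> F" for v
  proof -
    have "v \<in> src G ` A" "card {h \<in> A. src G h = v} \<noteq> 1"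
      using F that by (auto simp: valence_def subgraph_def)
    moreover from this have "card {h \<in> A. src G h = v} \<noteq> 0" using A by auto
    ultimately show ?thesis by linarith
  qed
  have s1: "2 * card F \<le> (\<Sum>v\<in>F. card {h \<in> A. src G h = v})"
    using sum_mono[of F "\<lambda>_. 2" "\<lambda>v. card {h \<in> A. src G h = v}"] val2 by simp
  have s2: "(\<Sum>v\<in>F. card {h \<in> A. src G h = v}) = card {h \<in> A. src G h \<in> F}"
    by (rule sum_valence_subset[OF A finF])
  have s3: "card {h \<in> A. src G h \<in> F} \<le> card A" by (rule card_mono[OF A]) auto
  show ?thesis
  proof (rule ccontr)
    assume "\<not> ?thesis"
    then have eq: "2 * card F = (\<Sum>v\<in>F. card {h \<in> A. src G h = v})"
      "card {h \<in> A. src G h \<in> F} = card A"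
      using s1 s2 s3 by auto
    from eq(2) have all: "{h \<in> A. src G h \<in> F} = A" by (intro card_subset_eq[OF A]) auto
    then have srcF: "src G ` A = F" using F by auto
    have two: "card {h \<in> A. src G h = v} = 2" if "v \<in> F" for v
    proof (rule ccontr)
      assume "card {h \<in> A. src G h = v} \<noteq> 2"
      then have "2 < card {h \<in> A. src G h = v}" using val2[OF that] by simp
      then have "(\<Sum>v\<in>F. 2) < (\<Sum>v\<in>F. card {h \<in> A. src G h = v})"
        by (intro sum_strict_mono_ex1[OF finF]) (use val2 that in auto)
      then show False using eq by simp
    qed
    have hA: "hclosed ?T A" using opp by (auto simp: hclosed_def explode_def subgraph_def)
    \<comment> \<open>All sources lie in F, so nothing is exploded and every vertex carries the left
      injection.\<close>
    have T: "verts ?T = Inl ` F" "hedges ?T = A" "opp ?T = opp G" "src ?T = Inl \<circ> src G"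
      using srcF by (auto simp: explode_def subgraph_def)
    have "conn ?T" using tree by (simp add: is_tree_def)
    moreover have "verts (subgraph ?T A) = verts ?T" "adj (subgraph ?T A) = adj ?T"
      using T srcF by (auto simp: subgraph_def adj_def)
    ultimately have "conn (subgraph ?T A)" by (simp add: conn_def)
    moreover have "valence (subgraph ?T A) v = 2" if "v \<in> verts (subgraph ?T A)" for v
    proof -
      have "v \<in> Inl ` F" using that T(1) \<open>verts (subgraph ?T A) = verts ?T\<close> by simp
      then obtain w where w: "v = Inl w" "w \<in> F" by auto
      have "src (subgraph ?T A) = Inl \<circ> src G" "hedges (subgraph ?T A) = A"
        using T by (auto simp: subgraph_def)
      then show ?thesis using two[OF w(2)] w(1) by (simp add: valence_def)
    qed
    ultimately have "cycle_graph (subgraph ?T A)" by (simp add: cycle_graph_def)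
    then show False using tree hA by (auto simp: is_tree_def)
  qed
qed

lemma card_Union_list_disjoint:
  assumes "\<forall>i<length Xs. \<forall>j<i. Xs ! i \<inter> Xs ! j = {}" "\<forall>X\<in>set Xs. finite X"
  shows "card (\<Union>(set Xs)) = sum_list (map card Xs)"
  using assms
proof (induction Xs)
  case (Cons X Xs)
  have disj: "X \<inter> \<Union>(set Xs) = {}"
  proof -
    have "Y \<inter> X = {}" if Y: "Y \<in> set Xs" for Y
    proof -
      obtain i where "i < length Xs" "Xs ! i = Y" using Y by (auto simp: in_set_conv_nth)
      then show ?thesis using Cons.prems(1)[rule_format, of "Suc i" 0] by simp
    qed
    then show ?thesis by blast
  qed
  have "\<forall>i<length Xs. \<forall>j<i. Xs ! i \<inter> Xs ! j = {}"
  proof (intro allI impI)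
    fix i j assume "i < length Xs" "j < i"
    then show "Xs ! i \<inter> Xs ! j = {}" using Cons.prems(1)[rule_format, of "Suc i" "Suc j"] by simp
  qed
  then have "card (\<Union>(set Xs)) = sum_list (map card Xs)" using Cons by simp
  then show ?case using Cons.prems(2) disj by (simp add: card_Un_disjoint)
qed simp

text \<open>The valences sum to 1 + 3 + 2(n - 2) = 2n for n vertices: a circle with a stick has
  Euler characteristic zero.\<close>

lemma fat_lollipop_card:
  assumes "fat_lollipop G"
  shows "2 * card (verts G) = card (hedges G)"
proof -
  have fg: "finite (verts G)" "finite (hedges G)" "src G ` hedges G = verts G"
    using assms by (auto simp: fat_lollipop_def fatgraph_def)
  obtain h where h: "h \<in> hedges G" "valence G (src G h) = 1" "valence G (src G (opp G h)) = 3"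
    "\<And>v. v \<in> verts G \<Longrightarrow> v \<noteq> src G h \<Longrightarrow> v \<noteq> src G (opp G h) \<Longrightarrow> valence G v = 2"
    using assms unfolding fat_lollipop_def by blast
  have ho: "opp G h \<in> hedges G" using assms h(1) by (auto simp: fat_lollipop_def fatgraph_def)
  let ?v = "src G h" and ?w = "src G (opp G h)"
  have vw: "?v \<in> verts G" "?w \<in> verts G" "?v \<noteq> ?w" using h ho fg(3) by auto
  have "card (hedges G) = (\<Sum>v\<in>verts G. valence G v)"
  proof -
    have "(\<Sum>v\<in>verts G. valence G v) = card {x \<in> hedges G. src G x \<in> verts G}"
      unfolding valence_def by (rule sum_valence_subset[OF fg(2,1)])
    also have "{x \<in> hedges G. src G x \<in> verts G} = hedges G" using fg(3) by auto
    finally show ?thesis by simp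
  qed
  also have "\<dots> = valence G ?v + (valence G ?w + (\<Sum>v\<in>verts G - {?v} - {?w}. valence G v))"
    using vw fg(1) by (simp add: sum.remove[of _ ?v] sum.remove[of _ ?w])
  also have "(\<Sum>v\<in>verts G - {?v} - {?w}. valence G v) = 2 * card (verts G - {?v} - {?w})"
    using h(4) by simp
  also have "card (verts G - {?v} - {?w}) = card (verts G) - 2"
    using vw fg(1) by (simp add: card_Diff_singleton)
  moreover have "card (verts G) \<ge> 2"
  proof -
    have "card {?v, ?w} \<le> card (verts G)" using vw fg(1) by (intro card_mono) auto
    then show ?thesis using vw(3) by simp
  qed
  ultimately show ?thesis using h by simp
qed

lemma comb_diagramD:
  assumes "comb_diagram chi k l D"
  shows "fatgraph (gam D)" "conn (gam D)" "\<forall>v\<in>verts (gam D). valence (gam D) v \<noteq> 2"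
    "euler_char (gam D) = chi" "length (lolls D) = k" "length (segs D) = l"
    "\<forall>A\<in>set (lolls D @ segs D @ map fst (trees D)). hclosed (gam D) A"
    "\<Union>(set (lolls D @ segs D @ map fst (trees D))) = hedges (gam D)"
    "\<forall>i<length (lolls D @ segs D @ map fst (trees D)). \<forall>j<i.
       (lolls D @ segs D @ map fst (trees D)) ! i \<inter> (lolls D @ segs D @ map fst (trees D)) ! j = {}"
    "\<forall>Q\<in>set (lolls D). fat_lollipop (subgraph (gam D) Q) \<and>
        (\<forall>a\<in>leaf_hedges (subgraph (gam D) Q). \<forall>h\<in>set (bcycle (subgraph (gam D) Q) a).
           bstep (gam D) h = bstep (subgraph (gam D) Q) h)"
    "\<forall>A\<in>set (segs D). is_segment (subgraph (gam D) A) \<and> card (A \<inter> leaf_hedges (gam D)) = 1"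
    "\<And>j A F. j < length (trees D) \<Longrightarrow> trees D ! j = (A, F) \<Longrightarrow>
        A \<inter> leaf_hedges (gam D) = {} \<and>
        F \<subseteq> {v \<in> src (gam D) ` A. valence (subgraph (gam D) A) v \<noteq> 1} \<and>
        is_tree (tree_of D j)"
    "\<forall>v\<in>verts (gam D). valence (gam D) v \<noteq> 1 \<longrightarrow>
        (\<exists>!i. i < k \<and> v \<in> src (gam D) ` (lolls D ! i)) \<and> (\<forall>(A, F)\<in>set (trees D). v \<notin> F)
        \<or> v \<notin> loll_verts D \<and> (\<exists>!j. j < length (trees D) \<and> v \<in> snd (trees D ! j))"
    "set (lvs D) = (\<Union>j<length (trees D). leaf_hedges (tree_of D j))"
  using assms unfolding comb_diagram_def Let_def by (simp_all split: prod.splits)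

text \<open>Lollipops contribute nothing to the Euler characteristic, a segment contributes its leaf and
  its edge, and a tree contributes its fundamental vertices and its edges.\<close>

lemma length_trees_le:
  assumes D: "comb_diagram chi k l D"
  shows "int (length (trees D)) \<le> - 2 * chi"
proof -
  let ?G = "gam D"
  let ?parts = "lolls D @ segs D @ map fst (trees D)"
  note C = comb_diagramD[OF D]
  have finV: "finite (verts ?G)" and finH: "finite (hedges ?G)" and srcV: "src ?G ` hedges ?G = verts ?G"
    using C(1) by (auto simp: fatgraph_def)
  have fin: "finite A" if "A \<in> set ?parts" for A
    using C(7) that finH by (auto simp: hclosed_def intro: finite_subset)
  have H: "card (hedges ?G) = sum_list (map card (lolls D)) + sum_list (map card (segs D))
      + sum_list (map (card \<circ> fst) (trees D))"
    using card_Union_list_disjoint[OF C(9)] fin C(8) by simp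
  have tr: "2 * card F < card A \<and> finite F" if "(A, F) \<in> set (trees D)" for A F
  proof -
    obtain j where j: "j < length (trees D)" "trees D ! j = (A, F)"
      using \<open>(A, F) \<in> set (trees D)\<close> by (auto simp: in_set_conv_nth)
    have A: "A \<in> set ?parts" using \<open>(A, F) \<in> set (trees D)\<close> by force
    have F: "F \<subseteq> {v \<in> src ?G ` A. valence (subgraph ?G A) v \<noteq> 1}" and "is_tree (tree_of D j)"
      using C(12)[OF j] by auto
    then have "is_tree (explode (subgraph ?G A) (src ?G ` A - F))"
      using j by (simp add: tree_of_def)
    moreover have "opp ?G ` A \<subseteq> A" using C(7) A by (auto simp: hclosed_def)
    ultimately have "2 * card F < card A"
      by (intro card_fundamental_lt[OF fin[OF A] _ F])
    moreover have "finite F" using F fin[OF A] by (intro finite_subset[OF F]) simp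
    ultimately show ?thesis by simp
  qed
  have S: "card (src ?G ` (A \<inter> leaf_hedges ?G)) \<le> 1" "card A = 2" if "A \<in> set (segs D)" for A
  proof -
    have A: "is_segment (subgraph ?G A)" "card (A \<inter> leaf_hedges ?G) = 1"
      using C(11) that by auto
    then show "card A = 2" by (simp add: is_segment_def subgraph_def)
    show "card (src ?G ` (A \<inter> leaf_hedges ?G)) \<le> 1"
      using A(2) fin that by (metis Un_iff card_image_le finite_Int set_append)
  qed
  have Q: "2 * card (src ?G ` A) = card A" if "A \<in> set (lolls D)" for A
    using fat_lollipop_card[of "subgraph ?G A"] C(10) that by (simp add: subgraph_def)
  \<comment> \<open>A univalent vertex is charged to the part containing its leaf half-edge, which
    cannot be a tree; every other vertex is charged to a lollipop or to a set of fundamental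
    vertices.\<close>
  have V: "verts ?G \<subseteq> (\<Union>A\<in>set (lolls D). src ?G ` A) \<union>
     (\<Union>A\<in>set (segs D). src ?G ` (A \<inter> leaf_hedges ?G)) \<union> (\<Union>T\<in>set (trees D). snd T)"
  proof
    fix v assume v: "v \<in> verts ?G"
    show "v \<in> (\<Union>A\<in>set (lolls D). src ?G ` A) \<union>
     (\<Union>A\<in>set (segs D). src ?G ` (A \<inter> leaf_hedges ?G)) \<union> (\<Union>T\<in>set (trees D). snd T)"
    proof (cases "valence ?G v = 1")
      case True
      obtain h where h: "h \<in> hedges ?G" "v = src ?G h" using v[folded srcV] by (meson imageE)
      then have hl: "h \<in> leaf_hedges ?G" using True by (simp add: leaf_hedges_def)
      obtain A where A: "A \<in> set ?parts" "h \<in> A" using h(1)[folded C(8)] by (meson UnionE)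
      show ?thesis
      proof (cases "A \<in> fst ` set (trees D)")
        case True
        then obtain j F where "j < length (trees D)" "trees D ! j = (A, F)"
          by (auto simp: in_set_conv_nth)
        then have False using C(12) hl A(2) by blast
        then show ?thesis ..
      next
        case False
        then have "A \<in> set (lolls D) \<or> A \<in> set (segs D)" using A(1) by auto
        then show ?thesis using A(2) h(2) hl by blast
      qed
    next
      case False
      then consider i where "i < k" "v \<in> src ?G ` (lolls D ! i)"
        | j where "j < length (trees D)" "v \<in> snd (trees D ! j)"
        using C(13) v by blast
      then show ?thesis using C(5) by cases (auto intro: nth_mem)
    qed
  qed
  have UN: "card (\<Union>x\<in>set xs. f x) \<le> (\<Sum>x\<leftarrow>xs. card (f x))" for f :: "'b \<Rightarrow> nat set" and xs
  proof (induction xs)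
    case (Cons x xs)
    then show ?case using card_Un_le[of "f x" "\<Union>x\<in>set xs. f x"] by simp
  qed simp
  let ?V1 = "\<Union>A\<in>set (lolls D). src ?G ` A" and ?V2 = "\<Union>A\<in>set (segs D). src ?G ` (A \<inter> leaf_hedges ?G)"
    and ?V3 = "\<Union>T\<in>set (trees D). snd T"
  have "finite (?V1 \<union> ?V2 \<union> ?V3)"
    using fin tr by auto
  then have "card (verts ?G) \<le> card (?V1 \<union> ?V2 \<union> ?V3)" using V by (rule card_mono)
  also have "\<dots> \<le> card ?V1 + card ?V2 + card ?V3"
    by (meson add_le_mono card_Un_le le_refl order_trans)
  finally have "card (verts ?G) \<le> card ?V1 + card ?V2 + card ?V3" .
  moreover have "2 * card ?V1 \<le> sum_list (map card (lolls D))"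
  proof -
    have "2 * card ?V1 \<le> (\<Sum>A\<leftarrow>lolls D. 2 * card (src ?G ` A))"
      using UN[of "\<lambda>A. src ?G ` A" "lolls D"] by (simp add: sum_list_const_mult)
    also have "\<dots> = sum_list (map card (lolls D))"
      by (rule arg_cong[of _ _ sum_list]) (use Q in auto)
    finally show ?thesis .
  qed
  moreover have "2 * card ?V2 \<le> sum_list (map card (segs D))"
  proof -
    have "2 * card ?V2 \<le> (\<Sum>A\<leftarrow>segs D. 2 * card (src ?G ` (A \<inter> leaf_hedges ?G)))"
      using UN[of "\<lambda>A. src ?G ` (A \<inter> leaf_hedges ?G)" "segs D"] by (simp add: sum_list_const_mult)
    also have "\<dots> \<le> sum_list (map card (segs D))"
      by (rule sum_list_mono) (use S in force)
    finally show ?thesis .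
  qed
  \<comment> \<open>The strict inequality between fundamental vertices and edges gains one for each
    tree; this gain is what bounds the number of trees.\<close>
  moreover have "2 * card ?V3 + length (trees D) \<le> sum_list (map (card \<circ> fst) (trees D))"
  proof -
    have "2 * card ?V3 + length (trees D) \<le> (\<Sum>T\<leftarrow>trees D. 2 * card (snd T) + 1)"
    proof -
      have "(\<Sum>T\<leftarrow>ts. 2 * card (snd T) + 1) = 2 * (\<Sum>T\<leftarrow>ts. card (snd T)) + length ts"
        for ts :: "(nat set \<times> nat set) list" by (induction ts) auto
      then show ?thesis using UN[of snd "trees D"] by simp
    qed
    also have "\<dots> \<le> sum_list (map (card \<circ> fst) (trees D))"
      by (rule sum_list_mono) (use tr in \<open>force simp: Suc_le_eq\<close>)
    finally show ?thesis .
  qed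
  \<comment> \<open>\<open>euler_char\<close> halves with \<open>div\<close>; parity makes this
    exact.\<close>
  moreover have "2 * (card (hedges ?G) div 2) = card (hedges ?G)"
  proof -
    have "hclosed ?G (hedges ?G)" using C(1) by (auto simp: hclosed_def fatgraph_def)
    then show ?thesis using even_card_hclosed[OF C(1)] by simp
  qed
  moreover have "chi = int (card (verts ?G)) - int (card (hedges ?G) div 2)"
    using C(4) by (simp add: euler_char_def)
  ultimately show ?thesis using H by linarith
qed

text \<open>The half-edges: \<open>a\<close>, \<open>t\<close> are the input and output leaves, \<open>b\<close>, \<open>s\<close> their opposites, and
  \<open>x\<close>, \<open>y\<close> are the half-edges met by the input boundary cycle; a prime marks the opposite half-edge
  (in \<open>one_arc\<close>, only \<open>x\<close> is met, and \<open>y\<close> is its opposite).\<close>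

definition one_arc :: "diagram \<Rightarrow> nat \<Rightarrow> nat \<Rightarrow> nat \<Rightarrow> nat \<Rightarrow> nat \<Rightarrow> nat \<Rightarrow> bool" where
  "one_arc D a b x y s t \<longleftrightarrow> (let G = gam D in
     distinct [a, b, x, y, s, t] \<and> hedges G = {a, b, x, y, s, t} \<and>
     lolls D = [{a, b, x, y}] \<and> segs D = [{s, t}] \<and> trees D = [] \<and>
     opp G a = b \<and> opp G b = a \<and> opp G x = y \<and> opp G y = x \<and> opp G s = t \<and> opp G t = s \<and>
     nxt G a = a \<and> nxt G t = t \<and> nxt G b = x \<and> nxt G x = s \<and> nxt G s = y \<and> nxt G y = b \<and>
     src G x = src G b \<and> src G s = src G b \<and> src G y = src G b \<and>
     distinct [src G a, src G b, src G t])"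

text \<open>The two trivalent vertices are the base point of the lollipop and the attaching point of
  the output segment; in \<open>one_arc\<close> they coincide in a four-valent vertex. The half-edge
  s sits in the corner from y to x', away from the corner from x' to y through which the input
  boundary cycle passes.\<close>

definition two_arcs :: "diagram \<Rightarrow> nat \<Rightarrow> nat \<Rightarrow> nat \<Rightarrow> nat \<Rightarrow> nat \<Rightarrow> nat \<Rightarrow> nat \<Rightarrow> nat \<Rightarrow> bool" where
  "two_arcs D a b x x' y y' s t \<longleftrightarrow> (let G = gam D in
     distinct [a, b, x, x', y, y', s, t] \<and> hedges G = {a, b, x, x', y, y', s, t} \<and>
     lolls D = [{a, b, x, x', y, y'}] \<and> segs D = [{s, t}] \<and> trees D = [] \<and>
     opp G a = b \<and> opp G b = a \<and> opp G x = x' \<and> opp G x' = x \<and> opp G y = y' \<and> opp G y' = y \<and>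
     opp G s = t \<and> opp G t = s \<and>
     nxt G a = a \<and> nxt G t = t \<and> nxt G b = x \<and> nxt G x = y' \<and> nxt G y' = b \<and>
     nxt G x' = y \<and> nxt G y = s \<and> nxt G s = x' \<and>
     src G x = src G b \<and> src G y' = src G b \<and> src G y = src G x' \<and> src G s = src G x' \<and>
     distinct [src G a, src G b, src G x', src G t])"

text \<open>Every bivalent vertex of the lollipop must carry the output segment, so there is at most one.\<close>

lemma diagram_0_1_1_cases:
  assumes D: "comb_diagram 0 1 1 D"
  shows "(\<exists>a b x y s t. one_arc D a b x y s t) \<or> (\<exists>a b x x' y y' s t. two_arcs D a b x x' y y' s t)"
proof -
  let ?G = "gam D"
  note C = comb_diagramD[OF D]
  have tr: "trees D = []" using length_trees_le[OF D] by simp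
  obtain Q S where QS: "lolls D = [Q]" "segs D = [S]"
    using C(5,6) by (metis One_nat_def length_0_conv length_Suc_conv)
  let ?P = "subgraph ?G Q"
  have fatG: "fatgraph ?G" by (fact C(1))
  have H: "hedges ?G = Q \<union> S" using C(8) QS tr by auto
  have disj: "Q \<inter> S = {}"
    using C(9)[rule_format, of 1 0] QS tr by (simp add: Int_commute)
  have clQ: "opp ?G ` Q \<subseteq> Q" and clS: "opp ?G ` S \<subseteq> S" using C(7) QS by (auto simp: hclosed_def)
  have opp: "opp ?G h \<noteq> h" "opp ?G (opp ?G h) = h" if "h \<in> hedges ?G" for h
    using fatG that by (auto simp: fatgraph_def)
  have lol: "fat_lollipop ?P" using C(10) QS by simp
  have bst: "bstep ?G h = bstep ?P h" if "a \<in> leaf_hedges ?P" "h \<in> set (bcycle ?P a)" for a h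
    using C(10) QS that by simp
  have fatP: "fatgraph ?P" and connP: "conn ?P" using lol by (auto simp: fat_lollipop_def)
  have P: "hedges ?P = Q" "src ?P = src ?G" "opp ?P = opp ?G" "verts ?P = src ?G ` Q"
    by (auto simp: subgraph_def)
  obtain a where a: "a \<in> Q" "valence ?P (src ?G a) = 1" "valence ?P (src ?G (opp ?G a)) = 3"
    and biv: "\<And>v. v \<in> src ?G ` Q \<Longrightarrow> v \<noteq> src ?G a \<Longrightarrow> v \<noteq> src ?G (opp ?G a) \<Longrightarrow> valence ?P v = 2"
    using lol unfolding fat_lollipop_def P by blast
  define b where "b = opp ?G a"
  have b: "b \<in> Q" "opp ?G a = b" "opp ?G b = a" "b \<noteq> a" "valence ?P (src ?G b) = 3"
    using a clQ opp H unfolding b_def by auto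
  have ab: "src ?G a \<noteq> src ?G b" using a b by auto
  note fa = fatgraph_fiber1[OF fatP, of a, unfolded P, OF a(1,2)]
  note fb = fatgraph_fiber3[OF fatP, of b, unfolded P, OF b(1,5)]
  define x where "x = nxt ?P b"
  define z where "z = nxt ?P x"
  have nP: "nxt ?P a = a" "nxt ?P b = x" "nxt ?P x = z" "nxt ?P z = b"
    and Fa: "\<And>h. h \<in> Q \<Longrightarrow> src ?G h = src ?G a \<longleftrightarrow> h = a"
    and Fb: "\<And>h. h \<in> Q \<and> src ?G h = src ?G b \<longleftrightarrow> h = b \<or> h = x \<or> h = z"
    and dist: "distinct [a, b, x, z]"
    using fa fb ab unfolding x_def z_def by (auto simp: set_eq_iff)
  have xz: "x \<in> Q" "z \<in> Q" using Fb by blast+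
  have leafa: "a \<in> leaf_hedges ?P" using a by (simp add: leaf_hedges_def P)
  have valG: "valence ?G v = valence ?P v + card {h \<in> S. src ?G h = v}" for v
  proof -
    have "{h \<in> hedges ?G. src ?G h = v} = {h \<in> Q. src ?G h = v} \<union> {h \<in> S. src ?G h = v}"
      using H by auto
    moreover have "finite Q" "finite S" using fatG H by (auto simp: fatgraph_def)
    ultimately show ?thesis using disj unfolding valence_def P
      by (subst card_Un_disjoint[symmetric]) auto
  qed
  obtain t where t: "t \<in> S" "t \<in> leaf_hedges ?G" "S \<inter> leaf_hedges ?G = {t}"
  proof -
    have "card (S \<inter> leaf_hedges ?G) = 1" using C(11) QS by simp
    then obtain t where "S \<inter> leaf_hedges ?G = {t}" by (auto simp: card_1_singleton_iff)
    with that[of t] show thesis by blast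
  qed
  define s where "s = opp ?G t"
  have s: "s \<in> S" "opp ?G t = s" "opp ?G s = t" "s \<noteq> t"
    using t clS opp H unfolding s_def by auto
  have "card S = 2" using C(11) QS by (simp add: is_segment_def subgraph_def)
  then have S: "S = {s, t}" using s(1,4) t(1) by (auto simp: card_2_iff)
  have tval: "valence ?G (src ?G t) = 1" using t by (simp add: leaf_hedges_def)
  note ft = fatgraph_fiber1[OF fatG, of t, OF _ tval]
  have nt: "nxt ?G t = t" "\<And>h. h \<in> hedges ?G \<Longrightarrow> src ?G h = src ?G t \<longleftrightarrow> h = t"
    using ft t H by auto
  have "s \<notin> leaf_hedges ?G" using t s by auto
  then have sval: "valence ?G (src ?G s) \<noteq> 1" using s H by (simp add: leaf_hedges_def)
  \<comment> \<open>An internal vertex off the lollipop would have to be fundamental in a tree, and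
    there are none.\<close>
  have sQ: "src ?G s \<in> src ?G ` Q"
  proof -
    have "src ?G s \<in> verts ?G" using fatG s H by (auto simp: fatgraph_def)
    then show ?thesis using C(13)[rule_format, of "src ?G s"] sval tr QS by (auto simp: Ex1_def)
  qed
  have B: "v = src ?G a \<or> v = src ?G b \<or> v = src ?G s" if v: "v \<in> src ?G ` Q" for v
  proof (rule ccontr)
    assume n: "\<not> ?thesis"
    then have "valence ?P v = 2" using biv v b by auto
    moreover have "v \<in> verts ?G" using v H fatG by (auto simp: fatgraph_def)
    then have "valence ?G v \<noteq> 2" using C(3) by blast
    ultimately have "card {h \<in> S. src ?G h = v} \<noteq> 0" using valG[of v] by simp
    then have "{h \<in> S. src ?G h = v} \<noteq> {}" by (metis card.empty)
    then have "src ?G t = v" using n S by auto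
    then show False using v nt(2) t disj H by auto
  qed
  have oppQ: "opp ?G h \<in> Q" "opp ?G h \<noteq> h" "opp ?G (opp ?G h) = h" if "h \<in> Q" for h
    using that clQ opp H by auto
  have oppab: "opp ?G h \<noteq> a" "opp ?G h \<noteq> b" if "h \<in> Q" "h \<noteq> a" "h \<noteq> b" for h
    using oppQ(3)[OF that(1)] that b by auto
  have injG: "h = h'" if "h \<in> hedges ?G" "h' \<in> hedges ?G" "nxt ?G h = nxt ?G h'" for h h'
    using fatG that by (auto simp: fatgraph_def bij_betw_def inj_on_def)
  have HG: "hedges ?G = insert s (insert t Q)" using H S by auto
  have stQ: "s \<notin> Q" "t \<notin> Q" using disj S by auto
  show ?thesis
  proof (cases "src ?G s \<in> {src ?G a, src ?G b}")
    case True
    then have srcQ: "src ?G h = src ?G a \<or> src ?G h = src ?G b" if "h \<in> Q" for h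
      using B that by force
    then have Q: "Q = {a, b, x, z}" using Fa Fb a(1) by blast
    have ox: "opp ?G x = z" "opp ?G z = x"
      using oppQ[of x] oppab[of x] dist Q by auto
    have "bcycle ?P (hd [a, x, b]) = [a, x, b]"
    proof (rule bcycle_eqI)
      fix i assume "i < length [a, x, b]"
      then have "i = 0 \<or> i = 1 \<or> i = 2" by auto
      then show "bstep ?P ([a, x, b] ! i) = [a, x, b] ! (Suc i mod length [a, x, b])"
        using nP ox b by (auto simp: bstep_def P)
    qed (use dist in auto)
    \<comment> \<open>The marked boundary cycle is the same in the lollipop and in the diagram. This
      fixes \<open>nxt\<close> of the whole graph at the opposites of its half-edges; the remaining
      values are forced by the valences.\<close>
    then have bc: "bstep ?G h = bstep ?P h" if "h \<in> {a, x, b}" for h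
      using bst[OF leafa] that by auto
    have nG: "nxt ?G b = x" "nxt ?G z = b" "nxt ?G a = a"
      using bc[of a] bc[of x] bc[of b] nP ox b by (auto simp: bstep_def P)
    have aH: "a \<in> hedges ?G" "b \<in> hedges ?G" "s \<in> hedges ?G" "x \<in> hedges ?G" using HG Q by auto
    \<comment> \<open>The input leaf half-edge is fixed by \<open>nxt\<close> in the whole graph, so
      no second half-edge starts there.\<close>
    have sa: "src ?G s \<noteq> src ?G a"
    proof
      assume e: "src ?G s = src ?G a"
      then obtain n where "(nxt ?G ^^ n) a = s" using fatG aH by (metis fatgraph_def)
      moreover have "(nxt ?G ^^ n) a = a" for n using nG by (induction n) auto
      ultimately show False using stQ a by auto
    qed
    then have sb: "src ?G s = src ?G b" using True by auto
    have "src ?G t \<noteq> src ?G b" using nt(2)[OF aH(2)] stQ(2) b(1) by metis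
    then have "{h \<in> S. src ?G h = src ?G b} = {s}" using S sb by auto
    then have v4: "valence ?G (src ?G b) = 4" using valG[of "src ?G b"] b by simp
    note f4 = fatgraph_fiber4[OF fatG aH(2) v4, unfolded nG]
    \<comment> \<open>Four steps lead from b back to b, and z is the only predecessor of b.\<close>
    have "nxt ?G (nxt ?G x) = z"
      using f4(1,2) nG(2) injG HG xz by (metis (no_types, lifting) insert_iff mem_Collect_eq)
    moreover have "nxt ?G x = s"
    proof -
      have "s \<in> {b, x, nxt ?G x, nxt ?G (nxt ?G x)}" using f4(1) aH sb by blast
      then show ?thesis using \<open>nxt ?G (nxt ?G x) = z\<close> stQ b xz by auto
    qed
    moreover have "distinct [a, b, x, z, s, t]" using dist stQ s(4) Q by auto
    moreover have "hedges ?G = {a, b, x, z, s, t}" using HG Q by auto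
    moreover have "src ?G x = src ?G b" "src ?G z = src ?G b" using Fb by blast+
    moreover have "src ?G t \<noteq> src ?G a" using nt(2)[OF aH(1)] stQ(2) a(1) by metis
    moreover note \<open>src ?G t \<noteq> src ?G b\<close>
    ultimately have "one_arc D a b x z s t"
      unfolding one_arc_def Let_def using Q QS S tr b ox s nG nt sb ab by simp
    then show ?thesis by blast
  next
    case False
    then have s2: "valence ?P (src ?G s) = 2" using biv sQ b by auto
    obtain p where p: "p \<in> Q" "src ?G p = src ?G s" using sQ by force
    note fp = fatgraph_fiber2[OF fatP, unfolded P]
    have Fs: "\<And>h. h \<in> Q \<and> src ?G h = src ?G s \<longleftrightarrow> h = p \<or> h = nxt ?P p" and pn: "nxt ?P p \<noteq> p"
      using fp[OF p(1)] s2 p by (auto simp: set_eq_iff)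
    have srcQ: "src ?G h = src ?G a \<or> src ?G h = src ?G b \<or> src ?G h = src ?G s" if "h \<in> Q" for h
      using B that by force
    have Q0: "Q = {a, b, x, z, p, nxt ?P p}" using srcQ Fa Fb Fs a(1) by blast
    have "src ?G x = src ?G b" "src ?G z = src ?G b" using Fb by blast+
    then have sep: "h \<notin> {a, b, x, z}" if "src ?G h = src ?G s" for h using False that by auto
    have pd: "p \<notin> {a, b, x, z}" "nxt ?P p \<notin> {a, b, x, z}" using sep Fs by blast+
    \<comment> \<open>Otherwise the arc from x would close up at the base point, and the remaining
      two half-edges would form a separate component.\<close>
    have oxz: "opp ?G x \<noteq> z"
    proof
      assume oz: "opp ?G x = z"
      then have "opp ?G z = x" using oppQ xz by force
      then have op: "opp ?G h \<in> {p, nxt ?P p}" if h: "h \<in> {p, nxt ?P p}" for h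
      proof -
        have hQ: "h \<in> Q" "h \<noteq> a" "h \<noteq> b" "h \<noteq> x" "h \<noteq> z" using h pd Q0 by blast+
        have "opp ?G h \<noteq> x" "opp ?G h \<noteq> z"
          using oppQ(3)[OF hQ(1)] oz \<open>opp ?G z = x\<close> hQ by auto
        then show ?thesis using oppQ(1)[OF hQ(1)] oppab[OF hQ(1-3)] Q0 by blast
      qed
      have "v = src ?G s" if "(src ?G s, v) \<in> (adj ?P)\<^sup>*" for v
        using that
      proof (induction rule: rtrancl_induct)
        case (step v w)
        then obtain h where "h \<in> Q" "src ?G h = src ?G s" "w = src ?G (opp ?G h)"
          by (auto simp: adj_def P)
        then show ?case using op Fs by blast
      qed simp
      moreover have "(src ?G s, src ?G b) \<in> (adj ?P)\<^sup>*" using connP sQ b by (auto simp: conn_def P)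
      ultimately have "src ?G b = src ?G s" by blast
      then show False using False by simp
    qed
    define x' where "x' = opp ?G x"
    have x': "x' \<in> Q" "x' \<notin> {a, b, x, z}" "opp ?G x' = x" "opp ?G x = x'"
      using oppQ[of x] oppab[of x] oxz xz dist by (auto simp: x'_def)
    then have sx': "src ?G x' = src ?G s" using Q0 Fs by auto
    define y where "y = nxt ?P x'"
    have Fs': "\<And>h. h \<in> Q \<and> src ?G h = src ?G s \<longleftrightarrow> h = x' \<or> h = y" and ny: "nxt ?P y = x'" and yx: "y \<noteq> x'"
      using fp[OF x'(1)] s2 sx' unfolding y_def by (auto simp: set_eq_iff)
    have Q: "Q = {a, b, x, x', y, z}" using srcQ Fa Fb Fs' a(1) by blast
    have yd: "y \<notin> {a, b, x, z}" using sep Fs' by blast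
    have "opp ?G y = z"
      using oppQ[of y] oppab[of y] yd yx Q oppQ(3)[of x] x' by auto
    then have oy: "opp ?G y = z" "opp ?G z = y" using oppQ(3)[of y] Q by auto
    have "bcycle ?P (hd [a, x, y, b]) = [a, x, y, b]"
    proof (rule bcycle_eqI)
      fix i assume "i < length [a, x, y, b]"
      then have "i = 0 \<or> i = 1 \<or> i = 2 \<or> i = 3" by auto
      then show "bstep ?P ([a, x, y, b] ! i) = [a, x, y, b] ! (Suc i mod length [a, x, y, b])"
        using nP oy x' b y_def by (auto simp: bstep_def P)
    qed (use dist yd in auto)
    then have bc: "bstep ?G h = bstep ?P h" if "h \<in> {a, x, y, b}" for h
      using bst[OF leafa] that by auto
    have nG: "nxt ?G b = x" "nxt ?G z = b" "nxt ?G a = a" "nxt ?G x' = y"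
      using bc[of a] bc[of x] bc[of b] bc[of y] nP oy x' b y_def by (auto simp: bstep_def P)
    have aH: "a \<in> hedges ?G" "b \<in> hedges ?G" "s \<in> hedges ?G" "x' \<in> hedges ?G" using HG Q by auto
    have tn: "src ?G t \<noteq> src ?G b" "src ?G t \<noteq> src ?G s" "src ?G t \<noteq> src ?G a"
      using nt(2)[OF aH(2)] nt(2)[OF aH(3)] nt(2)[OF aH(1)] stQ(2) b(1) s(4) a(1) by metis+
    then have Sb: "{h \<in> S. src ?G h = src ?G b} = {}" and Ss: "{h \<in> S. src ?G h = src ?G s} = {s}"
      using S False by auto
    have v3: "valence ?G (src ?G b) = 3" "valence ?G (src ?G x') = 3"
      unfolding sx' valG Sb Ss b(5) s2 by simp_all
    note f3 = fatgraph_fiber3[OF fatG aH(2) v3(1), unfolded nG]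
    note g3 = fatgraph_fiber3[OF fatG aH(4) v3(2), unfolded nG]
    have "nxt ?G x = z"
    proof -
      have "z \<in> {b, x, nxt ?G x}" using f3(1) HG xz Fb by blast
      then show ?thesis using dist by auto
    qed
    moreover have "nxt ?G y = s"
    proof -
      have "s \<in> {x', y, nxt ?G y}" using g3(1) aH sx' by auto
      then show ?thesis using stQ Q by auto
    qed
    moreover have "nxt ?G s = x'" using g3(2) calculation by simp
    moreover have "distinct [a, b, x, x', y, z, s, t]" using dist stQ s(4) Q x'(2) yd yx by auto
    moreover have "hedges ?G = {a, b, x, x', y, z, s, t}" using HG Q by auto
    moreover have "src ?G x = src ?G b" "src ?G z = src ?G b" "src ?G y = src ?G s"
      using Fb Fs' by blast+
    moreover have "src ?G a \<noteq> src ?G s" "src ?G b \<noteq> src ?G s" using False by auto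
    ultimately have "two_arcs D a b x x' y z s t"
      unfolding two_arcs_def Let_def
      using Q QS S tr b x'(3,4) oy s nG nt sx' ab tn by simp
    then show ?thesis by blast
  qed
qed

section \<open>The realization as a circle\<close>

text \<open>\<open>bdry\<close> takes the least index whose cumulative length reaches s, so a
  parameter falling on a vertex belongs to the edge that ends there. Hence the strict bound on the
  left, with an exception for the first edge, which receives the parameter zero.\<close>

lemma bdry_eq:
  assumes "bcycle G h = ps @ g # qs" "\<forall>g\<in>set ps. 0 \<le> L g"
    and "s = sum_list (map L (bcycle G h)) * t"
    and "ps = [] \<or> sum_list (map L ps) < s" "s \<le> sum_list (map L ps) + L g"
  shows "bdry G L h t = rpt G L (g, s - sum_list (map L ps))"
proof -
  have least: "(LEAST i. s \<le> sum_list (map L (take (Suc i) (ps @ g # qs)))) = length ps"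
  proof (rule Least_equality)
    show "s \<le> sum_list (map L (take (Suc (length ps)) (ps @ g # qs)))" using assms(5) by simp
    fix j assume j: "s \<le> sum_list (map L (take (Suc j) (ps @ g # qs)))"
    show "length ps \<le> j"
    proof (rule ccontr)
      assume n: "\<not> length ps \<le> j"
      then have "sum_list (map L (take (Suc j) (ps @ g # qs))) = sum_list (map L (take (Suc j) ps))" by simp
      also have "\<dots> \<le> sum_list (map L (take (Suc j) ps)) + sum_list (map L (drop (Suc j) ps))"
        using assms(2) by (auto intro!: sum_list_nonneg dest!: in_set_dropD)
      also have "\<dots> = sum_list (map L ps)"
        by (metis append_take_drop_id map_append sum_list_append)
      finally show False using assms(4) n j by auto
    qed
  qed
  have "sum_list (map L (ps @ g # qs)) * t = s" using assms(1,3) by simp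
  then show ?thesis unfolding bdry_def Let_def assms(1) least by (simp only: least) simp
qed

lemma rpt_cong: "equivclp (pglue G L) p q \<Longrightarrow> rpt G L p = rpt G L q"
  unfolding rpt_def by (meson equivclp_sym equivclp_trans)

lemma rpt_flip: "(h, t) \<in> prepts G L \<Longrightarrow> rpt G L (h, t) = rpt G L (opp G h, L h - t)"
  by (intro rpt_cong r_into_equivclp pglue.flip)

lemma rpt_ends: "h \<in> hedges G \<Longrightarrow> h' \<in> hedges G \<Longrightarrow> src G h = src G h' \<Longrightarrow> rpt G L (h, 0) = rpt G L (h', 0)"
  by (intro rpt_cong r_into_equivclp pglue.ends)

text \<open>A function constant on generating pairs descends to the quotient. Used contrapositively,
  it separates points without a description of the generated equivalence relation.\<close>

lemma rpt_eq_imp_eq: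
  assumes inv: "\<And>p q. pglue G L p q \<Longrightarrow> f p = f q"
    and "p \<in> prepts G L" "rpt G L p = rpt G L q"
  shows "f p = f q"
proof -
  have "p \<in> rpt G L q" using assms(2,3) by (auto simp: rpt_def equivclp_def)
  then have "equivclp (pglue G L) q p" by (simp add: rpt_def)
  then show ?thesis
    by (induction rule: equivclp_induct) (auto dest: inv)
qed

text \<open>f inverts the input parametrization: \<open>ins\<close> says that it recovers the
  parameter, which gives injectivity, and \<open>pts\<close> turns the coordinate of any point, here
  a point of the output cycle, back into an input parameter.\<close>

lemma circle_coordinate:
  assumes inv: "\<And>p q. pglue G L p q \<Longrightarrow> f p = f q"
    and ins: "\<And>u. u \<in> {0..<1} \<Longrightarrow> \<exists>p\<in>prepts G L. bdry G L a u = rpt G L p \<and> f p = u"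
    and outs: "\<And>v. v \<in> {0..<1} \<Longrightarrow> \<exists>p\<in>prepts G L. bdry_bar G L t v = rpt G L p \<and> f p = frac (c + v)"
    and pts: "\<And>p. p \<in> prepts G L \<Longrightarrow> rpt G L p = bdry G L a (f p)"
  shows "inj_on (bdry G L a) {0..<1::real}"
    and "v \<in> {0..<1} \<Longrightarrow> bdry_bar G L t v = bdry G L a (frac (c + v))"
proof -
  show "inj_on (bdry G L a) {0..<1}"
  proof (rule inj_onI)
    fix u w :: real assume uw: "u \<in> {0..<1}" "w \<in> {0..<1}" "bdry G L a u = bdry G L a w"
    obtain p where p: "p \<in> prepts G L" "bdry G L a u = rpt G L p" "f p = u" using ins[OF uw(1)] by metis
    obtain q where q: "q \<in> prepts G L" "bdry G L a w = rpt G L q" "f q = w" using ins[OF uw(2)] by metis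
    have "f p = f q" by (rule rpt_eq_imp_eq[OF inv p(1)], assumption) (metis p(2) q(2) uw(3))
    then show "u = w" using p q by simp
  qed
  show "bdry_bar G L t v = bdry G L a (frac (c + v))" if v: "v \<in> {0..<1}"
  proof -
    obtain p where "p \<in> prepts G L" "bdry_bar G L t v = rpt G L p" "f p = frac (c + v)"
      using outs[OF v] by metis
    then show ?thesis using pts[of p] by simp
  qed
qed

lemma frac_eqI:
  fixes z z' :: real
  assumes "z = z' \<or> z = z' + 1 \<or> z = z' - 1"
  shows "frac z = frac z'"
  using assms by (auto simp: frac_def)

lemma card_distinct_6_8:
  "distinct [a, b, c, d, e, f] \<Longrightarrow> card {a, b, c, d, e, f} = 6"
  "distinct [a, b, c, d, e, f, g, h] \<Longrightarrow> card {a, b, c, d, e, f, g, h} = 8"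
  by simp_all

text \<open>A diagram with six half-edges is of the form \<open>one_arc\<close>, so the output segment sits at the base
  point; otherwise there are eight.\<close>

definition circle_pos :: "diagram \<Rightarrow> lens \<Rightarrow> real" where
  "circle_pos D L = (if card (hedges (gam D)) = 6 then 0
     else frac (L (bstep (gam D) (in_mark D 0))))"

section \<open>Boundary cycles and edge lengths of the two combinatorial types\<close>

lemma filter_insert:
  "{h \<in> insert a A. P h} = (if P a then insert a {h \<in> A. P h} else {h \<in> A. P h})"
  by auto

lemma one_arc_marks:
  assumes "one_arc D a b x y s t"
  shows "leaf_hedges (gam D) = {a, t}" "in_mark D 0 = a" "out_mark D 0 = t"
    "bcycle (gam D) a = [a, x, b]" "bcycle (gam D) t = [t, y, s]"
proof -
  note A = assms[unfolded one_arc_def Let_def]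
  let ?G = "gam D"
  have QS: "lolls D = [{a, b, x, y}]" "segs D = [{s, t}]"
    and o: "opp ?G a = b" "opp ?G b = a" "opp ?G x = y" "opp ?G y = x" "opp ?G s = t" "opp ?G t = s"
      "nxt ?G a = a" "nxt ?G t = t" "nxt ?G b = x" "nxt ?G x = s" "nxt ?G s = y" "nxt ?G y = b"
    using A by simp_all
  have H: "hedges ?G = {a, b, x, y, s, t}" and d: "distinct [a, b, x, y, s, t]"
    and e: "src ?G x = src ?G b" "src ?G s = src ?G b" "src ?G y = src ?G b"
    and n': "distinct [src ?G a, src ?G b, src ?G t]"
    using A by simp_all
  have n: "distinct [src ?G t, src ?G b, src ?G a]" using n' by auto
  have val: "valence ?G (src ?G a) = 1" "valence ?G (src ?G t) = 1" "valence ?G (src ?G b) = 4"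
    unfolding valence_def H filter_insert e using d n n' by simp_all
  show lf: "leaf_hedges ?G = {a, t}"
    unfolding leaf_hedges_def H filter_insert by (simp add: val e)
  show "in_mark D 0 = a" "out_mark D 0 = t"
    unfolding in_mark_def out_mark_def lf QS using d by (auto intro!: the_equality)
  have "bcycle ?G (hd [a, x, b]) = [a, x, b]"
  proof (rule bcycle_eqI)
    fix i assume "i < length [a, x, b]"
    then have "i = 0 \<or> i = 1 \<or> i = 2" by auto
    then show "bstep ?G ([a, x, b] ! i) = [a, x, b] ! (Suc i mod length [a, x, b])"
      by (auto simp: bstep_def o)
  qed (use d in auto)
  then show "bcycle (gam D) a = [a, x, b]" by simp
  have "bcycle ?G (hd [t, y, s]) = [t, y, s]"
  proof (rule bcycle_eqI)
    fix i assume "i < length [t, y, s]"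
    then have "i = 0 \<or> i = 1 \<or> i = 2" by auto
    then show "bstep ?G ([t, y, s] ! i) = [t, y, s] ! (Suc i mod length [t, y, s])"
      by (auto simp: bstep_def o)
  qed (use d in auto)
  then show "bcycle (gam D) t = [t, y, s]" by simp
qed

lemma two_arcs_marks:
  assumes "two_arcs D a b x x' y y' s t"
  shows "leaf_hedges (gam D) = {a, t}" "in_mark D 0 = a" "out_mark D 0 = t"
    "bcycle (gam D) a = [a, x, y, b]" "bcycle (gam D) t = [t, x', y', s]"
proof -
  note A = assms[unfolded two_arcs_def Let_def]
  let ?G = "gam D"
  have QS: "lolls D = [{a, b, x, x', y, y'}]" "segs D = [{s, t}]"
    and o: "opp ?G a = b" "opp ?G b = a" "opp ?G x = x'" "opp ?G x' = x" "opp ?G y = y'" "opp ?G y' = y"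
      "opp ?G s = t" "opp ?G t = s" "nxt ?G a = a" "nxt ?G t = t" "nxt ?G b = x" "nxt ?G x = y'"
      "nxt ?G y' = b" "nxt ?G x' = y" "nxt ?G y = s" "nxt ?G s = x'"
    using A by simp_all
  have H: "hedges ?G = {a, b, x, x', y, y', s, t}" and d: "distinct [a, b, x, x', y, y', s, t]"
    and e: "src ?G x = src ?G b" "src ?G y' = src ?G b" "src ?G y = src ?G x'" "src ?G s = src ?G x'"
    and n': "distinct [src ?G a, src ?G b, src ?G x', src ?G t]"
    using A by simp_all
  have n: "distinct [src ?G t, src ?G x', src ?G b, src ?G a]" using n' by auto
  have val: "valence ?G (src ?G a) = 1" "valence ?G (src ?G t) = 1" "valence ?G (src ?G b) = 3"
    "valence ?G (src ?G x') = 3"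
    unfolding valence_def H filter_insert e using d n n' by simp_all
  show lf: "leaf_hedges ?G = {a, t}"
    unfolding leaf_hedges_def H filter_insert by (simp add: val e)
  show "in_mark D 0 = a" "out_mark D 0 = t"
    unfolding in_mark_def out_mark_def lf QS using d by (auto intro!: the_equality)
  have "bcycle ?G (hd [a, x, y, b]) = [a, x, y, b]"
  proof (rule bcycle_eqI)
    fix i assume "i < length [a, x, y, b]"
    then have "i = 0 \<or> i = 1 \<or> i = 2 \<or> i = 3" by auto
    then show "bstep ?G ([a, x, y, b] ! i) = [a, x, y, b] ! (Suc i mod length [a, x, y, b])"
      by (auto simp: bstep_def o)
  qed (use d in auto)
  then show "bcycle (gam D) a = [a, x, y, b]" by simp
  have "bcycle ?G (hd [t, x', y', s]) = [t, x', y', s]"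
  proof (rule bcycle_eqI)
    fix i assume "i < length [t, x', y', s]"
    then have "i = 0 \<or> i = 1 \<or> i = 2 \<or> i = 3" by auto
    then show "bstep ?G ([t, x', y', s] ! i) = [t, x', y', s] ! (Suc i mod length [t, x', y', s])"
      by (auto simp: bstep_def o)
  qed (use d in auto)
  then show "bcycle (gam D) t = [t, x', y', s]" by simp
qed

lemma one_arc_lens:
  assumes "one_arc D a b x y s t" "L \<in> cell D"
  shows "L a = 0" "L b = 0" "L s = 0" "L t = 0" "L x = 1" "L y = 1"
proof -
  note A = assms(1)[unfolded one_arc_def Let_def]
  have L: "\<And>h. h \<in> hedges (gam D) \<Longrightarrow> L (opp (gam D) h) = L h"
    "\<And>h. h \<in> leaf_hedges (gam D) \<Longrightarrow> L h = 0" "\<And>Q. Q \<in> set (lolls D) \<Longrightarrow> tot_len L Q = 1"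
    using assms(2) unfolding cell_def is_string_diagram_def pseudometric_def by blast+
  show 1: "L a = 0" "L t = 0" using L(2) one_arc_marks(1)[OF assms(1)] by auto
  then show 2: "L b = 0" "L s = 0" using L(1)[of a] L(1)[of t] A by simp_all
  have "L y = L x" using L(1)[of x] A by simp
  \<comment> \<open>\<open>tot_len\<close> halves a sum over half-edges, so total length one means
    half-edge sum two.\<close>
  moreover have "L a + (L b + (L x + L y)) = 2" using L(3)[of "{a, b, x, y}"] A by (simp add: tot_len_def)
  ultimately show "L x = 1" "L y = 1" using 1 2 by simp_all
qed

lemma two_arcs_lens:
  assumes "two_arcs D a b x x' y y' s t" "L \<in> cell D"
  shows "L a = 0" "L b = 0" "L s = 0" "L t = 0" "L x' = L x" "L y' = L y" "L x + L y = 1"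
    "L x \<ge> 0" "L y \<ge> 0"
proof -
  note A = assms(1)[unfolded two_arcs_def Let_def]
  have L: "\<And>h. h \<in> hedges (gam D) \<Longrightarrow> L (opp (gam D) h) = L h" "\<And>h. h \<in> hedges (gam D) \<Longrightarrow> L h \<ge> 0"
    "\<And>h. h \<in> leaf_hedges (gam D) \<Longrightarrow> L h = 0" "\<And>Q. Q \<in> set (lolls D) \<Longrightarrow> tot_len L Q = 1"
    using assms(2) unfolding cell_def is_string_diagram_def pseudometric_def by blast+
  show 1: "L a = 0" "L t = 0" using L(3) two_arcs_marks(1)[OF assms(1)] by auto
  then show 2: "L b = 0" "L s = 0" using L(1)[of a] L(1)[of t] A by simp_all
  show 3: "L x' = L x" "L y' = L y" "L x \<ge> 0" "L y \<ge> 0"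
    using L(1)[of x] L(1)[of y] L(2)[of x] L(2)[of y] A by simp_all
  have "L a + (L b + (L x + (L x' + (L y + L y')))) = 2"
    using L(4)[of "{a, b, x, x', y, y'}"] A by (simp add: tot_len_def)
  then show "L x + L y = 1" using 1 2 3 by simp
qed

text \<open>The output cycle t, x', y', s starts at the attaching vertex, at position
  \<open>L x\<close>, and runs through both arcs backwards. After the reversal in
  \<open>bdry_bar\<close> it follows the input circle with initial offset
  \<open>L x\<close>.\<close>

lemma two_arcs_circle:
  assumes A: "two_arcs D a b x x' y y' s t" and L: "L \<in> cell D"
  shows "inj_on (bdry (gam D) L a) {0..<1}"
    and "v \<in> {0..<1} \<Longrightarrow> bdry_bar (gam D) L t v = bdry (gam D) L a (frac (L x + v))"
proof -
  let ?G = "gam D"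
  have H: "hedges ?G = {a, b, x, x', y, y', s, t}" and d: "distinct [a, b, x, x', y, y', s, t]"
    and o: "opp ?G a = b" "opp ?G b = a" "opp ?G x = x'" "opp ?G x' = x" "opp ?G y = y'" "opp ?G y' = y"
      "opp ?G s = t" "opp ?G t = s"
    and e: "src ?G x = src ?G b" "src ?G y' = src ?G b" "src ?G y = src ?G x'" "src ?G s = src ?G x'"
    and n': "distinct [src ?G a, src ?G b, src ?G x', src ?G t]"
    using A[unfolded two_arcs_def Let_def] by simp_all
  have n: "distinct [src ?G t, src ?G x', src ?G b, src ?G a]" using n' by auto
  note l = two_arcs_lens[OF A L]
  note m = two_arcs_marks[OF A]
  have Ly: "L y = 1 - L x" using l by simp
  \<comment> \<open>the coordinate along the input boundary cycle\<close>
  define f :: "nat \<times> real \<Rightarrow> real" where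
    "f = (\<lambda>(h, r). frac (if h = x then r else if h = x' then L x - r else if h = y then L x + r
         else if h = y' then - r else if h \<in> {s, t} then L x else 0))"
  have fv: "f (a, r) = 0" "f (b, r) = 0" "f (x, r) = frac r" "f (x', r) = frac (L x - r)"
    "f (y, r) = frac (L x + r)" "f (y', r) = frac (- r)" "f (s, r) = frac (L x)" "f (t, r) = frac (L x)" for r
    using d by (auto simp: f_def)
  have inv: "f p = f q" if "pglue ?G L p q" for p q
    using that
  proof cases
    case (flip h r)
    then have "h \<in> {a, b, x, x', y, y', s, t}" using H by (simp add: prepts_def)
    then show ?thesis unfolding flip
      by (elim insertE emptyE) (simp_all add: o fv l Ly frac_eqI)
  next
    case (ends h h')
    then have "h \<in> {a, b, x, x', y, y', s, t}" "h' \<in> {a, b, x, x', y, y', s, t}" using H by simp_all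
    then show ?thesis using ends(5) unfolding ends(1,2)
      by (elim insertE emptyE; insert n n'; simp add: e fv)
  qed
  have in0: "bdry ?G L a 0 = rpt ?G L (a, 0)"
    using bdry_eq[of ?G a "[]" a "[x, y, b]" L 0 0] m l by simp
  have in1: "bdry ?G L a u = rpt ?G L (x, u)" if "0 < u" "u \<le> L x" for u
    using bdry_eq[of ?G a "[a]" x "[y, b]" L u u] m l that by simp
  have in2: "bdry ?G L a u = rpt ?G L (y, u - L x)" if "L x < u" "u \<le> 1" for u
    using bdry_eq[of ?G a "[a, x]" y "[b]" L u u] m l that by simp
  have out0: "bdry ?G L t 0 = rpt ?G L (t, 0)"
    using bdry_eq[of ?G t "[]" t "[x', y', s]" L 0 0] m l by simp
  have out1: "bdry ?G L t u = rpt ?G L (x', u)" if "0 < u" "u \<le> L x" for u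
    using bdry_eq[of ?G t "[t]" x' "[y', s]" L u u] m l that by simp
  have out2: "bdry ?G L t u = rpt ?G L (y', u - L x)" if "L x < u" "u \<le> 1" for u
    using bdry_eq[of ?G t "[t, x']" y' "[s]" L u u] m l that by simp
  have pre: "(h, r) \<in> prepts ?G L \<longleftrightarrow> h \<in> hedges ?G \<and> 0 \<le> r \<and> r \<le> L h" for h r
    by (simp add: prepts_def)
  have v0: "rpt ?G L (b, 0) = rpt ?G L (a, 0)" "rpt ?G L (x, 0) = rpt ?G L (a, 0)"
    "rpt ?G L (y', 0) = rpt ?G L (a, 0)"
    using rpt_flip[of a 0 ?G L] rpt_ends[of x ?G b L] rpt_ends[of y' ?G b L] H e o l by (simp_all add: pre)
  have v1: "rpt ?G L (x', 0) = rpt ?G L (x, L x)" "rpt ?G L (y, 0) = rpt ?G L (x, L x)"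
    "rpt ?G L (s, 0) = rpt ?G L (x, L x)" "rpt ?G L (t, 0) = rpt ?G L (x, L x)"
    using rpt_flip[of s 0 ?G L] rpt_ends[of y ?G x' L] rpt_ends[of s ?G x' L] rpt_flip[of x' 0 ?G L]
      H e o l by (simp_all add: pre)
  have v2: "rpt ?G L (y, L y) = rpt ?G L (a, 0)"
    using rpt_flip[of y' 0 ?G L] v0 H o l by (simp add: pre)
  \<comment> \<open>In this case the arc y has length zero, and its collapse closes the arc x up to
    a circle.\<close>
  have v3: "rpt ?G L (x, L x) = rpt ?G L (a, 0)" if "L x = 1"
    using v1(2) v2 Ly that by simp
  have px: "rpt ?G L (x, r) = bdry ?G L a (f (x, r))" if r: "0 \<le> r" "r \<le> L x" for r
  proof -
    consider "r = 0" | "0 < r" "r < 1" | "r = 1" "L x = 1" using r l by linarith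
    then show ?thesis by cases (use r in0 in1[of r] v0 v3 in \<open>simp_all add: fv\<close>)
  qed
  have py: "rpt ?G L (y, r) = bdry ?G L a (f (y, r))" if r: "0 \<le> r" "r \<le> L y" for r
  proof -
    consider "r = 0" | "0 < r" "L x + r < 1" | "r = L y" using r Ly by linarith
    then show ?thesis
    proof cases
      case 1
      then show ?thesis using v1(2) px[of "L x"] l by (simp add: fv)
    next
      case 2
      then show ?thesis using in2[of "L x + r"] l by (simp add: fv)
    next
      case 3
      then show ?thesis using v2 in0 Ly by (simp add: fv)
    qed
  qed
  have pts: "rpt ?G L p = bdry ?G L a (f p)" if "p \<in> prepts ?G L" for p
  proof -
    obtain h r where p: "p = (h, r)" by force
    have hr: "h \<in> {a, b, x, x', y, y', s, t}" "0 \<le> r" "r \<le> L h" using that H by (auto simp: p prepts_def)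
    from hr(1) consider "h = a \<or> h = b" | "h = x" | "h = x'" | "h = y" | "h = y'" | "h = s \<or> h = t" by auto
    then show ?thesis
    proof cases
      case 1
      then have "r = 0" using hr l by auto
      then show ?thesis using 1 in0 v0 by (auto simp: p fv)
    next
      case 2
      then show ?thesis using px hr by (simp add: p)
    next
      case 3
      then show ?thesis using px[of "L x - r"] rpt_flip[of x' r ?G L] hr l o H by (simp add: p pre fv)
    next
      case 4
      then show ?thesis using py hr by (simp add: p)
    next
      case 5
      have "frac (L x + (L y - r)) = frac (- r)" using Ly by (intro frac_eqI) simp
      then show ?thesis using 5 py[of "L y - r"] rpt_flip[of y' r ?G L] hr l o H by (simp add: p pre fv)
    next
      case 6
      then have "r = 0" using hr l by auto
      then show ?thesis using 6 px[of "L x"] v1 l by (auto simp: p fv)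
    qed
  qed
  have ins: "\<exists>p\<in>prepts ?G L. bdry ?G L a u = rpt ?G L p \<and> f p = u" if u: "u \<in> {0..<1}" for u
  proof -
    consider "u = 0" | "0 < u" "u \<le> L x" | "L x < u" "u < 1" using u by fastforce
    then show ?thesis
    proof cases
      case 1
      then show ?thesis using in0 l H by (intro bexI[of _ "(a, 0)"]) (simp_all add: fv pre)
    next
      case 2
      then show ?thesis using in1[of u] u l H by (intro bexI[of _ "(x, u)"]) (simp_all add: fv pre)
    next
      case 3
      then show ?thesis using in2[of u] u l H by (intro bexI[of _ "(y, u - L x)"]) (simp_all add: fv pre)
    qed
  qed
  have outs: "\<exists>p\<in>prepts ?G L. bdry_bar ?G L t v = rpt ?G L p \<and> f p = frac (L x + v)"
    if v: "v \<in> {0..<1}" for v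
  proof (cases "v = 0")
    case True
    \<comment> \<open>The parameter \<open>frac (1 - v)\<close> is 0 and not 1 at v = 0, so the
      start is read on the first half-edge and not at the end of the cycle.\<close>
    then have "bdry_bar ?G L t v = rpt ?G L (t, 0)" using out0 by (simp add: bdry_bar_def)
    then show ?thesis using True l H by (intro bexI[of _ "(t, 0)"]) (simp_all add: fv pre)
  next
    case False
    then have bb: "bdry_bar ?G L t v = bdry ?G L t (1 - v)" using v by (simp add: bdry_bar_def)
    show ?thesis
    proof (cases "1 - v \<le> L x")
      case True
      moreover have "frac (L x - (1 - v)) = frac (L x + v)" by (intro frac_eqI) simp
      ultimately show ?thesis using out1[of "1 - v"] bb v l H
        by (intro bexI[of _ "(x', 1 - v)"]) (simp_all add: fv pre)
    next
      case False
      moreover have "frac (- (1 - v - L x)) = frac (L x + v)" by (intro frac_eqI) simp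
      ultimately show ?thesis using out2[of "1 - v"] bb v l H
        by (intro bexI[of _ "(y', 1 - v - L x)"]) (simp_all add: fv pre)
    qed
  qed
  show "inj_on (bdry ?G L a) {0..<1}"
    by (rule circle_coordinate(1)[OF inv ins outs pts])
  show "bdry_bar ?G L t v = bdry ?G L a (frac (L x + v))" if "v \<in> {0..<1}"
    by (rule circle_coordinate(2)[OF inv ins outs pts that])
qed

text \<open>The output segment sits at the base point, so the offset is zero; the summand 0 is kept
  to match \<open>circle_coordinate\<close> and \<open>circle_pos\<close>.\<close>

lemma one_arc_circle:
  assumes A: "one_arc D a b x y s t" and L: "L \<in> cell D"
  shows "inj_on (bdry (gam D) L a) {0..<1}"
    and "v \<in> {0..<1} \<Longrightarrow> bdry_bar (gam D) L t v = bdry (gam D) L a (frac (0 + v))"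
proof -
  let ?G = "gam D"
  have H: "hedges ?G = {a, b, x, y, s, t}" and d: "distinct [a, b, x, y, s, t]"
    and o: "opp ?G a = b" "opp ?G b = a" "opp ?G x = y" "opp ?G y = x" "opp ?G s = t" "opp ?G t = s"
    and e: "src ?G x = src ?G b" "src ?G y = src ?G b" "src ?G s = src ?G b"
    using A[unfolded one_arc_def Let_def] by simp_all
  note l = one_arc_lens[OF A L]
  note m = one_arc_marks[OF A]
  define f :: "nat \<times> real \<Rightarrow> real" where
    "f = (\<lambda>(h, r). frac (if h = x then r else if h = y then - r else 0))"
  have fv: "f (a, r) = 0" "f (b, r) = 0" "f (x, r) = frac r" "f (y, r) = frac (- r)"
    "f (s, r) = 0" "f (t, r) = 0" for r
    using d by (auto simp: f_def)
  have inv: "f p = f q" if "pglue ?G L p q" for p q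
    using that
  proof cases
    case (flip h r)
    then have "h \<in> {a, b, x, y, s, t}" using H by (simp add: prepts_def)
    then show ?thesis unfolding flip
      by (elim insertE emptyE) (simp_all add: o fv l frac_eqI)
  next
    case (ends h h')
    then have "h \<in> {a, b, x, y, s, t}" "h' \<in> {a, b, x, y, s, t}" using H by simp_all
    \<comment> \<open>Every half-edge starts at the single point with coordinate zero, whatever the
      vertex.\<close>
    then show ?thesis unfolding ends(1,2) by (elim insertE emptyE; simp add: fv)
  qed
  have in0: "bdry ?G L a 0 = rpt ?G L (a, 0)"
    using bdry_eq[of ?G a "[]" a "[x, b]" L 0 0] m l by simp
  have in1: "bdry ?G L a u = rpt ?G L (x, u)" if "0 < u" "u \<le> 1" for u
    using bdry_eq[of ?G a "[a]" x "[b]" L u u] m l that by simp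
  have out0: "bdry ?G L t 0 = rpt ?G L (t, 0)"
    using bdry_eq[of ?G t "[]" t "[y, s]" L 0 0] m l by simp
  have out1: "bdry ?G L t u = rpt ?G L (y, u)" if "0 < u" "u \<le> 1" for u
    using bdry_eq[of ?G t "[t]" y "[s]" L u u] m l that by simp
  have pre: "(h, r) \<in> prepts ?G L \<longleftrightarrow> h \<in> hedges ?G \<and> 0 \<le> r \<and> r \<le> L h" for h r
    by (simp add: prepts_def)
  have v0: "rpt ?G L (b, 0) = rpt ?G L (a, 0)" "rpt ?G L (x, 0) = rpt ?G L (a, 0)"
    "rpt ?G L (y, 0) = rpt ?G L (a, 0)" "rpt ?G L (s, 0) = rpt ?G L (a, 0)"
    "rpt ?G L (t, 0) = rpt ?G L (a, 0)"
    using rpt_flip[of a 0 ?G L] rpt_ends[of x ?G b L] rpt_ends[of y ?G b L] rpt_ends[of s ?G b L]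
      rpt_flip[of s 0 ?G L] H e o l by (simp_all add: pre)
  have v1: "rpt ?G L (x, 1) = rpt ?G L (a, 0)"
    using rpt_flip[of y 0 ?G L] v0 H o l by (simp add: pre)
  have px: "rpt ?G L (x, r) = bdry ?G L a (f (x, r))" if r: "0 \<le> r" "r \<le> 1" for r
  proof -
    consider "r = 0" | "0 < r" "r < 1" | "r = 1" using r by linarith
    then show ?thesis by cases (use in0 in1[of r] v0 v1 in \<open>simp_all add: fv\<close>)
  qed
  have pts: "rpt ?G L p = bdry ?G L a (f p)" if "p \<in> prepts ?G L" for p
  proof -
    obtain h r where p: "p = (h, r)" by force
    have hr: "h \<in> {a, b, x, y, s, t}" "0 \<le> r" "r \<le> L h" using that H by (auto simp: p prepts_def)
    from hr(1) consider "h = a \<or> h = b \<or> h = s \<or> h = t" | "h = x" | "h = y" by auto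
    then show ?thesis
    proof cases
      case 1
      then have "r = 0" using hr l by auto
      then show ?thesis using 1 in0 v0 by (auto simp: p fv)
    next
      case 2
      then show ?thesis using px hr l by (simp add: p)
    next
      case 3
      have "frac (1 - r) = frac (- r)" by (intro frac_eqI) simp
      then show ?thesis using 3 px[of "1 - r"] rpt_flip[of y r ?G L] hr l o H by (simp add: p pre fv)
    qed
  qed
  have ins: "\<exists>p\<in>prepts ?G L. bdry ?G L a u = rpt ?G L p \<and> f p = u" if "u \<in> {0..<1}" for u
  proof (cases "u = 0")
    case True
    then show ?thesis using in0 l H by (intro bexI[of _ "(a, 0)"]) (simp_all add: fv pre)
  next
    case False
    then show ?thesis using in1[of u] that l H by (intro bexI[of _ "(x, u)"]) (simp_all add: fv pre)
  qed
  have outs: "\<exists>p\<in>prepts ?G L. bdry_bar ?G L t v = rpt ?G L p \<and> f p = frac (0 + v)"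
    if v: "v \<in> {0..<1}" for v
  proof (cases "v = 0")
    case True
    then have "bdry_bar ?G L t v = rpt ?G L (t, 0)" using out0 by (simp add: bdry_bar_def)
    then show ?thesis using True l H by (intro bexI[of _ "(t, 0)"]) (simp_all add: fv pre)
  next
    case False
    then have bb: "bdry_bar ?G L t v = bdry ?G L t (1 - v)" using v by (simp add: bdry_bar_def)
    have "frac (- (1 - v)) = frac (0 + v)" by (intro frac_eqI) simp
    then show ?thesis using out1[of "1 - v"] bb v l H
      by (intro bexI[of _ "(y, 1 - v)"]) (simp_all add: fv pre)
  qed
  show "inj_on (bdry ?G L a) {0..<1}"
    by (rule circle_coordinate(1)[OF inv ins outs pts])
  show "bdry_bar ?G L t v = bdry ?G L a (frac (0 + v))" if "v \<in> {0..<1}"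
    by (rule circle_coordinate(2)[OF inv ins outs pts that])
qed

section \<open>The position of the output vertex and its invariance under gluing\<close>

lemma two_arcs_pos:
  assumes "two_arcs D a b x x' y y' s t"
  shows "circle_pos D L = frac (L x)" "card (hedges (gam D)) = 8"
proof -
  note A = assms[unfolded two_arcs_def Let_def]
  have H: "hedges (gam D) = {a, b, x, x', y, y', s, t}" "distinct [a, b, x, x', y, y', s, t]"
    using A by simp_all
  show "card (hedges (gam D)) = 8" unfolding H(1) by (rule card_distinct_6_8(2)[OF H(2)])
  then show "circle_pos D L = frac (L x)"
    using two_arcs_marks[OF assms] A by (simp add: circle_pos_def bstep_def)
qed

lemma one_arc_pos:
  assumes "one_arc D a b x y s t"
  shows "circle_pos D L = 0" "card (hedges (gam D)) = 6"
proof -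
  note A = assms[unfolded one_arc_def Let_def]
  have H: "hedges (gam D) = {a, b, x, y, s, t}" "distinct [a, b, x, y, s, t]"
    using A by simp_all
  show "card (hedges (gam D)) = 6" unfolding H(1) by (rule card_distinct_6_8(1)[OF H(2)])
  then show "circle_pos D L = 0" by (simp add: circle_pos_def)
qed

lemma sd_point_circle:
  assumes "(D, L) \<in> sd_points 0 1 1"
  shows "inj_on (bdry (gam D) L (in_mark D 0)) {0..<1}"
    and "v \<in> {0..<1} \<Longrightarrow> bdry_bar (gam D) L (out_mark D 0) v
        = bdry (gam D) L (in_mark D 0) (frac (circle_pos D L + v))"
    and "circle_pos D L \<in> {0..<1}"
proof -
  have D: "comb_diagram 0 1 1 D" and L: "L \<in> cell D" using assms by (auto simp: sd_points_def)
  have "inj_on (bdry (gam D) L (in_mark D 0)) {0..<1} \<and>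
    (v \<in> {0..<1} \<longrightarrow> bdry_bar (gam D) L (out_mark D 0) v
        = bdry (gam D) L (in_mark D 0) (frac (circle_pos D L + v)))"
    using diagram_0_1_1_cases[OF D]
  proof (elim disjE exE)
    fix a b x y s t assume A: "one_arc D a b x y s t"
    show ?thesis
      using one_arc_circle(1)[OF A L] one_arc_circle(2)[OF A L, of v] unfolding one_arc_pos[OF A] one_arc_marks[OF A] by blast
  next
    fix a b x x' y y' s t assume A: "two_arcs D a b x x' y y' s t"
    show ?thesis
      using two_arcs_circle(1)[OF A L] two_arcs_circle(2)[OF A L, of v] unfolding two_arcs_pos[OF A] two_arcs_marks[OF A]
      by (simp add: frac_add_simps)
  qed
  then show "inj_on (bdry (gam D) L (in_mark D 0)) {0..<1}"
    and "v \<in> {0..<1} \<Longrightarrow> bdry_bar (gam D) L (out_mark D 0) v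
        = bdry (gam D) L (in_mark D 0) (frac (circle_pos D L + v))" by blast+
  show "circle_pos D L \<in> {0..<1}" by (simp add: circle_pos_def frac_lt_1)
qed

text \<open>The input marking is the only fixed point of \<open>nxt\<close> in the lollipop. In this
  form it is transported by isomorphisms without comparing valences.\<close>

lemma in_mark_fixed:
  assumes D: "comb_diagram 0 1 1 D"
  shows "in_mark D 0 \<in> lolls D ! 0" "nxt (gam D) (in_mark D 0) = in_mark D 0"
    "h \<in> lolls D ! 0 \<Longrightarrow> nxt (gam D) h = h \<Longrightarrow> h = in_mark D 0"
proof -
  have "in_mark D 0 \<in> lolls D ! 0 \<and> nxt (gam D) (in_mark D 0) = in_mark D 0 \<and>
    (h \<in> lolls D ! 0 \<longrightarrow> nxt (gam D) h = h \<longrightarrow> h = in_mark D 0)"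
    using diagram_0_1_1_cases[OF D]
  proof (elim disjE exE)
    fix a b x y s t assume A: "one_arc D a b x y s t"
    then have "lolls D = [{a, b, x, y}]" "distinct [a, b, x, y, s, t]" "nxt (gam D) a = a"
      "nxt (gam D) b = x" "nxt (gam D) x = s" "nxt (gam D) y = b"
      by (simp_all add: one_arc_def Let_def)
    then show ?thesis unfolding one_arc_marks(2)[OF A] by auto
  next
    fix a b x x' y y' s t assume A: "two_arcs D a b x x' y y' s t"
    then have "lolls D = [{a, b, x, x', y, y'}]" "distinct [a, b, x, x', y, y', s, t]" "nxt (gam D) a = a"
      "nxt (gam D) b = x" "nxt (gam D) x = y'" "nxt (gam D) y' = b" "nxt (gam D) x' = y" "nxt (gam D) y = s"
      by (simp_all add: two_arcs_def Let_def)
    then show ?thesis unfolding two_arcs_marks(2)[OF A] by auto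
  qed
  then show "in_mark D 0 \<in> lolls D ! 0" "nxt (gam D) (in_mark D 0) = in_mark D 0"
    "h \<in> lolls D ! 0 \<Longrightarrow> nxt (gam D) h = h \<Longrightarrow> h = in_mark D 0" by blast+
qed

lemma trees_0_1_1: "comb_diagram 0 1 1 D \<Longrightarrow> trees D = []"
  using length_trees_le[of 0 1 1 D] by simp

text \<open>The position depends only on the number of half-edges and on the length of the edge that
  follows the marking, and both are expressed through data preserved by isomorphisms.\<close>

lemma circle_pos_iso:
  assumes D: "comb_diagram 0 1 1 D" and D': "comb_diagram 0 1 1 D'"
    and iso: "diagram_iso \<phi> D D'" and LL: "\<And>h. h \<in> hedges (gam D) \<Longrightarrow> L' (\<phi> h) = L h"
  shows "circle_pos D L = circle_pos D' L'"
proof -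
  let ?G = "gam D" and ?G' = "gam D'" and ?a = "in_mark D 0"
  have i: "bij_betw \<phi> (hedges ?G) (hedges ?G')"
    "\<And>h. h \<in> hedges ?G \<Longrightarrow> opp ?G' (\<phi> h) = \<phi> (opp ?G h)"
    "\<And>h. h \<in> hedges ?G \<Longrightarrow> nxt ?G' (\<phi> h) = \<phi> (nxt ?G h)"
    "lolls D' = map ((`) \<phi>) (lolls D)"
    using iso unfolding diagram_iso_def Let_def by blast+
  have fg: "fatgraph ?G" and len: "length (lolls D) = 1"
    and cl: "\<forall>A\<in>set (lolls D @ segs D @ map fst (trees D)). hclosed ?G A"
    using comb_diagramD[OF D] by blast+
  have "lolls D ! 0 \<in> set (lolls D)" using len by simp
  then have "hclosed ?G (lolls D ! 0)" using cl by simp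
  then have aH: "?a \<in> hedges ?G" using in_mark_fixed(1)[OF D] by (auto simp: hclosed_def)
  then have oH: "opp ?G ?a \<in> hedges ?G" using fg by (simp add: fatgraph_def)
  then have bH: "bstep ?G ?a \<in> hedges ?G" using fg by (auto simp: fatgraph_def bstep_def bij_betw_def)
  have "\<phi> ?a \<in> lolls D' ! 0" using i(4) len in_mark_fixed(1)[OF D] by simp
  moreover have "nxt ?G' (\<phi> ?a) = \<phi> ?a" using i(3)[OF aH] in_mark_fixed(2)[OF D] by simp
  ultimately have "in_mark D' 0 = \<phi> ?a" using in_mark_fixed(3)[OF D'] by metis
  then have "bstep ?G' (in_mark D' 0) = \<phi> (bstep ?G ?a)"
    using i(2)[OF aH] i(3)[OF oH] by (simp add: bstep_def)
  moreover have "card (hedges ?G) = card (hedges ?G')" using i(1) by (rule bij_betw_same_card)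
  ultimately show ?thesis using LL[OF bH] by (simp add: circle_pos_def)
qed

text \<open>Only an arc of length zero can be contracted; then the other arc has length one, and the
  position of the output segment is an integer.\<close>

lemma circle_pos_contraction:
  assumes D: "comb_diagram 0 1 1 D" and L: "L \<in> cell D" and con: "contraction D L D' \<xi>"
  shows "circle_pos D L = circle_pos D' L'"
  using con
proof cases
  case (contract_loll h Q)
  have h: "h \<in> hedges (gam D)" "h \<notin> leaf_hedges (gam D)" "opp (gam D) h \<notin> leaf_hedges (gam D)"
    using contract_loll(3) by (auto simp: internal_edge_def)
  from diagram_0_1_1_cases[OF D] show ?thesis
  proof (elim disjE exE)
    fix a b x y s t assume A: "one_arc D a b x y s t"
    then have "lolls D = [{a, b, x, y}]" "opp (gam D) b = a" by (simp_all add: one_arc_def Let_def)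
    then have "h = x \<or> h = y"
      using contract_loll(5,6) h one_arc_marks(1)[OF A] by auto
    then show ?thesis using one_arc_lens(5,6)[OF A L] contract_loll(4) by auto
  next
    fix a b x x' y y' s t assume A: "two_arcs D a b x x' y y' s t"
    then have o: "lolls D = [{a, b, x, x', y, y'}]" "opp (gam D) b = a" by (simp_all add: two_arcs_def Let_def)
    then have "h = x \<or> h = x' \<or> h = y \<or> h = y'"
      using contract_loll(5,6) h two_arcs_marks(1)[OF A] by auto
    then have "L x = 0 \<or> L y = 0" using two_arcs_lens(5,6)[OF A L] contract_loll(4) by auto
    then have "L x = 0 \<or> L x = 1" using two_arcs_lens(7)[OF A L] by auto
    then have 0: "circle_pos D L = 0" unfolding two_arcs_pos[OF A] by auto
    have fg: "fatgraph (gam D)" using comb_diagramD(1)[OF D] .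
    have "hedges (gam D') = hedges (gam D) - {h, opp (gam D) h}"
      by (simp add: contract_loll(1) contract_diagram_def contract_def Let_def)
    moreover have "opp (gam D) h \<in> hedges (gam D)" "opp (gam D) h \<noteq> h" "finite (hedges (gam D))"
      using fg h(1) by (auto simp: fatgraph_def)
    ultimately have "card (hedges (gam D')) = 6"
      using h(1) two_arcs_pos(2)[OF A] by (simp add: card_Diff_subset)
    then show ?thesis using 0 by (simp add: circle_pos_def)
  qed
\<comment> \<open>The other kinds of contraction take place inside a tree.\<close>
qed (simp_all add: trees_0_1_1[OF D])

text \<open>Explosions and prunings start from a tree, so only isomorphisms and contractions in the
  lollipop remain.\<close>

lemma circle_pos_glue:
  assumes "(D, L) \<in> sd_points 0 1 1" "(D', L') \<in> sd_points 0 1 1" "sd_glue (D, L) (D', L')"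
  shows "circle_pos D L = circle_pos D' L'"
proof -
  have D: "comb_diagram 0 1 1 D" "L \<in> cell D" and D': "comb_diagram 0 1 1 D'"
    using assms by (auto simp: sd_points_def)
  note t = trees_0_1_1[OF D(1)]
  show ?thesis using assms(3)
  proof cases
    case (1 \<phi>)
    then show ?thesis using circle_pos_iso[OF D(1) D', of \<phi> L' L] by blast
  next
    case (2 \<xi>)
    then show ?thesis using circle_pos_contraction[OF D] by blast
  next
    case 3
    then show ?thesis using t by (auto elim: explosion.cases)
  next
    case (4 h)
    then show ?thesis using t by (auto elim: pruning.cases)
  qed
qed

section \<open>Evaluating p and the output loop on points of the moduli space\<close>

lemma sd_class_point:
  assumes "x \<in> sd_points chi k l"
  shows "sd_rep (sd_class chi k l x) \<in> sd_class chi k l x" "sd_class chi k l x \<subseteq> sd_points chi k l"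
proof -
  have "x \<in> sd_class chi k l x" using assms by (simp add: sd_class_def)
  then show "sd_rep (sd_class chi k l x) \<in> sd_class chi k l x" unfolding sd_rep_def by (rule someI)
qed (auto simp: sd_class_def)

lemma topspace_SD: "topspace (SD chi k l) = sd_class chi k l ` sd_points chi k l"
  unfolding SD_def topspace_quotient_space by (rule arg_cong[of _ _ "image _"]) (auto simp: sd_points_def)

text \<open>\<open>sd_rep\<close> may return any member of the class, so the position is followed
  along a zigzag of gluings, each of which can be traversed in either direction.\<close>

lemma circle_pos_rep:
  assumes "(D, L) \<in> sd_points 0 1 1" "sd_rep (sd_class 0 1 1 (D, L)) = (D', L')"
  shows "circle_pos D' L' = circle_pos D L"
proof -
  have "(D', L') \<in> sd_class 0 1 1 (D, L)" using sd_class_point(1)[OF assms(1)] assms(2) by simp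
  then have "equivclp (\<lambda>a b. a \<in> sd_points 0 1 1 \<and> b \<in> sd_points 0 1 1 \<and> sd_glue a b) (D, L) (D', L')"
    by (simp add: sd_class_def)
  then have "(case (D', L') of (D', L') \<Rightarrow> circle_pos D' L') = circle_pos D L"
  proof (induction rule: equivclp_induct)
    case (step y z)
    obtain a b a' b' where "y = (a, b)" "z = (a', b')" by force
    then show ?case using step circle_pos_glue[of a b a' b'] circle_pos_glue[of a' b' a b] by auto
  qed simp
  then show ?thesis by simp
qed

text \<open>At v = 0 the output parametrization starts at the input parameter
  \<open>circle_pos\<close>; injectivity of the input parametrization makes it the only candidate in
  the description of \<open>p_map\<close>.\<close>

lemma p_map_eq:
  assumes c: "c \<in> topspace (SD 0 1 1)" and rep: "sd_rep c = (D, L)"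
  shows "p_map c = circle_pos D L" "(D, L) \<in> sd_points 0 1 1"
proof -
  obtain x where x: "x \<in> sd_points 0 1 1" "c = sd_class 0 1 1 x" using c by (auto simp: topspace_SD)
  then show D: "(D, L) \<in> sd_points 0 1 1" using sd_class_point[OF x(1)] rep by auto
  note S = sd_point_circle[OF D]
  have b: "bdry_bar (gam D) L (out_mark D 0) 0 = bdry (gam D) L (in_mark D 0) (circle_pos D L)"
    using S(2)[of 0] S(3) by simp
  show "p_map c = circle_pos D L" unfolding p_map_def rep prod.case b
    using S(1,3) by (intro the_equality) (auto simp: inj_on_def)
qed

lemma p_map_class:
  assumes "(D, L) \<in> sd_points 0 1 1"
  shows "p_map (sd_class 0 1 1 (D, L)) = circle_pos D L"
proof -
  obtain D' L' where r: "sd_rep (sd_class 0 1 1 (D, L)) = (D', L')" by force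
  have "sd_class 0 1 1 (D, L) \<in> topspace (SD 0 1 1)" using assms by (auto simp: topspace_SD)
  then show ?thesis using p_map_eq(1)[OF _ r] circle_pos_rep[OF assms r] by simp
qed

text \<open>Every point of the output cycle lies on the lollipop and has exactly one input parameter
  in [0,1). There \<open>Theta\<close> is the given loop, so neither straightening nor interpolation
  enters.\<close>

lemma out_heart_eq_rot:
  assumes c: "c \<in> topspace (SD 0 1 1)"
  shows "out_heart M (c, \<gamma>) = (\<lambda>i\<in>{..<1}. rot (p_map c, \<gamma> 0))"
proof -
  obtain D L where rep: "sd_rep c = (D, L)" by force
  note p = p_map_eq[OF c rep]
  note S = sd_point_circle[OF p(2)]
  have len: "length (lolls D) = 1" "length (segs D) = 1"
    using p(2) comb_diagramD(5,6) by (auto simp: sd_points_def)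
  have th: "Theta M D L \<gamma> (bdry_bar (gam D) L (out_mark D 0) t) = \<gamma> 0 (frac (p_map c + t))"
    if t: "t \<in> {0..<1}" for t
  proof -
    let ?u = "frac (circle_pos D L + t)"
    have u: "?u \<in> {0..<1}" by (simp add: frac_lt_1)
    have "on_loll_pts D L (bdry (gam D) L (in_mark D 0) ?u) = {(0, ?u)}"
      unfolding on_loll_pts_def len using u S(1) by (auto simp: inj_on_def)
    then show ?thesis unfolding S(2)[OF t] p(1) Theta_def on_lolls_def by simp
  qed
  show ?thesis
    by (auto simp: out_heart_def rep rho_out_def len rot_def th restrict_def fun_eq_iff)
qed

section \<open>Existence of diagrams in every position\<close>

text \<open>For valence at most three, two steps of \<open>nxt\<close> exhaust a fibre; the orbit
  condition becomes a finite check.\<close>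

lemma fatgraphI:
  assumes "finite (hedges G)" "src G ` hedges G = verts G"
    "\<And>h. h \<in> hedges G \<Longrightarrow> opp G h \<in> hedges G \<and> opp G h \<noteq> h \<and> opp G (opp G h) = h"
    "nxt G ` hedges G = hedges G"
    "\<And>h. h \<in> hedges G \<Longrightarrow> src G (nxt G h) = src G h"
    "\<And>h h'. \<lbrakk>h \<in> hedges G; h' \<in> hedges G; src G h = src G h'\<rbrakk> \<Longrightarrow> h' \<in> {h, nxt G h, nxt G (nxt G h)}"
  shows "fatgraph G"
proof -
  have "inj_on (nxt G) (hedges G)" using assms(1,4) by (simp add: eq_card_imp_inj_on)
  moreover have "src G h = src G h' \<longleftrightarrow> (\<exists>n. (nxt G ^^ n) h = h')" if h: "h \<in> hedges G" "h' \<in> hedges G" for h h'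
  proof
    assume "src G h = src G h'"
    then consider "h' = (nxt G ^^ 0) h" | "h' = (nxt G ^^ 1) h" | "h' = (nxt G ^^ 2) h"
      using assms(6)[OF h] by (auto simp: numeral_2_eq_2)
    then show "\<exists>n. (nxt G ^^ n) h = h'" by cases metis+
  next
    assume "\<exists>n. (nxt G ^^ n) h = h'"
    then obtain n where n: "(nxt G ^^ n) h = h'" by blast
    have "(nxt G ^^ n) h \<in> hedges G \<and> src G ((nxt G ^^ n) h) = src G h"
    proof (induction n)
      case (Suc n)
      then have "nxt G ((nxt G ^^ n) h) \<in> hedges G" using assms(4) by blast
      then show ?case using Suc assms(5) by simp
    qed (use h in simp)
    then show "src G h = src G h'" using n by simp
  qed
  moreover have "finite (verts G)" using assms(1,2) by (metis finite_imageI)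
  ultimately show ?thesis using assms by (simp add: fatgraph_def bij_betw_def)
qed

text \<open>The half-edges 0 to 7 are a, b, x, x', y, y', s, t of \<open>two_arcs\<close>; the
  vertices 0 to 3 are the input leaf, the base point, the attaching point and the output
  leaf.\<close>

definition two_arc_graph :: "nat fgraph" where
  "two_arc_graph = \<lparr>verts = {0, 1, 2, 3}, hedges = {0, 1, 2, 3, 4, 5, 6, 7},
     src = (\<lambda>h. [0, 1, 1, 2, 2, 1, 2, 3] ! h), opp = (\<lambda>h. [1, 0, 3, 2, 5, 4, 7, 6] ! h),
     nxt = (\<lambda>h. [0, 2, 5, 4, 6, 1, 3, 7] ! h)\<rparr>"

definition two_arc_diagram :: diagram where
  "two_arc_diagram = \<lparr>gam = two_arc_graph, lolls = [{0, 1, 2, 3, 4, 5}], segs = [{6, 7}],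
     trees = [], lvs = []\<rparr>"

definition two_arc_lens :: "real \<Rightarrow> lens" where
  "two_arc_lens u = (\<lambda>h. if h \<in> {2, 3} then u else if h \<in> {4, 5} then 1 - u else 0)"

definition two_arc_lollipop :: "nat fgraph" where
  "two_arc_lollipop = subgraph two_arc_graph {0, 1, 2, 3, 4, 5}"

lemma two_arc_diagram_form: "two_arcs two_arc_diagram 0 1 2 3 4 5 6 7"
  by (simp add: two_arcs_def two_arc_diagram_def two_arc_graph_def)

lemma two_arc_graph_simps:
  "verts two_arc_graph = {0, 1, 2, 3}" "hedges two_arc_graph = {0, 1, 2, 3, 4, 5, 6, 7}"
  "src two_arc_graph 0 = 0" "src two_arc_graph (Suc 0) = 1" "src two_arc_graph 2 = 1" "src two_arc_graph 3 = 2"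
  "src two_arc_graph 4 = 2" "src two_arc_graph 5 = 1" "src two_arc_graph 6 = 2" "src two_arc_graph 7 = 3"
  "opp two_arc_graph 0 = 1" "opp two_arc_graph (Suc 0) = 0" "opp two_arc_graph 2 = 3" "opp two_arc_graph 3 = 2"
  "opp two_arc_graph 4 = 5" "opp two_arc_graph 5 = 4" "opp two_arc_graph 6 = 7" "opp two_arc_graph 7 = 6"
  "nxt two_arc_graph 0 = 0" "nxt two_arc_graph (Suc 0) = 2" "nxt two_arc_graph 2 = 5" "nxt two_arc_graph 3 = 4"
  "nxt two_arc_graph 4 = 6" "nxt two_arc_graph 5 = 1" "nxt two_arc_graph 6 = 3" "nxt two_arc_graph 7 = 7"
  by (simp_all add: two_arc_graph_def)

lemma fatgraph_two_arc_graph: "fatgraph two_arc_graph"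
  by (rule fatgraphI) (auto simp: two_arc_graph_simps)

lemma subgraph_nxt:
  assumes "nxt G h \<in> A"
  shows "nxt (subgraph G A) h = nxt G h"
proof -
  have "(LEAST n. n > 0 \<and> (nxt G ^^ n) h \<in> A) = 1"
    by (rule Least_equality) (use assms in auto)
  then show ?thesis by (simp add: subgraph_def)
qed

lemma subgraph_nxt2:
  assumes "nxt G h \<notin> A" "nxt G (nxt G h) \<in> A"
  shows "nxt (subgraph G A) h = nxt G (nxt G h)"
proof -
  have "(LEAST n. n > 0 \<and> (nxt G ^^ n) h \<in> A) = 2"
  proof (rule Least_equality)
    fix n assume "n > 0 \<and> (nxt G ^^ n) h \<in> A"
    moreover from this have "n \<noteq> 1" using assms(1) by auto
    ultimately show "2 \<le> n" by auto
  qed (use assms in \<open>simp add: numeral_2_eq_2\<close>)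
  then show ?thesis by (simp add: subgraph_def numeral_2_eq_2)
qed

lemma two_arc_lollipop_simps:
  "hedges two_arc_lollipop = {0, 1, 2, 3, 4, 5}" "src two_arc_lollipop = src two_arc_graph"
  "opp two_arc_lollipop = opp two_arc_graph" "verts two_arc_lollipop = {0, 1, 2}"
  "nxt two_arc_lollipop 0 = 0" "nxt two_arc_lollipop (Suc 0) = 2" "nxt two_arc_lollipop 2 = 5"
  "nxt two_arc_lollipop 3 = 4" "nxt two_arc_lollipop 4 = 3" "nxt two_arc_lollipop 5 = 1"
proof -
  show "nxt two_arc_lollipop 0 = 0" "nxt two_arc_lollipop (Suc 0) = 2" "nxt two_arc_lollipop 2 = 5"
    "nxt two_arc_lollipop 3 = 4" "nxt two_arc_lollipop 5 = 1"
    unfolding two_arc_lollipop_def by (subst subgraph_nxt; simp add: two_arc_graph_simps)+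
  \<comment> \<open>The output half-edge 6 lies between 4 and 3 in the cyclic order and is skipped
    in the lollipop.\<close>
  show "nxt two_arc_lollipop 4 = 3"
    unfolding two_arc_lollipop_def by (subst subgraph_nxt2; simp add: two_arc_graph_simps)
qed (auto simp: two_arc_lollipop_def subgraph_def two_arc_graph_simps)

lemma connI:
  assumes "r \<in> verts G" "\<And>v. v \<in> verts G \<Longrightarrow> (v, r) \<in> (adj G)\<^sup>* \<and> (r, v) \<in> (adj G)\<^sup>*"
  shows "conn G"
  using assms unfolding conn_def by (metis empty_iff rtrancl_trans)

lemma adjI: "h \<in> hedges G \<Longrightarrow> (src G h, src G (opp G h)) \<in> adj G"
  by (auto simp: adj_def)

lemma conn_two_arc_graph: "conn two_arc_graph"
proof (rule connI[of 1])
  have "(0, 1) \<in> adj two_arc_graph" "(1, 0) \<in> adj two_arc_graph" "(1, 2) \<in> adj two_arc_graph"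
    "(2, 1) \<in> adj two_arc_graph" "(2, 3) \<in> adj two_arc_graph" "(3, 2) \<in> adj two_arc_graph"
    using adjI[of 0 two_arc_graph] adjI[of 1 two_arc_graph] adjI[of 2 two_arc_graph] adjI[of 3 two_arc_graph]
      adjI[of 6 two_arc_graph] adjI[of 7 two_arc_graph] by (simp_all add: two_arc_graph_simps)
  moreover fix v assume "v \<in> verts two_arc_graph"
  then have "v = 0 \<or> v = 1 \<or> v = 2 \<or> v = 3" by (auto simp: two_arc_graph_simps)
  ultimately show "(v, 1) \<in> (adj two_arc_graph)\<^sup>* \<and> (1, v) \<in> (adj two_arc_graph)\<^sup>*"
    by (meson rtrancl.simps)
qed (simp add: two_arc_graph_simps)

lemma fat_lollipop_two_arc: "fat_lollipop two_arc_lollipop"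
proof -
  have val: "valence two_arc_lollipop 0 = 1" "valence two_arc_lollipop (Suc 0) = 3"
    "valence two_arc_lollipop 2 = 2"
    unfolding valence_def two_arc_lollipop_simps filter_insert by (simp_all add: two_arc_graph_simps)
  have "fatgraph two_arc_lollipop"
    by (rule fatgraphI) (auto simp: two_arc_lollipop_simps two_arc_graph_simps)
  moreover have "conn two_arc_lollipop"
  proof (rule connI[of 1])
    have "(0, 1) \<in> adj two_arc_lollipop" "(1, 0) \<in> adj two_arc_lollipop" "(1, 2) \<in> adj two_arc_lollipop"
      "(2, 1) \<in> adj two_arc_lollipop"
      using adjI[of 0 two_arc_lollipop] adjI[of 1 two_arc_lollipop] adjI[of 2 two_arc_lollipop]
        adjI[of 3 two_arc_lollipop] by (simp_all add: two_arc_lollipop_simps two_arc_graph_simps)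
    moreover fix v assume "v \<in> verts two_arc_lollipop"
    then have "v = 0 \<or> v = 1 \<or> v = 2" by (auto simp: two_arc_lollipop_simps)
    ultimately show "(v, 1) \<in> (adj two_arc_lollipop)\<^sup>* \<and> (1, v) \<in> (adj two_arc_lollipop)\<^sup>*"
      by (meson rtrancl.simps)
  qed (simp add: two_arc_lollipop_simps)
  moreover have "0 \<in> hedges two_arc_lollipop" by (simp add: two_arc_lollipop_simps)
  ultimately show ?thesis unfolding fat_lollipop_def
    by (intro conjI bexI[of _ 0]) (auto simp: two_arc_lollipop_simps two_arc_graph_simps val)
qed

lemma two_arc_lollipop_boundary:
  assumes "a \<in> leaf_hedges two_arc_lollipop" "h \<in> set (bcycle two_arc_lollipop a)"
  shows "bstep two_arc_graph h = bstep two_arc_lollipop h"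
proof -
  have val: "valence two_arc_lollipop 0 = 1" "valence two_arc_lollipop (Suc 0) = 3"
    "valence two_arc_lollipop 2 = 2"
    unfolding valence_def two_arc_lollipop_simps filter_insert by (simp_all add: two_arc_graph_simps)
  then have a: "a = 0" using assms(1)
    by (auto simp: leaf_hedges_def two_arc_lollipop_simps two_arc_graph_simps)
  have "bcycle two_arc_lollipop (hd [0, 2, 4, 1]) = [0, 2, 4, 1]"
  proof (rule bcycle_eqI)
    fix i assume "i < length [0, 2, 4, 1 :: nat]"
    then have "i = 0 \<or> i = 1 \<or> i = 2 \<or> i = 3" by auto
    then show "bstep two_arc_lollipop ([0, 2, 4, 1] ! i) = [0, 2, 4, 1] ! (Suc i mod length [0, 2, 4, 1 :: nat])"
      by (auto simp: bstep_def two_arc_lollipop_simps two_arc_graph_simps)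
  qed auto
  then have "h \<in> {0, 2, 4, 1}" using assms(2) a by simp
  then show ?thesis by (auto simp: bstep_def two_arc_lollipop_simps two_arc_graph_simps)
qed

lemma is_segment_two_arc: "is_segment (subgraph two_arc_graph {6, 7})"
proof -
  let ?S = "subgraph two_arc_graph {6, 7}"
  have S: "hedges ?S = {6, 7}" "src ?S = src two_arc_graph" "opp ?S = opp two_arc_graph" "verts ?S = {2, 3}"
    by (auto simp: subgraph_def two_arc_graph_simps)
  have "conn ?S"
  proof (rule connI[of 2])
    have "(2, 3) \<in> adj ?S" "(3, 2) \<in> adj ?S"
      using adjI[of 6 ?S] adjI[of 7 ?S] by (simp_all add: S two_arc_graph_simps)
    moreover fix v assume "v \<in> verts ?S"
    then have "v = 2 \<or> v = 3" by (auto simp: S)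
    ultimately show "(v, 2) \<in> (adj ?S)\<^sup>* \<and> (2, v) \<in> (adj ?S)\<^sup>*" by (meson rtrancl.simps)
  qed (simp add: S)
  \<comment> \<open>A nonempty subset closed under \<open>opp\<close> contains both half-edges, and
    then its vertices are univalent, not bivalent.\<close>
  moreover have False if A: "hclosed ?S A" "cycle_graph (subgraph ?S A)" for A
  proof -
    have sub: "A \<subseteq> {6, 7}" "opp two_arc_graph ` A \<subseteq> A" using A(1) by (auto simp: hclosed_def S)
    have "A \<noteq> {}" using A(2) by (auto simp: cycle_graph_def conn_def subgraph_def)
    then have "6 \<in> A \<or> 7 \<in> A" using sub(1) by auto
    then have A67: "A = {6, 7}" using sub by (auto simp: two_arc_graph_simps)
    have "valence (subgraph ?S A) 2 = 1"
      unfolding valence_def subgraph_def A67 fgraph.simps filter_insert by (simp add: two_arc_graph_simps)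
    moreover have "2 \<in> verts (subgraph ?S A)" by (simp add: A67 subgraph_def two_arc_graph_simps)
    ultimately show False using A(2) by (auto simp: cycle_graph_def)
  qed
  ultimately show ?thesis by (auto simp: is_segment_def is_tree_def S)
qed

text \<open>B serves as the set of half-edges of a boundary cycle: an invariant set meeting the
  leaves once leaves room for only one marking.\<close>

lemma ex1_orbit:
  assumes "\<And>n. (f ^^ n) h \<in> B" "A \<inter> B = {c}" "\<exists>n. c = (f ^^ n) h"
  shows "\<exists>!a. a \<in> A \<and> (\<exists>n. a = (f ^^ n) h)"
proof (rule ex1I)
  show "c \<in> A \<and> (\<exists>n. c = (f ^^ n) h)" using assms(2,3) by auto
  fix a assume "a \<in> A \<and> (\<exists>n. a = (f ^^ n) h)"
  then have "a \<in> A \<inter> B" using assms(1) by auto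
  then show "a = c" using assms(2) by simp
qed

text \<open>The two boundary cycles are {0, 1, 2, 4} with marking 0 and {3, 5, 6, 7} with marking 7;
  four vertices and four edges give Euler characteristic zero.\<close>

lemma comb_two_arc_diagram: "comb_diagram 0 1 1 two_arc_diagram"
proof -
  let ?G = two_arc_graph
  have D: "gam two_arc_diagram = ?G" "lolls two_arc_diagram = [{0, 1, 2, 3, 4, 5}]"
    "segs two_arc_diagram = [{6, 7}]" "trees two_arc_diagram = []" "lvs two_arc_diagram = []"
    by (simp_all add: two_arc_diagram_def)
  have lf: "leaf_hedges ?G = {0, 7}"
    using two_arcs_marks(1)[OF two_arc_diagram_form] by (simp add: D)
  have val: "valence ?G 0 = 1" "valence ?G (Suc 0) = 3" "valence ?G 2 = 3" "valence ?G 3 = 1"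
    unfolding valence_def two_arc_graph_simps filter_insert by (simp_all add: two_arc_graph_simps)
  have orb: "(bstep ?G ^^ n) h \<in> A" if "h \<in> A" "bstep ?G ` A \<subseteq> A" for n h A
    using that by (induction n) auto
  have pow: "(f ^^ 2) h = f (f h)" "(f ^^ 3) h = f (f (f h))" for f :: "nat \<Rightarrow> nat" and h
    by (simp_all add: numeral_2_eq_2 numeral_3_eq_3)
  have bs: "bstep ?G 0 = 2" "bstep ?G 2 = 4" "bstep ?G 4 = 1" "bstep ?G (Suc 0) = 0"
    "bstep ?G 7 = 3" "bstep ?G 3 = 5" "bstep ?G 5 = 6" "bstep ?G 6 = 7"
    by (simp_all add: bstep_def two_arc_graph_simps)
  have "marked ?G"
    unfolding marked_def
  proof
    fix h assume "h \<in> hedges ?G"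
    then consider "h \<in> {0, 1, 2, 4}" | "h \<in> {3, 5, 6, 7}" by (auto simp: two_arc_graph_simps)
    then show "\<exists>!a. a \<in> leaf_hedges ?G \<and> (\<exists>n. a = (bstep ?G ^^ n) h)"
    proof cases
      case 1
      have "(bstep ?G ^^ n) h \<in> {0, 1, 2, 4}" for n by (rule orb[OF 1]) (auto simp: bs)
      moreover have "leaf_hedges ?G \<inter> {0, 1, 2, 4} = {0}" unfolding lf by auto
      moreover have "\<exists>n\<in>{0, 1, 2, 3}. 0 = (bstep ?G ^^ n) h"
        using 1 by (auto simp: bs pow)
      ultimately show ?thesis by (intro ex1_orbit[where B = "{0, 1, 2, 4}"]) (blast+)
    next
      case 2
      have "(bstep ?G ^^ n) h \<in> {3, 5, 6, 7}" for n by (rule orb[OF 2]) (auto simp: bs)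
      moreover have "leaf_hedges ?G \<inter> {3, 5, 6, 7} = {7}" unfolding lf by auto
      moreover have "\<exists>n\<in>{0, 1, 2, 3}. 7 = (bstep ?G ^^ n) h"
        using 2 by (auto simp: bs pow)
      ultimately show ?thesis by (intro ex1_orbit[where B = "{3, 5, 6, 7}"]) (blast+)
    qed
  qed
  moreover have "\<forall>v\<in>verts ?G. valence ?G v \<noteq> 2" "euler_char ?G = 0"
    by (simp_all add: val two_arc_graph_simps euler_char_def)
  moreover have "\<forall>A\<in>set ([{0, 1, 2, 3, 4, 5}] @ [{6, 7}] @ []). hclosed ?G A"
    by (simp add: hclosed_def two_arc_graph_simps)
  moreover have "\<Union>(set ([{0, 1, 2, 3, 4, 5}] @ [{6, 7}] @ [])) = hedges ?G"
    by (auto simp: two_arc_graph_simps)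
  moreover have "card ({6, 7} \<inter> leaf_hedges ?G) = 1" by (simp add: lf)
  moreover have "\<forall>i<length ([{0, 1, 2, 3, 4, 5}] @ [{6, 7}] @ []). \<forall>j<i.
      ([{0, 1, 2, 3, 4, 5}] @ [{6, 7}] @ []) ! i \<inter> ([{0, 1, 2, 3, 4, 5}] @ [{6, 7 :: nat}] @ []) ! j = {}"
    by (auto simp: less_Suc_eq)
  moreover have "\<forall>v\<in>verts ?G. valence ?G v \<noteq> 1 \<longrightarrow> (\<exists>!i. i < 1 \<and> v \<in> src ?G ` ([{0, 1, 2, 3, 4, 5}] ! i))"
    by (auto simp: val two_arc_graph_simps)
  moreover note fatgraph_two_arc_graph conn_two_arc_graph is_segment_two_arc
    fat_lollipop_two_arc[unfolded two_arc_lollipop_def] two_arc_lollipop_boundary[unfolded two_arc_lollipop_def]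
  moreover have "acyclic ({} :: (nat \<times> nat) set)" by (simp add: acyclic_def)
  ultimately show ?thesis
    unfolding comb_diagram_def Let_def D by simp
qed

lemma two_arc_lens_cell:
  assumes "0 \<le> u" "u \<le> 1"
  shows "two_arc_lens u \<in> cell two_arc_diagram"
proof -
  have D: "gam two_arc_diagram = two_arc_graph" "lolls two_arc_diagram = [{0, 1, 2, 3, 4, 5}]"
    "trees two_arc_diagram = []"
    by (simp_all add: two_arc_diagram_def)
  have "leaf_hedges two_arc_graph = {0, 7}"
    using two_arcs_marks(1)[OF two_arc_diagram_form] by (simp add: D)
  then show ?thesis using assms unfolding cell_def is_string_diagram_def pseudometric_def D
    by (auto simp: two_arc_graph_simps two_arc_lens_def tot_len_def)
qed

section \<open>Excision and the diffuse class in degree zero\<close>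

lemma singular_simplex_0I:
  assumes "p \<in> topspace X"
  shows "singular_simplex 0 X (\<lambda>x\<in>standard_simplex 0. p)"
  using assms by (simp add: singular_simplex_def)

lemma singular_simplex_0_iff:
  "singular_simplex 0 X \<sigma> \<longleftrightarrow> (\<exists>p\<in>topspace X. \<sigma> = (\<lambda>x\<in>standard_simplex 0. p))"
proof
  assume s: "singular_simplex 0 X \<sigma>"
  let ?e = "\<lambda>j::nat. if j = 0 then 1 else 0 :: real"
  have "\<sigma> = (\<lambda>x\<in>standard_simplex 0. \<sigma> ?e)"
  proof
    fix x show "\<sigma> x = (\<lambda>x\<in>standard_simplex 0. \<sigma> ?e) x"
    proof (cases "x \<in> standard_simplex 0")
      case True
      then have "x = ?e" unfolding standard_simplex_0 by blast
      then show ?thesis using True by simp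
    next
      case False
      then show ?thesis using s by (simp add: singular_simplex_def extensional_def)
    qed
  qed
  moreover have "\<sigma> ?e \<in> topspace X"
    using s by (auto simp: singular_simplex_def standard_simplex_0 continuous_map_def)
  ultimately show "\<exists>p\<in>topspace X. \<sigma> = (\<lambda>x\<in>standard_simplex 0. p)" by blast
qed (auto simp: singular_simplex_0I)

lemma gmap_point: "gmap f (0, \<lambda>x\<in>standard_simplex 0. p) = (0, \<lambda>x\<in>standard_simplex 0. f p)"
  by (auto simp: gmap_def simplex_map_def fun_eq_iff)

lemma gchains_deg_empty: "c \<in> gchains_deg n (subtopology X {}) \<longleftrightarrow> c = 0"
proof -
  have e: "singular_simplex_set n (subtopology X {}) = {}"
    using nonempty_standard_simplex[of n] by (force simp: singular_simplex_def continuous_map_def Pi_iff)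
  show ?thesis unfolding gchains_deg_def e by simp
qed

lemma gbd_one_point:
  assumes "topspace X = {p}" "singular_simplex 1 X \<sigma>"
  shows "gbd (1, \<sigma>) = 0"
proof -
  have face: "singular_face 1 k \<sigma> = (\<lambda>x\<in>standard_simplex 0. p)" if "k \<le> 1" for k
  proof -
    have "singular_simplex 0 X (singular_face 1 k \<sigma>)"
      using singular_simplex_singular_face[OF assms(2)] that by simp
    then show ?thesis using assms(1) by (auto simp: singular_simplex_0_iff)
  qed
  have "chain_boundary 1 (frag_of \<sigma>) = 0"
    using face[of 0] face[of 1] by (simp add: chain_boundary_of)
  then show ?thesis by (simp add: gbd_def tag_def)
qed

lemma rlin_zero: "(\<And>s. s \<in> Poly_Mapping.keys c \<Longrightarrow> f s = 0) \<Longrightarrow> rlin f c = 0"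
  by (rule poly_mapping_eqI) (simp add: lookup_rlin[OF finite_keys order_refl])

text \<open>The two faces of a 1-simplex in a point coincide and cancel, and the empty space carries
  no chains. The homology classes defining the local Thom class thus become equalities of
  chains.\<close>

lemma homol_0_one_point:
  assumes X: "topspace X = {p}" and h: "homol 0 X {} c c'"
  shows "c = c'"
proof -
  obtain b where b: "b \<in> gchains_deg (Suc 0) X" "c - c' - rlin gbd b \<in> gchains_deg 0 (subtopology X {})"
    using h unfolding homol_def by blast
  have "rlin gbd b = 0"
    by (rule rlin_zero) (use b(1) gbd_one_point[OF X] in \<open>auto simp: gchains_deg_def\<close>)
  moreover have "c - c' - rlin gbd b = 0" using b(2) unfolding gchains_deg_empty .
  ultimately show ?thesis by simp
qed

text \<open>In degree zero the front face is the first vertex and the back face is the whole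
  simplex. Extensionality makes the restriction in \<open>seg 0 n\<close> return the simplex
  itself.\<close>

lemma capp_0:
  assumes "\<And>n \<sigma>. (n, \<sigma>) \<in> Poly_Mapping.keys c \<Longrightarrow> \<sigma> \<in> extensional (standard_simplex n) \<and> u (0, seg 0 0 \<sigma>) = 1"
  shows "capp 0 u c = c"
proof -
  have "capp 0 u c = (\<Sum>s\<in>Poly_Mapping.keys c. Poly_Mapping.single s (Poly_Mapping.lookup c s))"
    unfolding capp_def
  proof (rule sum.cong[OF refl])
    fix s assume s: "s \<in> Poly_Mapping.keys c"
    obtain n \<sigma> where e: "s = (n, \<sigma>)" by force
    note a = assms[OF s[unfolded e]]
    have "seg 0 n \<sigma> = \<sigma>" using a by (auto simp: seg_def fun_eq_iff extensional_def)
    then show "(case s of (n, \<sigma>) \<Rightarrow> if 0 \<le> n then Poly_Mapping.single (n - 0, seg 0 n \<sigma>)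
        (Poly_Mapping.lookup c s * u (0, seg 0 0 \<sigma>)) else 0) = Poly_Mapping.single s (Poly_Mapping.lookup c s)"
      using a by (simp add: e)
  qed
  also have "\<dots> = rlin frag_of c" by (simp add: rlin_frag_of)
  finally show ?thesis by (simp add: rlin_id)
qed

section \<open>Excision on simplices that are already small\<close>

lemma keys_gbd:
  assumes "t \<in> Poly_Mapping.keys (gbd (n, \<sigma>))"
  obtains k where "n > 0" "k \<le> n" "t = (n - 1, singular_face n k \<sigma>)"
proof -
  have "n > 0"
  proof (rule ccontr)
    assume "\<not> n > 0"
    then have "gbd (n, \<sigma>) = 0" by (simp add: gbd_def tag_def chain_boundary_def)
    then show False using assms by simp
  qed
  have "gbd (n, \<sigma>) = (\<Sum>k\<le>n. frag_cmul ((-1) ^ k) (frag_of (n - 1, singular_face n k \<sigma>)))"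
    using \<open>n > 0\<close> by (simp add: gbd_def tag_def chain_boundary_of frag_extend_sum frag_extend_cmul o_def)
  then obtain k where "k \<le> n" "t \<in> Poly_Mapping.keys (frag_cmul ((-1) ^ k) (frag_of (n - 1, singular_face n k \<sigma>)))"
    using assms keys_sum[of "\<lambda>k. frag_cmul ((-1) ^ k) (frag_of (n - 1, singular_face n k \<sigma>))" "{..n}"] by auto
  then have "t = (n - 1, singular_face n k \<sigma>)" by (auto split: if_splits)
  then show thesis using that \<open>n > 0\<close> \<open>k \<le> n\<close> by blast
qed

lemma exc_D_in_set: "in_set S s \<Longrightarrow> exc_D S B s = 0"
proof -
  assume "in_set S s"
  then have "subdiv_num S B s = 0" unfolding subdiv_num_def by (intro Least_eq_0) simp
  then show ?thesis by (simp add: exc_D_def)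
qed

text \<open>Such a simplex needs no subdivision, and neither do its faces, so the homotopy D
  vanishes both on it and on its boundary.\<close>

lemma exc_inverse_in_set:
  assumes "in_set S s"
  shows "exc_inverse S B s = frag_of s"
proof -
  obtain n \<sigma> where s: "s = (n, \<sigma>)" by force
  have "exc_D S B t = 0" if t: "t \<in> Poly_Mapping.keys (gbd s)" for t
  proof -
    obtain k where k: "n > 0" "k \<le> n" "t = (n - 1, singular_face n k \<sigma>)"
      using t unfolding s by (rule keys_gbd)
    have "singular_face n k \<sigma> x \<in> S" if "x \<in> standard_simplex (n - 1)" for x
      using assms that k simplical_face_in_standard_simplex[of n k x]
      by (auto simp: s in_set_def singular_face_def)
    then have "in_set S t" by (auto simp: k(3) in_set_def)
    then show ?thesis by (rule exc_D_in_set)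
  qed
  then have "frag_extend (exc_D S B) (gbd s) = 0" by (simp add: frag_extend_def)
  then have "exc_rho S B s = frag_of s" by (simp add: exc_rho_def exc_D_in_set[OF assms])
  then show ?thesis using assms by (simp add: exc_inverse_def)
qed

text \<open>A single tensor factor leaves only the sequence of cuts \<open>[0, n]\<close>, hence no
  proper faces.\<close>

lemma aw_1: "aw 1 (n, \<tau>) = frag_of [(n, seg 0 n (\<lambda>x. \<tau> x 0))]"
proof -
  have "{cs. length cs = Suc 1 \<and> sorted cs \<and> cs ! 0 = 0 \<and> cs ! 1 = n} = {[0, n]}"
    by (auto simp: length_Suc_conv)
  then show ?thesis by (simp add: aw_def)
qed

lemma count_list_take_le: "count_list (take j c) i \<le> count_list c i"
  by (metis append_take_drop_id count_list_append le_add1)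

text \<open>The vertices of the lattice path are grouped by their i-th coordinate. The groups
  partition all vertices, so summing barycentric coordinates within each group preserves the total
  and the signs.\<close>

lemma degen_standard_simplex:
  assumes x: "x \<in> standard_simplex (length c)"
  shows "degen c i x \<in> standard_simplex (count_list c i)"
proof -
  let ?n = "length c" and ?k = "count_list c i"
  let ?J = "\<lambda>m. {j. j \<le> ?n \<and> count_list (take j c) i = m}"
  have x0: "\<And>j. 0 \<le> x j" and sx: "sum x {..?n} = 1" using x by (auto simp: standard_simplex_def)
  have un: "(\<Union>m\<le>?k. ?J m) = {..?n}" using count_list_take_le by auto
  have "sum x (\<Union>m\<le>?k. ?J m) = (\<Sum>m\<le>?k. sum x (?J m))" by (rule sum.UNION_disjoint) auto
  then have s: "(\<Sum>m\<le>?k. degen c i x m) = 1" using un sx by (simp add: degen_def)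
  have nn: "0 \<le> degen c i x m" for m using x0 by (simp add: degen_def sum_nonneg)
  have "degen c i x m \<le> 1" for m
  proof -
    have "sum x (?J m) \<le> sum x {..?n}" by (rule sum_mono2) (use x0 in auto)
    then show ?thesis using sx by (simp add: degen_def)
  qed
  moreover have "degen c i x m = 0" if "m > ?k" for m
  proof -
    have J: "?J m = {}" using that count_list_take_le[of _ c i] by (auto simp: not_less[symmetric])
    show ?thesis unfolding degen_def J by (rule sum.empty)
  qed
  ultimately show ?thesis using s nn by (simp add: standard_simplex_def)
qed

text \<open>The witness has a first arc of length u, which may be zero. Surjectivity makes
  \<open>inv_into\<close> a right inverse of \<open>p_map\<close> on [0,1).\<close>

lemma p_map_surj:
  assumes "u \<in> {0..<1}"
  shows "u \<in> p_map ` topspace (SD 0 1 1)"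
proof -
  have D: "(two_arc_diagram, two_arc_lens u) \<in> sd_points 0 1 1"
    using comb_two_arc_diagram two_arc_lens_cell[of u] assms by (simp add: sd_points_def)
  have "p_map (sd_class 0 1 1 (two_arc_diagram, two_arc_lens u)) = frac (two_arc_lens u 2)"
    unfolding p_map_class[OF D] by (rule two_arcs_pos(1)[OF two_arc_diagram_form])
  also have "\<dots> = u" using assms by (simp add: two_arc_lens_def)
  finally show ?thesis using D unfolding topspace_SD by force
qed

section \<open>The Lipschitz conditions and the stratified pair in the absence of trees\<close>

lemma lvs_0_1_1: "comb_diagram 0 1 1 D \<Longrightarrow> lvs D = []"
  using comb_diagramD(14)[of 0 1 1 D] trees_0_1_1[of D] by simp

text \<open>The intersection graph has no half-edges, so the condition is vacuous for every bound,
  including the quotient by |\<chi>| = 0.\<close>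

lemma bigS_0_1_1: "bigS M 0 1 1 = topspace (SDLM M 0 1 1)"
proof -
  have "lipschitz_wrt M \<epsilon> D L \<gamma>" if "(c, \<gamma>) \<in> topspace (SDLM M 0 1 1)" "sd_rep c = (D, L)" for c D L \<gamma> \<epsilon>
  proof -
    have "c \<in> topspace (SD 0 1 1)" using that(1) by (simp add: SDLM_def)
    then have "comb_diagram 0 1 1 D" using p_map_eq(2)[OF _ that(2)] by (simp add: sd_points_def)
    then have "hedges (inter_graph D) = {}"
      using trees_0_1_1 by (simp add: inter_graph_def explode_def subgraph_def)
    then show ?thesis by (simp add: lipschitz_wrt_def leaf_hedges_def)
  qed
  then have "x \<in> bigS M 0 1 1 \<longleftrightarrow> x \<in> topspace (SDLM M 0 1 1)" for x
    by (cases x; cases "sd_rep (fst x)") (auto simp: bigS_def)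
  then show ?thesis by blast
qed

text \<open>An empty power of the manifold is one point, which extensional functions on the empty
  set encode as the constant \<open>undefined\<close>. As \<open>smallN\<close> is all of
  \<open>bigN\<close>, the relative subspaces become empty.\<close>

lemma Ntop_0_1_1:
  assumes "comb_diagram 0 1 1 D"
  shows "bigN M D = {\<lambda>_. undefined}" "smallN M chi D = {\<lambda>_. undefined}"
    "topspace (Ntop M D) = {\<lambda>_. undefined}" "topspace (Mpow M (set (lvs D))) = {\<lambda>_. undefined}"
proof -
  note t = trees_0_1_1[OF assms] lvs_0_1_1[OF assms]
  show N: "bigN M D = {\<lambda>_. undefined}" by (simp add: bigN_def t)
  then show "smallN M chi D = {\<lambda>_. undefined}" by (simp add: smallN_def t)
  show T: "topspace (Mpow M (set (lvs D))) = {\<lambda>_. undefined}"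
    by (simp add: Mpow_def t topspace_product_topology)
  then show "topspace (Ntop M D) = {\<lambda>_. undefined}" by (simp add: Ntop_def N)
qed

lemma seg_0_0:
  "seg 0 0 \<sigma> = (\<lambda>x\<in>standard_simplex 0. \<sigma> (\<lambda>j. if j = 0 then 1 else 0))"
proof
  fix x show "seg 0 0 \<sigma> x = (\<lambda>x\<in>standard_simplex 0. \<sigma> (\<lambda>j. if j = 0 then 1 else 0)) x"
  proof (cases "x \<in> standard_simplex 0")
    case True
    then have "x = (\<lambda>j. if j = 0 then 1 else 0)" unfolding standard_simplex_0 by blast
    then show ?thesis using True by (simp add: seg_def)
  qed (simp add: seg_def)
qed

text \<open>The empty word is the only shuffle of no factors, and the empty cross product is the
  point as a 0-simplex.\<close>

lemma ez_idx_empty: "ez_idx [] [] = frag_of (0, \<lambda>x\<in>standard_simplex 0. \<lambda>_. undefined)"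
proof -
  have "shuffle_words [] = {[]}" by (auto simp: shuffle_words_def)
  moreover have "shuffle_sgn [] = 1" by (simp add: shuffle_sgn_def)
  moreover have "(\<lambda>j\<in>{}. f j) = (\<lambda>_. undefined)" for f :: "nat \<Rightarrow> 'a" by (auto simp: restrict_def)
  ultimately show ?thesis by (simp add: ez_idx_def)
qed

lemma rlin_ez_idx_empty:
  "rlin (ez_idx []) (tens []) = Poly_Mapping.single (0, \<lambda>x\<in>standard_simplex 0. \<lambda>_. undefined) 1"
proof -
  have "rlin (ez_idx []) c = rlin (\<lambda>_. frag_of (0, \<lambda>x\<in>standard_simplex 0. \<lambda>_. undefined)) c"
    if "c = Poly_Mapping.single [] 1" for c :: "'a gsimp list \<Rightarrow>\<^sub>0 'b"
    by (rule rlin_cong) (auto simp: ez_idx_empty that split: if_splits)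
  then show ?thesis by (simp add: rlin_single_one)
qed

lemma capp_0_point:
  "capp 0 v (Poly_Mapping.single (0, \<lambda>x\<in>standard_simplex 0. p) 1)
    = Poly_Mapping.single (0, \<lambda>x\<in>standard_simplex 0. p) (v (0, \<lambda>x\<in>standard_simplex 0. p))"
proof (cases "(1::'b) = 0")
  case True
  \<comment> \<open>The zero ring is allowed; there a chain with coefficient 1 has no keys.\<close>
  then have "v (0, \<lambda>x\<in>standard_simplex 0. p) = 0" by (metis mult.right_neutral mult_zero_right)
  then show ?thesis by (simp add: capp_def True)
next
  case False
  then show ?thesis by (simp add: capp_def seg_0_0)
qed

text \<open>With no trees and leaves, \<open>\<omega>\<^sub>p\<close> is the unit, because the fundamental classes of
  the empty powers of the manifold are both represented by the point itself.\<close>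

lemma is_omega_p_point:
  fixes v :: "(nat \<Rightarrow> 'm, 'r::comm_ring_1) cochain"
  assumes P: "comb_diagram 0 1 1 P" and v: "is_omega_p M \<mu> 0 P v"
  shows "v (0, \<lambda>x\<in>standard_simplex 0. \<lambda>_. undefined) = 1"
proof -
  let ?e = "(\<lambda>_. undefined) :: nat \<Rightarrow> 'm" and ?s = "(0, \<lambda>x\<in>standard_simplex 0. \<lambda>_. undefined) :: (nat \<Rightarrow> 'm) gsimp"
  note t = trees_0_1_1[OF P] lvs_0_1_1[OF P]
  note N = Ntop_0_1_1[OF P]
  have q: "omega_deg M 0 = 0" by (simp add: omega_deg_def)
  \<comment> \<open>Both homologies are taken relative to the empty set, the first because
    \<open>smallN\<close> fills the whole space.\<close>
  obtain y where y: "homol 0 (Mpow M (set (lvs P))) {} y (rlin (ez_idx []) (tens []))"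
    "homol 0 (Ntop M P) {} (capp 0 v y) (push (tree_diagonal P) (rlin (ez_idx []) (tens [])))"
    using v unfolding is_omega_p_def Let_def q t(1) N(2) N(4) by (auto simp: t(2))
  have "y = Poly_Mapping.single ?s 1"
    using homol_0_one_point[OF N(4) y(1)] unfolding rlin_ez_idx_empty .
  moreover have "push (tree_diagonal P) (Poly_Mapping.single ?s 1) = (Poly_Mapping.single ?s 1 :: (_, 'r) gchain)"
  proof -
    have "tree_diagonal P ?e = ?e" by (auto simp: tree_diagonal_def t restrict_def)
    then show ?thesis by (simp add: push_def rlin_single_one gmap_point)
  qed
  ultimately have "Poly_Mapping.single ?s (v ?s) = Poly_Mapping.single ?s 1"
    using homol_0_one_point[OF N(3) y(2)] unfolding rlin_ez_idx_empty by (simp add: capp_0_point)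
  then show ?thesis by (metis lookup_single_eq)
qed

text \<open>Every elementary step restricts to the empty set of leaves and so returns the only
  point. The induction carries membership in \<open>sd_points\<close> along, which excludes prunings
  at each stage.\<close>

lemma nablas_undefined:
  assumes "nablas M 0 1 1 D L D' L' F"
  shows "(D', L') \<in> sd_points 0 1 1 \<and> F (\<lambda>_. undefined) = (\<lambda>_. undefined)"
  using assms
proof induction
  case (2 D L D' L' F D'' L'' F')
  have D: "comb_diagram 0 1 1 D'" "comb_diagram 0 1 1 D''" using 2 by (auto simp: sd_points_def)
  have r: "(\<lambda>j\<in>{}. f j) = (\<lambda>_. undefined)" for f :: "nat \<Rightarrow> 'a" by (auto simp: restrict_def)
  from \<open>nabla1 M D' L' D'' L'' F'\<close> have "F' (\<lambda>_. undefined) = (\<lambda>_. undefined)"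
  proof cases
    case (3 h)
    then show ?thesis using trees_0_1_1[OF D(1)] by (auto elim: pruning.cases)
  qed (simp_all add: lvs_0_1_1[OF D(2)] r)
  then show ?case using 2 by simp
qed simp

text \<open>Being cohomologous in degree zero means agreeing on 0-simplices. The value at p can
  therefore be carried along the evaluation map to the global Thom class, then to the cell of a
  representative, and finally to a zero cell, where it is one.\<close>

lemma diffuse_class_point:
  fixes W :: "('m sdlm, 'r::comm_ring_1) cochain"
  assumes W: "represents_diffuse_class M \<mu> 0 1 1 W" and p: "p \<in> topspace (SDLM M 0 1 1)"
  shows "W (0, \<lambda>x\<in>standard_simplex 0. p) = 1"
proof -
  let ?e = "(\<lambda>_. undefined) :: nat \<Rightarrow> 'm"
  let ?pt = "\<lambda>p. (0, \<lambda>x\<in>standard_simplex 0. p)"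
  have q: "omega_deg M 0 = 0" by (simp add: omega_deg_def)
  obtain w where w: "is_global_thom M \<mu> 0 1 1 w"
    "\<And>\<sigma>. singular_simplex 0 (subtopology (SDLM M 0 1 1) (bigS M 0 1 1)) \<sigma> \<Longrightarrow>
       W (0, \<sigma>) = pullb (ev M 0 1 1) w (0, \<sigma>)"
    using W unfolding represents_diffuse_class_def Let_def q cohomologous_def by auto
  obtain c \<gamma> where c: "p = (c, \<gamma>)" by force
  obtain D L where rep: "sd_rep c = (D, L)" by force
  have "c \<in> topspace (SD 0 1 1)" using p by (simp add: c SDLM_def)
  then have D: "comb_diagram 0 1 1 D" "L \<in> cell D" using p_map_eq(2)[OF _ rep] by (auto simp: sd_points_def)
  have "W (?pt p) = w (?pt (ev M 0 1 1 p))"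
  proof -
    have "singular_simplex 0 (subtopology (SDLM M 0 1 1) (bigS M 0 1 1)) (\<lambda>x\<in>standard_simplex 0. p)"
      by (rule singular_simplex_0I) (use p in \<open>simp add: bigS_0_1_1[unfolded One_nat_def]\<close>)
    then show ?thesis using w(2) by (simp add: pullb_def gmap_point)
  qed
  moreover have "ev M 0 1 1 p = nsd_class M 0 1 1 (D, L, ?e)"
    by (simp add: ev_def c rep lvs_0_1_1[OF D(1)] restrict_def)
  moreover obtain L0 P L' F v where *: "zero_cell 0 1 1 P" "nablas M 0 1 1 D L0 P L' F" "is_omega_p M \<mu> 0 P v"
    "\<And>\<sigma>. singular_simplex 0 (KN M D) \<sigma> \<Longrightarrow>
       pullb (\<lambda>(L, f). nsd_class M 0 1 1 (D, L, f)) w (0, \<sigma>) = pullb (F \<circ> snd) v (0, \<sigma>)"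
    using w(1) D(1) unfolding is_global_thom_def is_omega_K_def q cohomologous_def by auto
  have "(L, ?e) \<in> topspace (KN M D)" using D(2) Ntop_0_1_1(3)[OF D(1), of M] by (simp add: KN_def)
  then have "w (?pt (nsd_class M 0 1 1 (D, L, ?e))) = v (?pt (F ?e))"
    using *(4)[of "\<lambda>x\<in>standard_simplex 0. (L, ?e)"] by (simp add: singular_simplex_0I pullb_def gmap_point)
  moreover have "F ?e = ?e" using nablas_undefined[OF *(2)] by simp
  moreover have "v (?pt ?e) = 1"
    using is_omega_p_point[OF _ *(3)] *(1) by (simp add: zero_cell_def)
  ultimately show ?thesis by simp
qed

lemma finite_shuffle_words: "finite (shuffle_words ns)"
proof (rule finite_subset)
  show "shuffle_words ns \<subseteq> {c. set c \<subseteq> {..<length ns} \<and> length c = (\<Sum>i<length ns. ns ! i)}"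
  proof
    fix c assume c: "c \<in> shuffle_words ns"
    then have "sum (count_list c) {..<length ns} = length c"
      by (intro sum_count_set) (auto simp: shuffle_words_def)
    then show "c \<in> {c. set c \<subseteq> {..<length ns} \<and> length c = (\<Sum>i<length ns. ns ! i)}"
      using c by (auto simp: shuffle_words_def)
  qed
qed (simp add: finite_lists_length_eq)

lemma frag_extend_sum_frag_of:
  "finite I \<Longrightarrow> frag_extend f (\<Sum>i\<in>I. frag_cmul (k i) (frag_of (g i))) = (\<Sum>i\<in>I. frag_cmul (k i) (f (g i)))"
  by (simp add: frag_extend_sum frag_extend_cmul)

section \<open>The push-pull map\<close>

lemma ez_words_degen:
  assumes "c \<in> shuffle_words [m, n]" "x \<in> standard_simplex (length c)"
  shows "degen c 0 x \<in> standard_simplex m" "degen c 1 x \<in> standard_simplex n"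
proof -
  have "\<forall>i<2. count_list c i = [m, n] ! i" using assms(1) by (simp add: shuffle_words_def numeral_2_eq_2)
  then have "count_list c 0 = m" "count_list c 1 = n" by auto
  then show "degen c 0 x \<in> standard_simplex m" "degen c 1 x \<in> standard_simplex n"
    using degen_standard_simplex[OF assms(2)] by metis+
qed

lemma simplex_value:
  "singular_simplex n X \<sigma> \<Longrightarrow> x \<in> standard_simplex n \<Longrightarrow> \<sigma> x \<in> topspace X"
  by (auto simp: singular_simplex_def continuous_map_def)

definition sd_eta_simplex :: "(diagram \<times> lens) set gsimp" where
  "sd_eta_simplex = (1, \<lambda>x\<in>standard_simplex 1. inv_into (topspace (SD 0 1 1)) p_map (frac (x 1)))"

lemma p_inv_eta_eq: "p_inv_eta = Poly_Mapping.single sd_eta_simplex 1"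
proof -
  have "gmap f (1, \<lambda>x\<in>standard_simplex 1. frac (x 1)) = (1, \<lambda>x\<in>standard_simplex 1. f (frac (x 1)))"
    for f :: "real \<Rightarrow> (diagram \<times> lens) set" by (auto simp: gmap_def simplex_map_def fun_eq_iff)
  then show ?thesis
    by (simp add: p_inv_eta_def eta_def push_def rlin_single_one sd_eta_simplex_def)
qed

lemma sd_eta_value:
  assumes "x \<in> standard_simplex 1"
  shows "snd sd_eta_simplex x \<in> topspace (SD 0 1 1)" "p_map (snd sd_eta_simplex x) = frac (x 1)"
proof -
  have "frac (x 1) \<in> p_map ` topspace (SD 0 1 1)" by (rule p_map_surj) (simp add: frac_lt_1)
  then show "snd sd_eta_simplex x \<in> topspace (SD 0 1 1)" "p_map (snd sd_eta_simplex x) = frac (x 1)"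
    using assms by (simp_all add: sd_eta_simplex_def inv_into_into f_inv_into_f)
qed

text \<open>The lookup \<open>[b] ! i\<close> and the product over \<open>{..<1}\<close> are left as
  in \<open>ez_sd\<close>, so that \<open>ez_sd_1\<close> follows by unfolding.\<close>

definition ez_simplex :: "nat list \<Rightarrow> 'a gsimp \<Rightarrow> 'b gsimp \<Rightarrow> ('a \<times> (nat \<Rightarrow> 'b)) gsimp" where
  "ez_simplex c a b = (length c, \<lambda>x\<in>standard_simplex (length c).
     (snd a (degen c 0 x), \<lambda>i\<in>{..<1}. snd ([b] ! i) (degen c (Suc i) x)))"

definition ez2_simplex :: "nat list \<Rightarrow> 'a gsimp \<Rightarrow> 'b gsimp \<Rightarrow> ('a \<times> 'b) gsimp" where
  "ez2_simplex c a b = (length c, \<lambda>x\<in>standard_simplex (length c).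
     (snd a (degen c 0 x), snd b (degen c 1 x)))"

lemma ez_sd_1: "ez_sd 1 (a, [b]) =
    (\<Sum>c\<in>shuffle_words [fst a, fst b]. frag_cmul (shuffle_sgn c) (frag_of (ez_simplex c a b)))"
  by (simp add: ez_sd_def ez_simplex_def)

lemma ez2_eq: "ez2 (a, b) =
    (\<Sum>c\<in>shuffle_words [fst a, fst b]. frag_cmul (shuffle_sgn c) (frag_of (ez2_simplex c a b)))"
  by (simp add: ez2_def ez2_simplex_def)

lemma keys_frag_sum:
  assumes "finite I" "s \<in> Poly_Mapping.keys (\<Sum>i\<in>I. frag_cmul (k i) (frag_of (g i)))"
  shows "\<exists>i\<in>I. s = g i"
proof -
  obtain i where "i \<in> I" "s \<in> Poly_Mapping.keys (frag_cmul (k i) (frag_of (g i)))"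
    using assms keys_sum[of "\<lambda>i. frag_cmul (k i) (frag_of (g i))" I] by blast
  then show ?thesis by (intro bexI[of _ i]) (auto split: if_splits)
qed

text \<open>This places the shuffle simplices inside S, where excision does nothing and the cocycle
  takes the value one.\<close>

lemma ez_simplex_value:
  assumes b: "b \<in> gsing (LM (mtop M))" and c: "c \<in> shuffle_words [1, fst b]"
    and x: "x \<in> standard_simplex (length c)"
  shows "snd (ez_simplex c sd_eta_simplex b) x \<in> topspace (SDLM M 0 1 1)"
proof -
  have "snd b (degen c 1 x) \<in> topspace (LM (mtop M))"
    using simplex_value[of "fst b" "LM (mtop M)" "snd b"] b ez_words_degen(2)[OF c x] by (auto simp: gsing_def)
  then have "(\<lambda>i\<in>{..<1}. snd ([b] ! i) (degen c (Suc i) x)) \<in> topspace (LMpow 1 (mtop M))"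
    by (simp add: LMpow_def PiE_def)
  moreover have "snd sd_eta_simplex (degen c 0 x) \<in> topspace (SD 0 1 1)"
    by (rule sd_eta_value(1)[OF ez_words_degen(1)[OF c x]])
  ultimately show ?thesis using x by (simp add: ez_simplex_def SDLM_def)
qed

text \<open>For a fixed shuffle word the two products differ only in the first factor, a point of
  the moduli space against its image on the circle. As \<open>out_heart\<close> depends on that
  point through \<open>p_map\<close>, which undoes the chosen inverse, both become rotation by the
  same angle.\<close>

lemma aw_out_heart_ez_simplex:
  assumes b: "b \<in> gsing (LM (mtop M))" and c: "c \<in> shuffle_words [1, fst b]"
  shows "aw 1 (gmap (out_heart M) (ez_simplex c sd_eta_simplex b))
    = frag_of [gmap rot (ez2_simplex c (1, \<lambda>x\<in>standard_simplex 1. frac (x 1)) b)]"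
proof -
  let ?n = "length c" and ?\<sigma> = "snd (ez_simplex c sd_eta_simplex b)"
    and ?\<tau> = "snd (ez2_simplex c (1, \<lambda>x\<in>standard_simplex 1. frac (x 1)) b)"
  have "seg 0 ?n (\<lambda>x. simplex_map ?n (out_heart M) ?\<sigma> x 0) = simplex_map ?n rot ?\<tau>"
  proof
    fix x show "seg 0 ?n (\<lambda>x. simplex_map ?n (out_heart M) ?\<sigma> x 0) x = simplex_map ?n rot ?\<tau> x"
    proof (cases "x \<in> standard_simplex ?n")
      case True
      note e = sd_eta_value[OF ez_words_degen(1)[OF c True]]
      have "seg 0 ?n (\<lambda>x. simplex_map ?n (out_heart M) ?\<sigma> x 0) x = out_heart M (?\<sigma> x) 0"
        using True by (simp add: seg_def simplex_map_def)
      also have "\<dots> = rot (frac (degen c 0 x 1), snd b (degen c 1 x))"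
        using True out_heart_eq_rot[OF e(1), of M] e(2) by (simp add: ez_simplex_def)
      also have "\<dots> = simplex_map ?n rot ?\<tau> x"
        using True ez_words_degen(1)[OF c True] by (simp add: simplex_map_def ez2_simplex_def)
      finally show ?thesis .
    qed (simp add: seg_def simplex_map_def)
  qed
  moreover have "fst (ez_simplex c sd_eta_simplex b) = ?n"
    "fst (ez2_simplex c (1, \<lambda>x\<in>standard_simplex 1. frac (x 1)) b) = ?n"
    by (simp_all add: ez_simplex_def ez2_simplex_def)
  ultimately show ?thesis by (simp add: gmap_def aw_1[unfolded One_nat_def] split_beta)
qed

theorem proposition8p13:
  fixes M :: "'m riem"
    and \<mu> :: "'m \<Rightarrow> ('m, 'r::comm_ring_1) gchain"
    and W :: "('m sdlm, 'r) cochain"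
  assumes "closed_riemannian M"
    and "R_orientation M \<mu>"
    and "represents_diffuse_class M \<mu> 0 1 1 W"
  shows "\<forall>\<alpha> \<in> gchains (LM (mtop M)).
    ST M 0 1 1 0 W (tens2 p_inv_eta (tens [\<alpha>])) = tens [BV \<alpha>]"
proof
  fix \<alpha> :: "(real \<Rightarrow> 'm, 'r) gchain"
  assume "\<alpha> \<in> gchains (LM (mtop M))"
  then have \<alpha>: "\<And>b. b \<in> Poly_Mapping.keys \<alpha> \<Longrightarrow> b \<in> gsing (LM (mtop M))" by (auto simp: gchains_def)
  let ?eta = "(1, \<lambda>x\<in>standard_simplex 1. frac (x 1)) :: real gsimp"
  let ?X = "topspace (SDLM M 0 1 1)"
  define C where "C = rlin (ez_sd 1) (tens2 p_inv_eta (tens [\<alpha>]))"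
  have C: "C = rlin (\<lambda>b. ez_sd 1 (sd_eta_simplex, [b])) \<alpha>"
    by (simp only: C_def p_inv_eta_eq tens2_single_left tens_single_list rlin_rlin frag_extend_of)
  have keysC: "\<exists>b c. b \<in> gsing (LM (mtop M)) \<and> c \<in> shuffle_words [1, fst b] \<and> s = ez_simplex c sd_eta_simplex b"
    if "s \<in> Poly_Mapping.keys C" for s
  proof -
    obtain b where b: "b \<in> Poly_Mapping.keys \<alpha>" "s \<in> Poly_Mapping.keys (ez_sd 1 (sd_eta_simplex, [b]))"
      using \<open>s \<in> Poly_Mapping.keys C\<close> keys_rlin unfolding C by fast
    obtain c where "c \<in> shuffle_words [fst sd_eta_simplex, fst b]" "s = ez_simplex c sd_eta_simplex b"
      using keys_frag_sum[OF finite_shuffle_words b(2)[unfolded ez_sd_1]] by blast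
    moreover have "fst sd_eta_simplex = 1" by (simp add: sd_eta_simplex_def)
    ultimately show ?thesis using \<alpha>[OF b(1)] by metis
  qed
  have "rlin (exc_inverse (bigS M 0 1 1) (?X - smallS M 0 1 1)) C = rlin frag_of C"
  proof (rule rlin_cong)
    fix s assume "s \<in> Poly_Mapping.keys C"
    then obtain b c where "b \<in> gsing (LM (mtop M))" "c \<in> shuffle_words [1, fst b]" "s = ez_simplex c sd_eta_simplex b"
      using keysC by blast
    then have "in_set ?X s"
      using ez_simplex_value[of b M c] by (auto simp: in_set_def ez_simplex_def)
    then show "exc_inverse (bigS M 0 1 1) (?X - smallS M 0 1 1) s = frag_of s"
      unfolding bigS_0_1_1 by (rule exc_inverse_in_set)
  qed
  then have exc: "rlin (exc_inverse (bigS M 0 1 1) (?X - smallS M 0 1 1)) C = C" by (simp only: rlin_id)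
  have cap: "capp 0 W C = C"
  proof (rule capp_0)
    fix n \<sigma> assume "(n, \<sigma>) \<in> Poly_Mapping.keys C"
    then obtain b c where bc: "b \<in> gsing (LM (mtop M))" "c \<in> shuffle_words [1, fst b]"
      "(n, \<sigma>) = ez_simplex c sd_eta_simplex b"
      using keysC by blast
    have n: "n = length c" and \<sigma>: "\<sigma> = snd (ez_simplex c sd_eta_simplex b)"
      using bc(3) by (auto simp: ez_simplex_def prod_eq_iff)
    \<comment> \<open>The argument is vertex 0 of the standard simplex, the point at which the
      degree zero cap product evaluates W.\<close>
    have "\<sigma> (\<lambda>j. if j = 0 then 1 else 0) \<in> ?X"
      unfolding \<sigma> by (rule ez_simplex_value[OF bc(1,2)]) simp
    then have "W (0, seg 0 0 \<sigma>) = 1" unfolding seg_0_0 by (rule diffuse_class_point[OF assms(3)])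
    moreover have "\<sigma> \<in> extensional (standard_simplex n)" unfolding \<sigma> n by (simp add: ez_simplex_def)
    ultimately show "\<sigma> \<in> extensional (standard_simplex n) \<and> W (0, seg 0 0 \<sigma>) = 1" by simp
  qed
  have "ST M 0 1 1 0 W (tens2 p_inv_eta (tens [\<alpha>])) = rlin (aw 1) (push (out_heart M) C)"
    unfolding ST_def C_def[symmetric] exc cap ..
  also have "\<dots> = rlin (\<lambda>b. frag_extend (aw 1) (frag_extend (\<lambda>s. frag_of (gmap (out_heart M) s))
      (ez_sd 1 (sd_eta_simplex, [b])))) \<alpha>"
    by (simp only: C push_def rlin_rlin)
  also have "\<dots> = rlin (\<lambda>b. frag_extend (\<lambda>s. frag_of [s]) (frag_extend (\<lambda>s. frag_of (gmap rot s)) (ez2 (?eta, b)))) \<alpha>"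
  proof (rule rlin_cong)
    fix b assume "b \<in> Poly_Mapping.keys \<alpha>"
    then have b: "b \<in> gsing (LM (mtop M))" by (rule \<alpha>)
    have f: "fst sd_eta_simplex = 1" "fst ?eta = 1" by (simp_all add: sd_eta_simplex_def)
    show "frag_extend (aw 1) (frag_extend (\<lambda>s. frag_of (gmap (out_heart M) s)) (ez_sd 1 (sd_eta_simplex, [b])))
        = frag_extend (\<lambda>s. frag_of [s]) (frag_extend (\<lambda>s. frag_of (gmap rot s)) (ez2 (?eta, b)))"
      \<comment> \<open>Both first factors have dimension one, so the sums run over the same words
        with the same signs and are compared term by term.\<close>
      unfolding ez_sd_1 ez2_eq f frag_extend_sum_frag_of[OF finite_shuffle_words]
      by (rule sum.cong[OF refl]) (simp only: aw_out_heart_ez_simplex[OF b])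
  qed
  also have "\<dots> = tens [BV \<alpha>]"
    by (simp only: BV_def eta_def push_def tens2_single_left tens_single_list rlin_rlin frag_extend_of)
  finally show "ST M 0 1 1 0 W (tens2 p_inv_eta (tens [\<alpha>])) = tens [BV \<alpha>]" .
qed

end
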